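(* Let $T>0$, $\omega=2\pi/T$, $\Omega=[-\omega/2,\omega/2)$, and let $p$ be a real-valued $T$-periodic function with Fourier coefficients $\widetilde p_\ell=\frac1T\int_0^T e^{-i\ell\omega x}p(x)\,dx$ satisfying $\sum_{\ell\in\mathbb Z}|\widetilde p_\ell|(1+\ell^2)^{1/4}<\infty$. Let $\mathbf H$ be the Hankel operator on $L^2(\mathbb R_+)$, $(\mathbf Hf)(t)=\int_0^\infty h(t+s)f(s)\,ds$, $h(t)=p(\log t)/t$. Let $\mathcal U:L^2(\mathbb R_+)\to\mathfrak H:=L^2(\Omega;\ell^2(\mathbb Z))$ be the unitary operator $$[(\mathcal Uf)(k)]_m=\frac1{\sqrt{2\pi}}\int_0^\infty f(t)\,t^{-\frac12-ik-i\omega m}\,dt,\quad k\in\Omega,\ m\in\mathbb Z.$$ Then $\mathcal U\mathbf H\mathcal U^*=\int_\Omega^\oplus H(k)\,dk$, where for each $k$ the fiber operator $H(k)$ on $\ell^2(\mathbb Z)$ has the matrix $$[H(k)]_{n,m}=B\big(\tfrac12-i\omega n-ik,\ \tfrac12+i\omega m+ik\big)\,\widetilde p_{n-m},\quad n,m\in\mathbb Z,$$ with $B(z_1,z_2)=\Gamma(z_1)\Gamma(z_2)/\Gamma(z_1+z_2)$; moreover $k\mapsto H(k)$ is a continuous function on $\Omega$ with values in the trace class.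
   Context: $\int_\Omega^\oplus H(k)\,dk$ denotes the decomposable operator on $L^2(\Omega;\ell^2(\mathbb Z))$ acting by $(F)(k)\mapsto H(k)F(k)$. *)

theory Defs
  imports "HOL-Analysis.Analysis"
begin

definition fcoef :: "real \<Rightarrow> (real \<Rightarrow> real) \<Rightarrow> int \<Rightarrow> complex" where
  "fcoef T p l = (1 / of_real T) *
     (LINT x:{0..T}|lborel. exp (- \<i> * of_int l * of_real (2 * pi / T) * of_real x) * of_real (p x))"

definition L2pos :: "(real \<Rightarrow> complex) \<Rightarrow> bool" where
  "L2pos f \<longleftrightarrow> f \<in> borel_measurable lborel \<and>
      set_integrable lborel {0<..} (\<lambda>t. (cmod (f t))\<^sup>2)"

definition hkernel :: "(real \<Rightarrow> real) \<Rightarrow> real \<Rightarrow> complex" where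
  "hkernel p t = of_real (p (ln t) / t)"

definition hankel :: "(real \<Rightarrow> real) \<Rightarrow> (real \<Rightarrow> complex) \<Rightarrow> real \<Rightarrow> complex" where
  "hankel p f t = (LINT s:{0<..}|lborel. hkernel p (t + s) * f s)"

definition Omega :: "real \<Rightarrow> real set" where
  "Omega \<omega> = {- \<omega> / 2 ..< \<omega> / 2}"

definition Utrunc :: "real \<Rightarrow> (real \<Rightarrow> complex) \<Rightarrow> real \<Rightarrow> real \<Rightarrow> int \<Rightarrow> complex" where
  "Utrunc \<omega> f R k m = (1 / of_real (sqrt (2 * pi))) *
     (LINT t:{1/R..R}|lborel.
        f t * (of_real t) powr (- (1/2) - \<i> * of_real k - \<i> * of_real (\<omega> * of_int m)))"

text \<open>\<open>Ueq \<omega> f g\<close>: g is (a representative of) the element U f of L^2(Omega; l^2(Z)),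
  U being defined as the L^2 limit (Plancherel extension) of the truncated integrals.\<close>
definition Ueq :: "real \<Rightarrow> (real \<Rightarrow> complex) \<Rightarrow> (real \<Rightarrow> int \<Rightarrow> complex) \<Rightarrow> bool" where
  "Ueq \<omega> f g \<longleftrightarrow> (\<forall>m. (\<lambda>k. g k m) \<in> borel_measurable lborel) \<and>
     ((\<lambda>R. \<integral>\<^sup>+ k. indicator (Omega \<omega>) k *
              (\<Sum>\<^sub>\<infinity> m. ennreal ((cmod (Utrunc \<omega> f R k m - g k m))\<^sup>2)) \<partial>lborel)
        \<longlongrightarrow> 0) at_top"

definition l2 :: "(int \<Rightarrow> complex) \<Rightarrow> bool" where
  "l2 v \<longleftrightarrow> (\<lambda>n. (cmod (v n))\<^sup>2) summable_on UNIV"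

definition l2inner :: "(int \<Rightarrow> complex) \<Rightarrow> (int \<Rightarrow> complex) \<Rightarrow> complex" where
  "l2inner u v = (\<Sum>\<^sub>\<infinity> n. u n * cnj (v n))"

definition l2norm :: "(int \<Rightarrow> complex) \<Rightarrow> real" where
  "l2norm v = sqrt (\<Sum>\<^sub>\<infinity> n. (cmod (v n))\<^sup>2)"

definition mat_apply :: "(int \<Rightarrow> int \<Rightarrow> complex) \<Rightarrow> (int \<Rightarrow> complex) \<Rightarrow> int \<Rightarrow> complex" where
  "mat_apply M v = (\<lambda>n. \<Sum>\<^sub>\<infinity> m. M n m * v m)"

definition mat_bounded :: "(int \<Rightarrow> int \<Rightarrow> complex) \<Rightarrow> bool" where
  "mat_bounded M \<longleftrightarrow> (\<exists>C. \<forall>v. l2 v \<longrightarrow>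
      (\<forall>n. (\<lambda>m. M n m * v m) summable_on UNIV) \<and> l2 (mat_apply M v) \<and>
      l2norm (mat_apply M v) \<le> C * l2norm v)"

definition orthonormal_fam :: "nat \<Rightarrow> (nat \<Rightarrow> int \<Rightarrow> complex) \<Rightarrow> bool" where
  "orthonormal_fam N e \<longleftrightarrow> (\<forall>j<N. l2 (e j)) \<and>
      (\<forall>i<N. \<forall>j<N. l2inner (e i) (e j) = (if i = j then 1 else 0))"

definition trace_norm :: "(int \<Rightarrow> int \<Rightarrow> complex) \<Rightarrow> ereal" where
  "trace_norm M = (SUP (N, e, f) \<in> {(N, e, f). orthonormal_fam N e \<and> orthonormal_fam N f}.
      ereal (\<Sum>j<N. cmod (l2inner (mat_apply M (e j)) (f j))))"

definition trace_class :: "(int \<Rightarrow> int \<Rightarrow> complex) \<Rightarrow> bool" where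
  "trace_class M \<longleftrightarrow> mat_bounded M \<and> trace_norm M < \<infinity>"

definition Hfiber :: "real \<Rightarrow> (int \<Rightarrow> complex) \<Rightarrow> real \<Rightarrow> int \<Rightarrow> int \<Rightarrow> complex" where
  "Hfiber \<omega> pt k n m =
     Beta (1/2 - \<i> * of_real (\<omega> * of_int n) - \<i> * of_real k)
          (1/2 + \<i> * of_real (\<omega> * of_int m) + \<i> * of_real k) * pt (n - m)"

end

theory Submission
  imports Defs
begin

text \<open>Write \<open>\<xi>\<^sub>n = \<omega> n + k\<close>. The reflection formula turns \<open>\<bar>B(1/2 - i\<xi>\<^sub>n, 1/2 + i\<xi>\<^sub>m)\<bar>\<^sup>2\<close> into
  \<open>\<pi> \<bar>tanh \<pi>\<xi>\<^sub>n - tanh \<pi>\<xi>\<^sub>m\<bar> / \<bar>\<xi>\<^sub>n - \<xi>\<^sub>m\<bar>\<close>, which is exponentially small unless \<open>n\<close> and \<open>m\<close>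
  have opposite signs. Along the diagonal \<open>n - m = l\<close> there are \<open>\<bar>l\<bar>\<close> such pairs, each of size
  \<open>\<bar>l\<bar>\<^bsup>-1/2\<^esup>\<close>; hence the entries of \<open>H(k)\<close> are absolutely summable, uniformly in \<open>k\<close>, and the sum of
  their moduli dominates the trace norm.

  For the diagonalization, \<open>h(t) = \<Sum>\<^sub>l p\<^sub>l t\<^bsup>-1+i\<omega>l\<^esup>\<close>, and the Beta integral gives the Mellin transform of
  \<open>t \<mapsto> (t + s)\<^bsup>-1+i\<omega>l\<^esup>\<close>. To pass from truncated \<open>f\<close> to all of \<open>L\<^sup>2\<close> without Plancherel's theorem, test
  component \<open>n\<close> of both sides against the indicator of an interval in \<open>k\<close>. The test function pulled
  back to the half line is of size \<open>t\<^bsup>-1/2\<^esup> min(1, 1/\<bar>log t\<bar>)\<close>, so it is square integrable, and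
  Hilbert's inequality makes the double integral absolutely convergent: truncating in \<open>t\<close> yields
  \<open>U H f\<close>, truncating in \<open>s\<close> yields \<open>H(k) U f\<close>.\<close>

section \<open>Trace norms of matrices with summable entries\<close>

text \<open>Both transforms are known only as mean-square limits of truncated integrals, and the two
  limits truncate different variables: a cutoff in \<open>t\<close> for the Hankel image and a
  cutoff in \<open>s\<close> for \<open>f\<close> do not correspond to each other. Integration over
  a bounded interval in \<open>k\<close> is continuous for mean-square convergence. It also supplies
  the decay in log t without which the weight t^(-1/2) misses square integrability, logarithmically,
  at both 0 and infinity. Once the double integral converges absolutely, exhausting the quadrant in
  either way gives the same number. The weight (1 + l^2)^(1/4) in the hypothesis matches the size
  |l|^(1/2) of the l-th diagonal. Since \<open>p\<close> is determined by its coefficients only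
  almost everywhere, its expansion enters under the integral sign, for each fixed \<open>t\<close>,
  and not pointwise.\<close>

lemma has_sum_sum:
  fixes f :: "'i \<Rightarrow> 'a \<Rightarrow> 'b :: topological_comm_monoid_add"
  assumes "\<And>i. i \<in> I \<Longrightarrow> (f i has_sum s i) A"
  shows "((\<lambda>x. \<Sum>i\<in>I. f i x) has_sum (\<Sum>i\<in>I. s i)) A"
  using assms
proof (induction I rule: infinite_finite_induct)
  case (insert i I)
  then show ?case by (simp add: has_sum_add)
qed auto

lemma l2_mult_summable:
  assumes "l2 u" "l2 v"
  shows "(\<lambda>n. u n * cnj (v n)) summable_on UNIV"
proof -
  have "(\<lambda>n. ((cmod (u n))\<^sup>2 + (cmod (v n))\<^sup>2)) summable_on UNIV"
    using assms unfolding l2_def by (intro summable_on_add)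
  then have "(\<lambda>n. norm (u n * cnj (v n))) summable_on UNIV"
  proof (rule summable_on_comparison_test)
    fix n
    show "norm (u n * cnj (v n)) \<le> (cmod (u n))\<^sup>2 + (cmod (v n))\<^sup>2"
      using sum_squares_bound[of "cmod (u n)" "cmod (v n)"]
        mult_nonneg_nonneg[OF norm_ge_zero[of "u n"] norm_ge_zero[of "v n"]]
      unfolding norm_mult complex_mod_cnj by linarith
  qed auto
  then show ?thesis by (rule abs_summable_summable)
qed

lemma l2norm_nonneg: "l2norm v \<ge> 0"
  by (simp add: l2norm_def infsum_nonneg)

lemma l2_component_le:
  assumes "l2 v" shows "cmod (v n) \<le> l2norm v"
proof -
  have "(\<Sum>n\<in>{n}. (cmod (v n))\<^sup>2) \<le> (\<Sum>\<^sub>\<infinity> n. (cmod (v n))\<^sup>2)"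
    using assms unfolding l2_def by (intro finite_sum_le_infsum) auto
  then show ?thesis unfolding l2norm_def by (simp add: real_le_rsqrt)
qed

text \<open>For \<open>v = \<Sum>\<^sub>j cnj (e\<^sub>j m) e\<^sub>j\<close> both \<open>v m\<close> and \<open>\<parallel>v\<parallel>\<^sup>2\<close> equal the left-hand side \<open>c\<close>,
  so \<open>c\<^sup>2 \<le> c\<close>.\<close>
lemma bessel_component:
  assumes "orthonormal_fam N e"
  shows "(\<Sum>j<N. (cmod (e j m))\<^sup>2) \<le> 1"
proof -
  define c where "c = (\<Sum>j<N. (cmod (e j m))\<^sup>2)"
  define v where "v = (\<lambda>n. \<Sum>j<N. cnj (e j m) * e j n)"
  have l2e: "l2 (e j)" if "j < N" for j
    using assms that by (auto simp: orthonormal_fam_def)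
  have ip: "l2inner (e i) (e j) = (if i = j then 1 else 0)" if "i < N" "j < N" for i j
    using assms that by (auto simp: orthonormal_fam_def)
  have hs: "((\<lambda>n. e i n * cnj (e j n)) has_sum (if i = j then 1 else 0)) UNIV"
    if "i < N" "j < N" for i j
    using has_sum_infsum[OF l2_mult_summable[OF l2e[OF that(1)] l2e[OF that(2)]]] ip[OF that]
    by (simp add: l2inner_def)
  have vv: "v n * cnj (v n) = (\<Sum>i<N. \<Sum>j<N. (cnj (e i m) * e j m) * (e i n * cnj (e j n)))" for n
    unfolding v_def cnj_sum sum_product
    by (intro sum.cong refl) (simp add: mult_ac)
  have "((\<lambda>n. v n * cnj (v n)) has_sum
      (\<Sum>i<N. \<Sum>j<N. (cnj (e i m) * e j m) * (if i = j then 1 else 0))) UNIV"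
    unfolding vv by (intro has_sum_sum has_sum_cmult_right hs) auto
  also have "(\<Sum>i<N. \<Sum>j<N. (cnj (e i m) * e j m) * (if i = j then 1 else 0)) =
      (\<Sum>i<N. cnj (e i m) * e i m)"
    by (intro sum.cong refl) (simp add: if_distrib sum.delta cong: if_cong)
  also have "\<dots> = of_real c"
    unfolding c_def of_real_sum
    by (intro sum.cong refl) (metis complex_norm_square mult.commute of_real_power)
  finally have "((\<lambda>n. of_real ((cmod (v n))\<^sup>2)) has_sum (of_real c :: complex)) UNIV"
    by (simp only: complex_norm_square)
  from has_sum_Re[OF this] have hv: "((\<lambda>n. (cmod (v n))\<^sup>2) has_sum c) UNIV"
    by simp
  have "(\<Sum>n\<in>{m}. (cmod (v n))\<^sup>2) \<le> c"
    using finite_sum_le_infsum[of "\<lambda>n. (cmod (v n))\<^sup>2" UNIV "{m}"] hv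
    by (auto simp: has_sum_imp_summable dest: infsumI)
  moreover have "v m = of_real c"
    unfolding v_def c_def of_real_sum
    by (intro sum.cong refl) (metis complex_norm_square mult.commute of_real_power)
  ultimately have "c\<^sup>2 \<le> c" by simp
  then show ?thesis unfolding c_def[symmetric]
    using power2_le_imp_le[of c 1] by (cases "c \<le> 1") (auto simp: power2_eq_square)
qed

text \<open>The l1 norm dominates the l2 norm: with \<open>S\<close> the sum of all moduli, every
  \<open>cmod (w n)\<close> is at most \<open>S\<close>, so the sum of squares is at most
  \<open>S * S\<close>.\<close>

lemma l2I_of_bound:
  assumes r: "r summable_on UNIV" and le: "\<And>n. cmod (w n) \<le> r n * C" and C: "C \<ge> 0"
  shows "l2 w" "l2norm w \<le> (\<Sum>\<^sub>\<infinity>n. r n) * C"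
proof -
  define R where "R = (\<Sum>\<^sub>\<infinity>n. r n)"
  have rC: "(\<lambda>n. r n * C) summable_on UNIV" using r by (rule summable_on_cmult_left)
  have sw: "(\<lambda>n. cmod (w n)) summable_on UNIV"
    by (rule summable_on_comparison_test[OF rC]) (use le in auto)
  define S where "S = (\<Sum>\<^sub>\<infinity>n. cmod (w n))"
  have S: "S \<le> R * C" unfolding S_def R_def
    using infsum_mono[OF sw rC] le by (simp add: infsum_cmult_left')
  have wS: "cmod (w n) \<le> S" for n
    using finite_sum_le_infsum[OF sw, of "{n}"] by (simp add: S_def)
  have S0: "S \<ge> 0" using wS[of 0] norm_ge_zero order_trans by blast
  have sS: "(\<lambda>n. S * cmod (w n)) summable_on UNIV" using sw by (rule summable_on_cmult_right)
  have b: "(cmod (w n))\<^sup>2 \<le> S * cmod (w n)" for n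
    using wS[of n] by (simp add: power2_eq_square mult_right_mono)
  have s2: "(\<lambda>n. (cmod (w n))\<^sup>2) summable_on UNIV"
    by (rule summable_on_comparison_test[OF sS]) (use b in auto)
  then show "l2 w" by (simp add: l2_def)
  have "(\<Sum>\<^sub>\<infinity>n. (cmod (w n))\<^sup>2) \<le> S * S"
    using infsum_mono[OF s2 sS] b by (simp add: infsum_cmult_right' S_def)
  then have "l2norm w \<le> S"
    unfolding l2norm_def using S0 by (simp add: real_le_lsqrt power2_eq_square)
  with S show "l2norm w \<le> (\<Sum>\<^sub>\<infinity>n. r n) * C" by (simp add: R_def)
qed

context
  fixes M :: "int \<Rightarrow> int \<Rightarrow> complex"
  assumes M: "(\<lambda>(n,m). cmod (M n m)) summable_on UNIV"
begin

lemma abs_summable_matrix_rows: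
  "(\<lambda>m. cmod (M n m)) summable_on UNIV"
  "(\<lambda>n. \<Sum>\<^sub>\<infinity>m. cmod (M n m)) summable_on UNIV"
proof -
  have M': "(\<lambda>(n,m). cmod (M n m)) summable_on (SIGMA n:UNIV. UNIV)"
    using M by simp
  have 1: "(\<lambda>m. cmod (M n m)) summable_on UNIV" for n
    using summable_on_SigmaD1[OF M', of n] by simp
  then show "(\<lambda>m. cmod (M n m)) summable_on UNIV" .
  show "(\<lambda>n. \<Sum>\<^sub>\<infinity>m. cmod (M n m)) summable_on UNIV"
    using summable_on_Sigma_banach[OF M'] by simp
qed

text \<open>Only a sup bound on \<open>v\<close> enters, so that rows can be applied to vectors such
  as truncated transforms, of which no more than boundedness is established.\<close>

lemma abs_summable_row_mult:
  assumes "\<And>m. cmod (v m) \<le> C"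
  shows "(\<lambda>m. cmod (M n m * v m)) summable_on UNIV"
    and "cmod (mat_apply M v n) \<le> (\<Sum>\<^sub>\<infinity>m. cmod (M n m)) * C"
proof -
  have s: "(\<lambda>m. cmod (M n m) * C) summable_on UNIV"
    using abs_summable_matrix_rows(1) by (rule summable_on_cmult_left)
  have b: "cmod (M n m * v m) \<le> cmod (M n m) * C" for m
    using assms by (simp add: norm_mult mult_left_mono)
  show s': "(\<lambda>m. cmod (M n m * v m)) summable_on UNIV"
    by (rule summable_on_comparison_test[OF s]) (use b in auto)
  have "cmod (mat_apply M v n) \<le> (\<Sum>\<^sub>\<infinity>m. cmod (M n m * v m))"
    unfolding mat_apply_def by (rule norm_infsum_bound[OF s'])
  also have "\<dots> \<le> (\<Sum>\<^sub>\<infinity>m. cmod (M n m) * C)"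
    by (rule infsum_mono[OF s' s b])
  finally show "cmod (mat_apply M v n) \<le> (\<Sum>\<^sub>\<infinity>m. cmod (M n m)) * C"
    by (simp add: infsum_cmult_left')
qed

lemma mat_bounded_of_abs_summable: "mat_bounded M"
  unfolding mat_bounded_def
proof (intro exI[of _ "\<Sum>\<^sub>\<infinity>n. \<Sum>\<^sub>\<infinity>m. cmod (M n m)"] allI impI conjI)
  fix v :: "int \<Rightarrow> complex" assume v: "l2 v"
  note c = l2_component_le[OF v]
  show "(\<lambda>m. M n m * v m) summable_on UNIV" for n
    by (rule abs_summable_summable[OF abs_summable_row_mult(1)[OF c]])
  show "l2 (mat_apply M v)" "l2norm (mat_apply M v) \<le> (\<Sum>\<^sub>\<infinity>n. \<Sum>\<^sub>\<infinity>m. cmod (M n m)) * l2norm v"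
    using l2I_of_bound[OF abs_summable_matrix_rows(2) abs_summable_row_mult(2)[OF c] l2norm_nonneg] by auto
qed

text \<open>After summing over \<open>j\<close>, the entry \<open>M n m\<close> carries the weight
  given by the sum of \<open>cmod (e j m) * cmod (f j n)\<close>. By the arithmetic-geometric mean
  inequality and \<open>bessel_component\<close>, used at the coordinates \<open>m\<close> and
  \<open>n\<close>, this weight is at most 1.\<close>

lemma trace_norm_le_entries: "trace_norm M \<le> ereal (\<Sum>\<^sub>\<infinity>(n,m). cmod (M n m))"
  unfolding trace_norm_def
proof (rule SUP_least, clarify)
  fix N e f assume e: "orthonormal_fam N e" and f: "orthonormal_fam N f"
  have l2e: "l2 (e j)" and l2f: "l2 (f j)" if "j < N" for j
    using e f that by (auto simp: orthonormal_fam_def)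
  \<comment> \<open>This crude bound only justifies the exchange of sums for a single
    \<open>j\<close>; summed over \<open>j\<close> it would grow with \<open>N\<close>.\<close>
  have ef1: "cmod (M n m * e j m * cnj (f j n)) \<le> cmod (M n m) * (l2norm (e j) * l2norm (f j))"
    if "j < N" for j n m
    unfolding norm_mult complex_mod_cnj mult.assoc
    by (intro mult_left_mono mult_mono l2_component_le l2e l2f that) (auto simp: l2norm_nonneg)
  have s: "(\<lambda>(n,m). cmod (M n m * e j m * cnj (f j n))) summable_on UNIV" if j: "j < N" for j
    by (rule summable_on_comparison_test[OF summable_on_cmult_left[OF M, of "l2norm (e j) * l2norm (f j)"]])
      (use ef1[OF j] in auto)
  have le1: "cmod (l2inner (mat_apply M (e j)) (f j)) \<le> (\<Sum>\<^sub>\<infinity>(n,m). cmod (M n m * e j m * cnj (f j n)))"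
    if j: "j < N" for j
  proof -
    have s2: "(\<lambda>(n,m). M n m * e j m * cnj (f j n)) summable_on (SIGMA n:UNIV. UNIV)"
      using abs_summable_summable[of "\<lambda>(n,m). M n m * e j m * cnj (f j n)" UNIV] s[OF j]
      by (simp add: case_prod_unfold)
    have "l2inner (mat_apply M (e j)) (f j) = (\<Sum>\<^sub>\<infinity>n. \<Sum>\<^sub>\<infinity>m. M n m * e j m * cnj (f j n))"
      unfolding l2inner_def mat_apply_def
      by (simp add: infsum_cmult_left')
    also have "\<dots> = (\<Sum>\<^sub>\<infinity>(n,m). M n m * e j m * cnj (f j n))"
      using infsum_Sigma'_banach[OF s2] by simp
    also have "cmod \<dots> \<le> (\<Sum>\<^sub>\<infinity>(n,m). cmod (M n m * e j m * cnj (f j n)))"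
      using norm_infsum_bound[of "\<lambda>(n,m). M n m * e j m * cnj (f j n)" UNIV] s[OF j]
      by (simp add: case_prod_unfold)
    finally show ?thesis .
  qed
  have "(\<Sum>j<N. cmod (l2inner (mat_apply M (e j)) (f j)))
      \<le> (\<Sum>j<N. (\<Sum>\<^sub>\<infinity>(n,m). cmod (M n m * e j m * cnj (f j n))))"
    by (intro sum_mono le1) auto
  also have "\<dots> = (\<Sum>\<^sub>\<infinity>x. \<Sum>j<N. case x of (n,m) \<Rightarrow> cmod (M n m * e j m * cnj (f j n)))"
    by (rule infsumI[symmetric], rule has_sum_sum) (use s in auto)
  also have "\<dots> \<le> (\<Sum>\<^sub>\<infinity>(n,m). cmod (M n m))"
  proof (rule infsum_mono)
    show "(\<lambda>x. \<Sum>j<N. case x of (n,m) \<Rightarrow> cmod (M n m * e j m * cnj (f j n))) summable_on UNIV"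
      by (rule has_sum_imp_summable, rule has_sum_sum, rule has_sum_infsum) (use s in auto)
    show "(\<lambda>(n,m). cmod (M n m)) summable_on UNIV" by (rule M)
    fix x :: "int \<times> int"
    obtain n m where x: "x = (n,m)" by fastforce
    have "(\<Sum>j<N. cmod (e j m) * cmod (f j n)) \<le> (\<Sum>j<N. ((cmod (e j m))\<^sup>2 + (cmod (f j n))\<^sup>2) / 2)"
    proof (rule sum_mono)
      fix j show "cmod (e j m) * cmod (f j n) \<le> ((cmod (e j m))\<^sup>2 + (cmod (f j n))\<^sup>2) / 2"
        using sum_squares_bound[of "cmod (e j m)" "cmod (f j n)"] by simp
    qed
    also have "\<dots> \<le> 1"
      using bessel_component[OF e, of m] bessel_component[OF f, of n]
      by (simp add: sum.distrib sum_divide_distrib[symmetric])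
    finally have "cmod (M n m) * (\<Sum>j<N. cmod (e j m) * cmod (f j n)) \<le> cmod (M n m)"
      by (simp add: mult_left_le)
    then show "(\<Sum>j<N. case x of (n,m) \<Rightarrow> cmod (M n m * e j m * cnj (f j n))) \<le>
        (case x of (n,m) \<Rightarrow> cmod (M n m))"
      by (simp add: x norm_mult sum_distrib_left mult.assoc)
  qed
  finally show "ereal (\<Sum>j<N. cmod (l2inner (mat_apply M (e j)) (f j)))
      \<le> ereal (\<Sum>\<^sub>\<infinity>(n,m). cmod (M n m))" by simp
qed

lemma trace_class_of_abs_summable: "trace_class M"
  unfolding trace_class_def using mat_bounded_of_abs_summable trace_norm_le_entries
  by (metis ereal_infty_less(1) ereal_less_eq(1) less_ereal.simps(4) order_le_less_trans)

end

text \<open>Dominated convergence for double series: outside a finite set \<open>F\<close> of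
  indices the differences sum to less than \<epsilon>/2 for all \<open>k'\<close> at once, and on
  \<open>F\<close> continuity of finitely many entries suffices. The factor 2 arises because the
  majorant bounds the entries at \<open>k'\<close> and at \<open>k\<close>.\<close>

lemma trace_norm_continuous_of_majorant:
  fixes H :: "real \<Rightarrow> int \<Rightarrow> int \<Rightarrow> complex"
  assumes W: "(\<lambda>(n,m). W n m) summable_on UNIV"
    and le: "\<And>k n m. k \<in> S \<Longrightarrow> cmod (H k n m) \<le> W n m"
    and cont: "\<And>n m. continuous_on S (\<lambda>k. H k n m)"
    and k: "k \<in> S" and eps: "\<epsilon> > 0"
  shows "\<exists>\<delta>>0. \<forall>k'\<in>S. \<bar>k' - k\<bar> < \<delta> \<longrightarrow> trace_norm (\<lambda>n m. H k' n m - H k n m) < ereal \<epsilon>"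
proof -
  let ?D = "\<lambda>k' (n,m). cmod (H k' n m - H k n m)"
  have D: "?D k' x \<le> 2 * (case x of (n,m) \<Rightarrow> W n m)" if "k' \<in> S" for k' x
  proof -
    obtain n m where x: "x = (n,m)" by fastforce
    show ?thesis
      using norm_triangle_ineq4[of "H k' n m" "H k n m"] le[OF that, of n m] le[OF k, of n m]
      by (simp add: x)
  qed
  have W2: "(\<lambda>x. 2 * (case x of (n,m) \<Rightarrow> W n m)) summable_on A" for A
    using summable_on_subset_banach[OF W, of A] by (intro summable_on_cmult_right) auto
  have sD: "?D k' summable_on A" if "k' \<in> S" for k' A
    by (rule summable_on_comparison_test[OF W2]) (use D[OF that] in auto)
  have "((\<lambda>F. \<Sum>x\<in>F. 2 * (case x of (n,m) \<Rightarrow> W n m)) \<longlongrightarrow>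
      (\<Sum>\<^sub>\<infinity>x. 2 * (case x of (n,m) \<Rightarrow> W n m))) (finite_subsets_at_top UNIV)"
    using W2[of UNIV] by (rule infsum_tendsto)
  then have "\<forall>\<^sub>F F in finite_subsets_at_top UNIV. (\<Sum>\<^sub>\<infinity>x. 2 * (case x of (n,m) \<Rightarrow> W n m)) - \<epsilon>/2 <
      (\<Sum>x\<in>F. 2 * (case x of (n,m) \<Rightarrow> W n m))"
    by (rule order_tendstoD) (use eps in auto)
  then obtain F where F: "finite F" and F2: "(\<Sum>\<^sub>\<infinity>x. 2 * (case x of (n,m) \<Rightarrow> W n m)) - \<epsilon>/2 <
      (\<Sum>x\<in>F. 2 * (case x of (n,m) \<Rightarrow> W n m))"
    unfolding eventually_finite_subsets_at_top by blast
  have tail: "(\<Sum>\<^sub>\<infinity>x\<in>-F. 2 * (case x of (n,m) \<Rightarrow> W n m)) < \<epsilon>/2"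
    using F2 infsum_Un_disjoint[of "\<lambda>x. 2 * (case x of (n,m) \<Rightarrow> W n m)" F "-F"] W2 F by simp
  have ck: "((\<lambda>k'. H k' n m) \<longlongrightarrow> H k n m) (at k within S)" for n m
    using cont k by (auto simp: continuous_on_def)
  have "((\<lambda>k'. \<Sum>x\<in>F. ?D k' x) \<longlongrightarrow> (\<Sum>x\<in>F. ?D k x)) (at k within S)"
    unfolding case_prod_unfold by (intro tendsto_intros ck)
  then have "((\<lambda>k'. \<Sum>x\<in>F. ?D k' x) \<longlongrightarrow> 0) (at k within S)" by (simp add: case_prod_unfold)
  then have "\<forall>\<^sub>F k' in at k within S. (\<Sum>x\<in>F. ?D k' x) < \<epsilon>/2"
    by (rule order_tendstoD) (use eps in auto)
  then obtain \<delta> where \<delta>: "\<delta> > 0" "\<And>k'. k' \<in> S \<Longrightarrow> k' \<noteq> k \<Longrightarrow> \<bar>k' - k\<bar> < \<delta> \<Longrightarrow> (\<Sum>x\<in>F. ?D k' x) < \<epsilon>/2"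
    unfolding eventually_at by (auto simp: dist_real_def)
  show ?thesis
  proof (intro exI[of _ \<delta>] conjI ballI impI \<delta>(1))
    fix k' assume k': "k' \<in> S" "\<bar>k' - k\<bar> < \<delta>"
    \<comment> \<open>The filter \<open>at k within S\<close> says nothing about
      \<open>k' = k\<close>, where every term vanishes.\<close>
    have 1: "(\<Sum>x\<in>F. ?D k' x) < \<epsilon>/2"
      using \<delta>(2)[OF k'(1) _ k'(2)] eps by (cases "k' = k") (auto simp: case_prod_unfold)
    have "(\<Sum>\<^sub>\<infinity>x\<in>-F. ?D k' x) \<le> (\<Sum>\<^sub>\<infinity>x\<in>-F. 2 * (case x of (n,m) \<Rightarrow> W n m))"
      by (rule infsum_mono[OF sD[OF k'(1)] W2 D[OF k'(1)]])
    then have "(\<Sum>\<^sub>\<infinity>x. ?D k' x) < \<epsilon>"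
      using infsum_Un_disjoint[OF sD[OF k'(1)] sD[OF k'(1)], of F "-F"] F 1 tail by simp
    moreover have "trace_norm (\<lambda>n m. H k' n m - H k n m) \<le> ereal (\<Sum>\<^sub>\<infinity>x. ?D k' x)"
      using trace_norm_le_entries[OF sD[OF k'(1)]] .
    ultimately show "trace_norm (\<lambda>n m. H k' n m - H k n m) < ereal \<epsilon>"
      using order_le_less_trans by fastforce
  qed
qed

section \<open>A summable majorant for the fiber matrices\<close>

text \<open>On the line Re z = 1/2 conjugation is z -> 1 - z, so the squared modulus is Gamma z *
  Gamma (1 - z), which the reflection formula evaluates.\<close>

lemma cmod_Gamma_half:
  "(cmod (Gamma (1/2 + \<i> * of_real y)))\<^sup>2 = pi / cosh (pi * y)"
proof -
  define z where "z = 1/2 + \<i> * complex_of_real y"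
  have "cnj z = 1 - z" by (simp add: z_def complex_eq_iff)
  then have "complex_of_real ((cmod (Gamma z))\<^sup>2) = Gamma z * Gamma (1 - z)"
    by (simp only: complex_norm_square cnj_Gamma)
  also have "\<dots> = of_real pi / sin (of_real pi * z)" by (rule Gamma_reflection_complex)
  also have "of_real pi * z = \<i> * of_real (pi * y) + of_real pi / 2"
    by (simp add: z_def algebra_simps)
  also have "sin \<dots> = cosh (of_real (pi * y))"
    by (simp add: sin_add cosh_conv_cos)
  also have "\<dots> = of_real (cosh (pi * y))" unfolding cosh_def by (simp add: exp_of_real[symmetric] scaleR_conv_of_real)
  finally show ?thesis unfolding z_def by (metis of_real_divide of_real_eq_iff)
qed

text \<open>Reflection again, after Gamma (1 + z) = z * Gamma z. The product form includes y = 0,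
  where the quotient by sinh would be 0 / 0.\<close>

lemma cmod_Gamma_one:
  "(cmod (Gamma (1 + \<i> * of_real y)))\<^sup>2 * sinh (pi * y) = pi * y"
proof (cases "y = 0")
  case False
  define z where "z = \<i> * complex_of_real y"
  have z: "z \<noteq> 0" "z \<notin> \<int>\<^sub>\<le>\<^sub>0" using False by (auto simp: z_def complex_eq_iff elim!: nonpos_Ints_cases)
  have "cnj (1 + z) = 1 - z" by (simp add: z_def complex_eq_iff)
  then have "complex_of_real ((cmod (Gamma (1 + z)))\<^sup>2) = Gamma (1 + z) * Gamma (1 - z)"
    by (simp only: complex_norm_square cnj_Gamma)
  also have "\<dots> = z * (Gamma z * Gamma (1 - z))" using Gamma_plus1[OF z(2)] by (simp add: add.commute)
  also have "\<dots> = z * (of_real pi / sin (of_real pi * z))" by (simp only: Gamma_reflection_complex)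
  also have "of_real pi * z = \<i> * of_real (pi * y)" by (simp add: z_def)
  also have "sin \<dots> = \<i> * sinh (of_real (pi * y))"
    by (simp add: sinh_conv_sin)
  also have "sinh (complex_of_real (pi * y)) = of_real (sinh (pi * y))" unfolding sinh_def by (simp add: exp_of_real[symmetric] scaleR_conv_of_real)
  also have "z * (of_real pi / (\<i> * of_real (sinh (pi * y)))) = of_real (pi * y / sinh (pi * y))"
    by (simp add: z_def)
  finally have "(cmod (Gamma (1 + z)))\<^sup>2 = pi * y / sinh (pi * y)" by (metis of_real_eq_iff)
  then show ?thesis using False by (simp add: z_def)
qed auto

text \<open>The two arguments add up to 1 + iy with y = \<eta> - \<xi>, so all three Gamma moduli
  are explicit, and sinh (a - b) / (cosh a * cosh b) = tanh a - tanh b. For \<xi> = \<eta> the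
  identity reads 0 = 0 and carries no information.\<close>

lemma cmod_Beta_tanh:
  fixes \<xi> \<eta> :: real
  shows "(cmod (Beta (1/2 - \<i> * of_real \<xi>) (1/2 + \<i> * of_real \<eta>)))\<^sup>2 * \<bar>\<xi> - \<eta>\<bar> =
     pi * \<bar>tanh (pi * \<xi>) - tanh (pi * \<eta>)\<bar>"
proof (cases "\<xi> = \<eta>")
  case False
  define y where "y = \<eta> - \<xi>"
  have y: "y \<noteq> 0" using False by (simp add: y_def)
  have ab: "(1/2 - \<i> * of_real \<xi>) + (1/2 + \<i> * of_real \<eta>) = 1 + \<i> * of_real y"
    by (simp add: y_def algebra_simps)
  have A: "(cmod (Gamma (1/2 - \<i> * of_real \<xi>)))\<^sup>2 = pi / cosh (pi * \<xi>)"
    using cmod_Gamma_half[of "-\<xi>"] by simp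
  have B: "(cmod (Gamma (1/2 + \<i> * of_real \<eta>)))\<^sup>2 = pi / cosh (pi * \<eta>)"
    using cmod_Gamma_half[of \<eta>] by simp
  have C: "(cmod (Gamma (1 + \<i> * of_real y)))\<^sup>2 = pi * y / sinh (pi * y)"
    using cmod_Gamma_one[of y] y by (simp add: field_simps)
  have t: "tanh (pi * \<eta>) - tanh (pi * \<xi>) = sinh (pi * y) / (cosh (pi * \<xi>) * cosh (pi * \<eta>))"
    unfolding y_def right_diff_distrib sinh_diff tanh_def by (simp add: field_simps)
  have "(cmod (Beta (1/2 - \<i> * of_real \<xi>) (1/2 + \<i> * of_real \<eta>)))\<^sup>2 =
     pi / cosh (pi * \<xi>) * (pi / cosh (pi * \<eta>)) / (pi * y / sinh (pi * y))"
    unfolding Beta_def ab norm_divide norm_mult power_divide power_mult_distrib A B C ..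
  also have "\<dots> = pi * ((tanh (pi * \<eta>) - tanh (pi * \<xi>)) / y)"
    unfolding t using y by (simp add: field_simps)
  \<comment> \<open>The quotient has no sign to discuss: it has just been shown to be a
    square.\<close>
  also have "\<dots> = \<bar>\<dots>\<bar>" unfolding calculation[symmetric] by simp
  also have "\<dots> = pi * (\<bar>tanh (pi * \<xi>) - tanh (pi * \<eta>)\<bar> / \<bar>y\<bar>)"
    by (simp add: abs_mult abs_minus_commute)
  finally show ?thesis using y by (simp add: y_def abs_minus_commute)
qed auto

text \<open>The case on which \<open>cmod_Beta_tanh\<close> is silent. The denominator is Gamma 1 =
  1, the modulus equals pi / cosh (pi \<xi>), and cosh x is at least exp |x| / 2.\<close>

lemma cmod_Beta_diag:
  "cmod (Beta (1/2 - \<i> * of_real \<xi>) (1/2 + \<i> * of_real \<xi>)) \<le> 2 * pi * exp (- pi * \<bar>\<xi>\<bar>)"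
proof -
  have A: "(cmod (Gamma (1/2 - \<i> * of_real \<xi>)))\<^sup>2 = pi / cosh (pi * \<xi>)"
    using cmod_Gamma_half[of "-\<xi>"] by simp
  have B: "(cmod (Gamma (1/2 + \<i> * of_real \<xi>)))\<^sup>2 = pi / cosh (pi * \<xi>)"
    using cmod_Gamma_half[of \<xi>] by simp
  have "(cmod (Beta (1/2 - \<i> * of_real \<xi>) (1/2 + \<i> * of_real \<xi>)))\<^sup>2 = (pi / cosh (pi * \<xi>))\<^sup>2"
    unfolding Beta_def norm_divide norm_mult power_divide power_mult_distrib A B
    by (simp add: power2_eq_square)
  then have "cmod (Beta (1/2 - \<i> * of_real \<xi>) (1/2 + \<i> * of_real \<xi>)) = pi / cosh (pi * \<xi>)"
    by (rule power2_eq_imp_eq) auto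
  also have "\<dots> = pi / cosh \<bar>pi * \<xi>\<bar>" by simp
  also have "\<dots> \<le> pi / (exp \<bar>pi * \<xi>\<bar> / 2)"
    by (intro divide_left_mono mult_pos_pos) (auto simp: cosh_def add_pos_pos)
  finally show ?thesis by (simp add: exp_minus abs_mult field_simps)
qed

section \<open>Comparison of tanh with the sign of the index\<close>

lemma tanh_minus_one_bound: "x \<ge> 0 \<Longrightarrow> \<bar>tanh x - 1\<bar> \<le> 2 * exp (- 2 * x)" for x :: real
proof -
  have "tanh x - 1 = - (2 * exp (- 2 * x)) / (1 + exp (- 2 * x))"
    unfolding tanh_real_altdef by (simp add: field_simps add_nonneg_eq_0_iff)
  then have "\<bar>tanh x - 1\<bar> = 2 * exp (- 2 * x) / (1 + exp (- 2 * x))" by (simp add: abs_mult)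
  also have "\<dots> \<le> 2 * exp (- 2 * x) / 1" by (intro divide_left_mono) (auto simp: add_pos_pos)
  finally show ?thesis by simp
qed

text \<open>For nonzero \<open>n\<close> the point \<omega> n + k lies at distance at least \<omega>
  |n| - \<omega>/2, hence at least \<omega> |n| / 2, from 0. For n = 0 the sign of the point is
  unknown, but the right-hand side is 2 and exceeds the distance of tanh from 1.\<close>

lemma tanh_step_bound:
  fixes \<omega> k :: real and n :: int
  assumes \<omega>: "\<omega> > 0" and k: "\<bar>k\<bar> \<le> \<omega> / 2"
  shows "\<bar>tanh (pi * (\<omega> * n + k)) - (if n \<ge> 0 then 1 else - 1)\<bar> \<le> 2 * exp (- pi * \<omega> * \<bar>n\<bar>)"
proof -
  have low: "\<omega> * \<bar>n\<bar> / 2 \<le> \<omega> * \<bar>n\<bar> - \<omega> / 2" if "n \<noteq> 0"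
  proof -
    have "1 \<le> \<bar>real_of_int n\<bar>" using that by linarith
    then have "\<omega> * 1 \<le> \<omega> * \<bar>n\<bar>" using \<omega> by (intro mult_left_mono) auto
    then show ?thesis by simp
  qed
  consider "n = 0" | "n > 0" | "n < 0" by linarith
  then show ?thesis
  proof cases
    case 1
    then show ?thesis using tanh_real_bounds[of "pi * k"] by auto
  next
    case 2
    have "pi * (\<omega> * \<bar>n\<bar> / 2) \<le> pi * (\<omega> * n + k)" using low 2 k by (intro mult_left_mono) auto
    moreover have "0 \<le> pi * (\<omega> * \<bar>n\<bar> / 2)" using \<omega> by simp
    ultimately show ?thesis
      using tanh_minus_one_bound[of "pi * (\<omega> * n + k)"] 2
      by (auto elim!: order_trans simp: algebra_simps)
  next
    case 3
    have "pi * (\<omega> * \<bar>n\<bar> / 2) \<le> pi * (- (\<omega> * n + k))" using low 3 k by (intro mult_left_mono) auto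
    moreover have "0 \<le> pi * (\<omega> * \<bar>n\<bar> / 2)" using \<omega> by simp
    moreover have "tanh (pi * (\<omega> * n + k)) = - tanh (pi * (- (\<omega> * n + k)))"
      by (metis mult_minus_right tanh_minus minus_minus)
    ultimately show ?thesis
      using tanh_minus_one_bound[of "pi * (- (\<omega> * n + k))"] 3
      by (auto elim!: order_trans simp: algebra_simps abs_minus_commute)
  qed
qed

text \<open>\<open>beta_major \<omega> l n\<close> dominates the Beta factor of the matrix entry \<open>(n, n - l)\<close> uniformly in the
  quasimomentum. Only the \<open>\<bar>l\<bar>\<close> indices \<open>n\<close> where \<open>n\<close> and \<open>n - l\<close> have opposite signs carry no
  exponential decay, so the sum over \<open>n\<close> is of order \<open>\<bar>l\<bar> / sqrt \<bar>l\<bar>\<close>.\<close>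
definition beta_major :: "real \<Rightarrow> int \<Rightarrow> int \<Rightarrow> real" where
  "beta_major \<omega> l n = (if l = 0 then 2 * pi * exp (- pi * \<omega> / 2) ^ nat \<bar>n\<bar>
     else sqrt (pi / (\<omega> * \<bar>l\<bar>)) * sqrt 2 * (exp (- pi * \<omega> / 2) ^ nat \<bar>n\<bar> + exp (- pi * \<omega> / 2) ^ nat \<bar>n - l\<bar>
        + indicator ({0..<l} \<union> {l..<0}) n))"

text \<open>The exponential form is what the estimates produce, the power form is what the geometric
  series sums.\<close>

lemma exp_power_nat_abs: "exp (- pi * \<omega> / 2) ^ nat \<bar>n\<bar> = exp (- pi * \<omega> * \<bar>real_of_int n\<bar> / 2)"
proof -
  have "real (nat \<bar>n\<bar>) = \<bar>real_of_int n\<bar>" by simp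
  then show ?thesis unfolding exp_of_nat_mult[symmetric] by (simp add: algebra_simps)
qed

text \<open>Off the diagonal, tanh is replaced by the sign at both indices and the square root is
  split by subadditivity. The root halves the exponents, whence the base exp (- pi \<omega> / 2). On
  the diagonal the same base comes from |\<omega> n + k| >= \<omega> |n| / 2.\<close>

lemma cmod_Beta_le_major:
  fixes \<omega> k :: real and n l :: int
  assumes \<omega>: "\<omega> > 0" and k: "\<bar>k\<bar> \<le> \<omega> / 2"
  shows "cmod (Beta (1/2 - \<i> * of_real (\<omega> * n + k)) (1/2 + \<i> * of_real (\<omega> * (n - l) + k))) \<le> beta_major \<omega> l n"
proof (cases "l = 0")
  case True
  have "\<omega> * \<bar>n\<bar> / 2 \<le> \<bar>\<omega> * n + k\<bar>"
  proof (cases "n = 0")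
    case False
    then have "1 \<le> \<bar>real_of_int n\<bar>" by linarith
    then have "\<omega> * 1 \<le> \<omega> * \<bar>n\<bar>" using \<omega> by (intro mult_left_mono) auto
    moreover have "\<bar>\<omega> * n\<bar> - \<bar>k\<bar> \<le> \<bar>\<omega> * n + k\<bar>" by linarith
    moreover have "\<bar>\<omega> * n\<bar> = \<omega> * \<bar>n\<bar>" using \<omega> by (simp add: abs_mult)
    ultimately show ?thesis using k by linarith
  qed auto
  then have "pi * (\<omega> * \<bar>n\<bar> / 2) \<le> pi * \<bar>\<omega> * n + k\<bar>" by (intro mult_left_mono) auto
  then have "exp (- pi * \<bar>\<omega> * n + k\<bar>) \<le> exp (- pi * \<omega> * \<bar>real_of_int n\<bar> / 2)" by (simp add: algebra_simps)
  then show ?thesis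
    using cmod_Beta_diag[of "\<omega> * n + k"] True unfolding beta_major_def exp_power_nat_abs
    by (auto elim!: order_trans)
next
  case False
  define \<sigma> where "\<sigma> = (\<lambda>n::int. if n \<ge> 0 then 1 else (-1::real))"
  define X where "X = cmod (Beta (1/2 - \<i> * of_real (\<omega> * n + k)) (1/2 + \<i> * of_real (\<omega> * (n - l) + k)))"
  have e: "sqrt (2 * exp (- pi * \<omega> * \<bar>j\<bar>)) = sqrt 2 * exp (- pi * \<omega> / 2) ^ nat \<bar>j\<bar>" for j :: int
    unfolding exp_power_nat_abs real_sqrt_mult
    by (simp add: real_sqrt_unique power2_eq_square exp_add[symmetric])
  have ind: "sqrt (2 * indicator A n) = sqrt 2 * indicator A n" for A
    by (simp add: indicator_def)
  have "X\<^sup>2 * (\<omega> * \<bar>l\<bar>) = pi * \<bar>tanh (pi * (\<omega> * n + k)) - tanh (pi * (\<omega> * (n - l) + k))\<bar>"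
    using cmod_Beta_tanh[of "\<omega> * n + k" "\<omega> * (n - l) + k"] \<omega>
    unfolding X_def by (simp add: algebra_simps abs_mult)
  then have X2: "X\<^sup>2 = pi / (\<omega> * \<bar>l\<bar>) * \<bar>tanh (pi * (\<omega> * n + k)) - tanh (pi * (\<omega> * (n - l) + k))\<bar>"
    using \<omega> False by (simp add: field_simps)
  have "\<bar>tanh (pi * (\<omega> * n + k)) - tanh (pi * (\<omega> * (n - l) + k))\<bar> \<le>
     2 * exp (- pi * \<omega> * \<bar>n\<bar>) + 2 * exp (- pi * \<omega> * \<bar>n - l\<bar>) + \<bar>\<sigma> n - \<sigma> (n - l)\<bar>"
    using tanh_step_bound[OF \<omega> k, of n] tanh_step_bound[OF \<omega> k, of "n - l"]
    unfolding \<sigma>_def of_int_diff by linarith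
  \<comment> \<open>The signs differ when n >= 0 > n - l, that is 0 <= n < l, or when n < 0 <= n -
    l, that is l <= n < 0.\<close>
  also have "\<bar>\<sigma> n - \<sigma> (n - l)\<bar> = 2 * indicator ({0..<l} \<union> {l..<0}) n"
    by (auto simp: \<sigma>_def indicator_def)
  finally have b: "\<bar>tanh (pi * (\<omega> * n + k)) - tanh (pi * (\<omega> * (n - l) + k))\<bar> \<le>
     2 * exp (- pi * \<omega> * \<bar>n\<bar>) + 2 * exp (- pi * \<omega> * \<bar>n - l\<bar>) + 2 * indicator ({0..<l} \<union> {l..<0}) n" .
  have "X = sqrt (X\<^sup>2)" by (simp add: X_def)
  also have "\<dots> \<le> sqrt (pi / (\<omega> * \<bar>l\<bar>) * (2 * exp (- pi * \<omega> * \<bar>n\<bar>) + 2 * exp (- pi * \<omega> * \<bar>n - l\<bar>) + 2 * indicator ({0..<l} \<union> {l..<0}) n))"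
    unfolding X2 using b \<omega> by (intro real_sqrt_le_mono mult_left_mono) auto
  also have "\<dots> = sqrt (pi / (\<omega> * \<bar>l\<bar>)) * sqrt (2 * exp (- pi * \<omega> * \<bar>n\<bar>) + 2 * exp (- pi * \<omega> * \<bar>n - l\<bar>) + 2 * indicator ({0..<l} \<union> {l..<0}) n)"
    by (rule real_sqrt_mult)
  also have "\<dots> \<le> sqrt (pi / (\<omega> * \<bar>l\<bar>)) * (sqrt (2 * exp (- pi * \<omega> * \<bar>n\<bar>)) + sqrt (2 * exp (- pi * \<omega> * \<bar>n - l\<bar>)) + sqrt (2 * indicator ({0..<l} \<union> {l..<0}) n))"
    using \<omega> by (intro mult_left_mono order_trans[OF sqrt_add_le_add_sqrt] add_mono order_refl) auto
  also have "\<dots> = beta_major \<omega> l n"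
    unfolding beta_major_def e[of n] e[of "n - l"] ind using False by (simp add: algebra_simps)
  finally show ?thesis unfolding X_def .
qed

section \<open>Summing the majorant along diagonals\<close>

lemma summable_on_power_nat_abs:
  fixes x :: real
  assumes "0 \<le> x" "x < 1"
  shows "(\<lambda>n::int. x ^ nat \<bar>n\<bar>) summable_on UNIV"
proof -
  have g: "(\<lambda>n. x ^ n) summable_on (UNIV :: nat set)"
    using assms by (intro norm_summable_imp_summable_on) (simp add: summable_geometric)
  have 1: "(\<lambda>n::int. x ^ nat \<bar>n\<bar>) summable_on range int"
    using g by (subst summable_on_reindex) (auto simp: o_def inj_on_def)
  have 2: "(\<lambda>n::int. x ^ nat \<bar>n\<bar>) summable_on range (\<lambda>n. - int n)"
    using g by (subst summable_on_reindex) (auto simp: o_def inj_on_def)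
  have U: "(UNIV :: int set) = range int \<union> range (\<lambda>n. - int n)"
  proof -
    have "n \<in> range int \<union> range (\<lambda>n. - int n)" for n
      by (cases n rule: int_cases2) auto
    then show ?thesis by blast
  qed
  show ?thesis unfolding U by (rule summable_on_union[OF 1 2])
qed

lemma beta_major_nonneg: "\<omega> > 0 \<Longrightarrow> beta_major \<omega> l n \<ge> 0"
  by (simp add: beta_major_def)

text \<open>For l nonzero the sum is a constant times (2 Z + |l|) / sqrt |l|, where \<open>Z\<close>
  is the two-sided geometric sum. As |l| >= 1, this is at most a constant times sqrt |l|, which is
  (l^2)^(1/4).\<close>

lemma beta_major_sum:
  assumes \<omega>: "\<omega> > 0"
  obtains C where "C \<ge> 0" "\<And>l. beta_major \<omega> l summable_on UNIV"
    "\<And>l. (\<Sum>\<^sub>\<infinity>n. beta_major \<omega> l n) \<le> C * (1 + (real_of_int l)\<^sup>2) powr (1/4)"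
proof -
  define x where "x = exp (- pi * \<omega> / 2)"
  define Z where "Z = (\<Sum>\<^sub>\<infinity>n::int. x ^ nat \<bar>n\<bar>)"
  have x: "0 \<le> x" "x < 1" using \<omega> by (auto simp: x_def)
  have h1: "((\<lambda>n::int. x ^ nat \<bar>n\<bar>) has_sum Z) UNIV"
    unfolding Z_def by (rule has_sum_infsum[OF summable_on_power_nat_abs[OF x]])
  have h2: "((\<lambda>n::int. x ^ nat \<bar>n - l\<bar>) has_sum Z) UNIV" for l
  proof -
    have "bij_betw (\<lambda>n::int. n - l) UNIV UNIV" by (rule bij_betwI[of _ _ _ "\<lambda>n. n + l"]) auto
    from has_sum_reindex_bij_betw[OF this, of "\<lambda>n. x ^ nat \<bar>n\<bar>" Z] h1 show ?thesis by simp
  qed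
  have h3: "((\<lambda>n. indicator ({0..<l} \<union> {l..<0}) n :: real) has_sum \<bar>l\<bar>) UNIV" for l :: int
  proof -
    have "((\<lambda>n. 1 :: real) has_sum (\<Sum>n\<in>{0..<l} \<union> {l..<0}. 1)) ({0..<l} \<union> {l..<0})"
      by (rule has_sum_finite) auto
    also have "(\<Sum>n\<in>{0..<l} \<union> {l..<0}. 1 :: real) = \<bar>l\<bar>"
      by (subst sum.union_disjoint) auto
    also have "((\<lambda>n. 1 :: real) has_sum \<bar>l\<bar>) ({0..<l} \<union> {l..<0}) \<longleftrightarrow>
        ((\<lambda>n. indicator ({0..<l} \<union> {l..<0}) n :: real) has_sum \<bar>l\<bar>) UNIV"
      by (rule has_sum_cong_neutral) (auto simp: indicator_def)
    finally show ?thesis .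
  qed
  have Z0: "Z \<ge> 0" unfolding Z_def using x by (intro infsum_nonneg) auto
  \<comment> \<open>One summand serves l = 0, the other l nonzero; their sum covers both cases with
    one constant.\<close>
  define C where "C = 2 * pi * Z + sqrt (pi / \<omega>) * sqrt 2 * (2 * Z + 1)"
  have hs: "(beta_major \<omega> l has_sum (if l = 0 then 2 * pi * Z else
     sqrt (pi / (\<omega> * \<bar>l\<bar>)) * sqrt 2 * (Z + Z + \<bar>l\<bar>))) UNIV" for l
    unfolding beta_major_def x_def[symmetric]
    using has_sum_cmult_right[OF h1, of "2 * pi"]
      has_sum_cmult_right[OF has_sum_add[OF has_sum_add[OF h1 h2[of l]] h3[of l]], of "sqrt (pi / (\<omega> * \<bar>l\<bar>)) * sqrt 2"]
    by (cases "l = 0") auto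
  show ?thesis
  proof (rule that[of C])
    show "C \<ge> 0" using Z0 \<omega> by (simp add: C_def)
    fix l
    show "beta_major \<omega> l summable_on UNIV" using hs by (rule has_sum_imp_summable)
    have p1: "(1 + (real_of_int l)\<^sup>2) powr (1/4) \<ge> 1" by (simp add: ge_one_powr_ge_zero)
    show "(\<Sum>\<^sub>\<infinity>n. beta_major \<omega> l n) \<le> C * (1 + (real_of_int l)\<^sup>2) powr (1/4)"
    proof (cases "l = 0")
      case True
      then have "(\<Sum>\<^sub>\<infinity>n. beta_major \<omega> l n) = 2 * pi * Z" using infsumI[OF hs[of l]] by simp
      also have "\<dots> \<le> C" using Z0 \<omega> by (simp add: C_def)
      finally show ?thesis using True by simp
    next
      case False
      define L where "L = \<bar>real_of_int l\<bar>"
      have L: "L \<ge> 1" unfolding L_def using False by linarith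
      have "(\<Sum>\<^sub>\<infinity>n. beta_major \<omega> l n) = sqrt (pi / (\<omega> * L)) * sqrt 2 * (Z + Z + L)"
        using infsumI[OF hs[of l]] False by (simp add: L_def)
      also have "\<dots> = sqrt (pi / \<omega>) * sqrt 2 * ((2 * Z + L) / sqrt L)"
        by (simp add: real_sqrt_divide real_sqrt_mult)
      also have "\<dots> \<le> sqrt (pi / \<omega>) * sqrt 2 * ((2 * Z + 1) * sqrt L)"
      proof (intro mult_left_mono)
        have "2 * Z + L \<le> (2 * Z + 1) * L" using mult_left_mono[OF L, of Z] Z0 by (simp add: algebra_simps)
        also have "\<dots> = (2 * Z + 1) * sqrt L * sqrt L" using L by simp
        finally show "(2 * Z + L) / sqrt L \<le> (2 * Z + 1) * sqrt L"
          using L by (simp add: divide_le_eq)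
      qed (use \<omega> in auto)
      also have "\<dots> \<le> C * sqrt L" using Z0 L \<omega> by (simp add: C_def algebra_simps)
      also have "sqrt L \<le> (1 + (real_of_int l)\<^sup>2) powr (1/4)"
      proof -
        have "sqrt L = (L powr 2) powr (1/4)" using L unfolding powr_powr by (simp add: powr_half_sqrt)
        also have "\<dots> \<le> (1 + (real_of_int l)\<^sup>2) powr (1/4)"
          using L by (intro powr_mono2) (auto simp: L_def)
        finally show ?thesis .
      qed
      then have "C * sqrt L \<le> C * (1 + (real_of_int l)\<^sup>2) powr (1/4)"
        using \<open>C \<ge> 0\<close> by (rule mult_left_mono)
      finally show ?thesis .
    qed
  qed
qed

definition fiber_major :: "real \<Rightarrow> (int \<Rightarrow> complex) \<Rightarrow> int \<Rightarrow> int \<Rightarrow> real" where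
  "fiber_major \<omega> c n m = beta_major \<omega> (n - m) n * cmod (c (n - m))"

lemma Hfiber_le_major:
  assumes "\<omega> > 0" "k \<in> Omega \<omega>"
  shows "cmod (Hfiber \<omega> c k n m) \<le> fiber_major \<omega> c n m"
proof -
  have k: "\<bar>k\<bar> \<le> \<omega> / 2" using assms by (auto simp: Omega_def)
  show ?thesis
    using cmod_Beta_le_major[OF assms(1) k, of n "n - m"]
    unfolding Hfiber_def fiber_major_def norm_mult
    by (intro mult_right_mono) (auto simp: algebra_simps)
qed

text \<open>The substitution (n, m) -> (n - m, n) turns diagonals into rows. The inner sum over
  \<open>n\<close> is bounded by \<open>beta_major_sum\<close>, and the outer sum over the offset is
  the hypothesis on \<open>c\<close>.\<close>

lemma fiber_major_summable:
  assumes \<omega>: "\<omega> > 0"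
    and c: "(\<lambda>l::int. cmod (c l) * (1 + (real_of_int l)\<^sup>2) powr (1/4)) summable_on UNIV"
  shows "(\<lambda>(n,m). fiber_major \<omega> c n m) summable_on UNIV"
proof -
  obtain C where C: "C \<ge> 0" "\<And>l. beta_major \<omega> l summable_on UNIV"
    "\<And>l. (\<Sum>\<^sub>\<infinity>n. beta_major \<omega> l n) \<le> C * (1 + (real_of_int l)\<^sup>2) powr (1/4)"
    using beta_major_sum[OF \<omega>] by blast
  have "(\<lambda>(l,n). beta_major \<omega> l n * cmod (c l)) summable_on (SIGMA l:UNIV. UNIV)"
  proof (rule summable_on_SigmaI)
    show "((\<lambda>n. case (l, n) of (l,n) \<Rightarrow> beta_major \<omega> l n * cmod (c l)) has_sum
        ((\<Sum>\<^sub>\<infinity>n. beta_major \<omega> l n) * cmod (c l))) UNIV" for l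
      using has_sum_cmult_left[OF has_sum_infsum[OF C(2)]] by simp
    show "(\<lambda>l. (\<Sum>\<^sub>\<infinity>n. beta_major \<omega> l n) * cmod (c l)) summable_on UNIV"
    proof (rule summable_on_comparison_test[OF summable_on_cmult_right[OF c, of C]])
      fix l :: int
      show "(\<Sum>\<^sub>\<infinity>n. beta_major \<omega> l n) * cmod (c l) \<le> C * (cmod (c l) * (1 + (real_of_int l)\<^sup>2) powr (1/4))"
        using mult_right_mono[OF C(3)[of l], of "cmod (c l)"] by (simp add: mult_ac)
      show "0 \<le> (\<Sum>\<^sub>\<infinity>n. beta_major \<omega> l n) * cmod (c l)"
        using beta_major_nonneg[OF \<omega>] by (simp add: infsum_nonneg)
    qed
    show "0 \<le> (case (l, n) of (l,n) \<Rightarrow> beta_major \<omega> l n * cmod (c l))" for l n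
      using beta_major_nonneg[OF \<omega>] by simp
  qed
  then have s: "(\<lambda>(l,n). beta_major \<omega> l n * cmod (c l)) summable_on UNIV" by simp
  have "bij_betw (\<lambda>(n,m). (n - m, n)) UNIV (UNIV :: (int \<times> int) set)"
    by (rule bij_betwI[of _ _ _ "\<lambda>(l,n). (n, n - l)"]) auto
  from summable_on_reindex_bij_betw[OF this, of "\<lambda>(l,n). beta_major \<omega> l n * cmod (c l)"] s
  show ?thesis by (simp add: fiber_major_def case_prod_unfold)
qed

text \<open>The sum of the two Beta arguments does not depend on \<open>k\<close>, so the
  denominator is constant. The numerators move along Re z = 1/2, away from the poles of
  Gamma.\<close>

lemma Hfiber_continuous: "continuous_on S (\<lambda>k. Hfiber \<omega> c k n m)"
proof -
  have nn: "z \<notin> \<int>\<^sub>\<le>\<^sub>0" if "Re z = 1/2" for z :: complex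
    using that by (auto elim!: nonpos_Ints_cases)
  have ab: "(1/2 - \<i> * of_real (\<omega> * of_int n) - \<i> * of_real k) +
      (1/2 + \<i> * of_real (\<omega> * of_int m) + \<i> * of_real k) = 1 + \<i> * of_real (\<omega> * (m - n))" for k
    by (simp add: algebra_simps)
  have g: "continuous_on {z. Re z = 1/2} (Gamma :: complex \<Rightarrow> complex)"
    by (rule continuous_on_Gamma) (use nn in auto)
  show ?thesis unfolding Hfiber_def Beta_def ab divide_inverse[of "_ * _"]
    by (intro continuous_on_mult continuous_on_const continuous_on_compose2[OF g] continuous_intros) auto
qed

section \<open>Fourier series of absolutely summable coefficients\<close>

lemma integrable_count_space_int_iff:
  fixes F :: "int \<Rightarrow> complex"
  shows "integrable (count_space UNIV) F \<longleftrightarrow> (\<lambda>l. norm (F l)) summable_on UNIV"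
  using abs_summable_equivalent[of F UNIV] by (simp add: Infinite_Set_Sum.abs_summable_on_def)

text \<open>Holds for every family: complex summability is absolute summability, and where it fails
  both sides take the default value 0. Measurability of a sum therefore follows from measurability
  of a parameter integral, even at points of divergence.\<close>

lemma infsum_eq_integral_count_space:
  fixes F :: "int \<Rightarrow> complex"
  shows "infsum F UNIV = lebesgue_integral (count_space UNIV) F"
proof (cases "(\<lambda>l. norm (F l)) summable_on UNIV")
  case True
  then have "infsetsum F UNIV = infsum F UNIV"
    using abs_summable_equivalent[of F UNIV] by (intro infsetsum_infsum) auto
  then show ?thesis by (simp add: infsetsum_def)
next
  case False
  then have "\<not> F summable_on UNIV" by (simp add: summable_on_iff_abs_summable_on_complex)
  with False show ?thesis
    by (simp add: infsum_not_exists not_integrable_integral_eq integrable_count_space_int_iff)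
qed

lemma borel_measurable_pair_count_space:
  fixes F :: "int \<Rightarrow> 'a \<Rightarrow> complex"
  assumes "\<And>l. F l \<in> borel_measurable M"
  shows "(\<lambda>(x,l). F l x) \<in> borel_measurable (M \<Otimes>\<^sub>M count_space UNIV)"
proof -
  have "(\<lambda>z. F (snd z) (fst z)) \<in> borel_measurable (M \<Otimes>\<^sub>M count_space UNIV)"
    by (rule measurable_compose_countable[of "\<lambda>l z. F l (fst z)"])
      (auto intro!: measurable_compose[OF measurable_fst assms])
  then show ?thesis by (simp add: case_prod_unfold)
qed

lemma borel_measurable_infsum_int:
  fixes F :: "int \<Rightarrow> 'a \<Rightarrow> complex"
  assumes "\<And>l. F l \<in> borel_measurable M"
  shows "(\<lambda>x. \<Sum>\<^sub>\<infinity>l. F l x) \<in> borel_measurable M"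
proof -
  interpret sigma_finite_measure "count_space (UNIV :: int set)"
    by (rule sigma_finite_measure_count_space)
  show ?thesis unfolding infsum_eq_integral_count_space
    by (rule borel_measurable_lebesgue_integral) (rule borel_measurable_pair_count_space[OF assms])
qed

text \<open>Fubini for \<open>M\<close> and counting measure. The majorant \<open>b l * w x\<close>
  separates the variables, so it is integrable on the product as soon as each factor is.\<close>

lemma integral_infsum_int:
  fixes F :: "int \<Rightarrow> 'a \<Rightarrow> complex"
  assumes sf: "sigma_finite_measure M"
    and F: "\<And>l. F l \<in> borel_measurable M"
    and b: "b summable_on UNIV"
    and w: "integrable M w"
    and le: "\<And>l x. x \<in> space M \<Longrightarrow> cmod (F l x) \<le> b l * w x"
  shows "integrable M (\<lambda>x. \<Sum>\<^sub>\<infinity>l. F l x)"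
    and "(\<integral>x. (\<Sum>\<^sub>\<infinity>l. F l x) \<partial>M) = (\<Sum>\<^sub>\<infinity>l. \<integral>x. F l x \<partial>M)"
proof -
  interpret M: sigma_finite_measure M by fact
  interpret C: sigma_finite_measure "count_space (UNIV :: int set)"
    by (rule sigma_finite_measure_count_space)
  interpret P: pair_sigma_finite M "count_space (UNIV :: int set)" ..
  have meas: "(\<lambda>(x,l). F l x) \<in> borel_measurable (M \<Otimes>\<^sub>M count_space UNIV)"
    by (rule borel_measurable_pair_count_space[OF F])
  have s: "(\<lambda>l. cmod (F l x)) summable_on UNIV" if "x \<in> space M" for x
    by (rule summable_on_comparison_test[OF summable_on_cmult_left[OF b, of "w x"]]) (use le[OF that] in auto)
  have bd: "(\<Sum>\<^sub>\<infinity>l. cmod (F l x)) \<le> (\<Sum>\<^sub>\<infinity>l. b l) * w x" if "x \<in> space M" for x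
    using infsum_mono[OF s[OF that] summable_on_cmult_left[OF b, of "w x"]] le[OF that]
    by (simp add: infsum_cmult_left')
  \<comment> \<open>\<open>infsum_eq_integral_count_space\<close> speaks of complex families, so the
    sum of moduli is embedded in the complex numbers and then pulled back.\<close>
  have nrm: "complex_of_real (\<integral>l. cmod (F l x) \<partial>count_space UNIV) = (\<Sum>\<^sub>\<infinity>l. complex_of_real (cmod (F l x)))" for x
    by (simp add: infsum_eq_integral_count_space)
  have nrm2: "(\<integral>l. cmod (F l x) \<partial>count_space UNIV) = (\<Sum>\<^sub>\<infinity>l. cmod (F l x))" if "x \<in> space M" for x
  proof -
    have "(\<Sum>\<^sub>\<infinity>l. complex_of_real (cmod (F l x))) = of_real (\<Sum>\<^sub>\<infinity>l. cmod (F l x))"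
      using infsumI[OF has_sum_of_real[OF has_sum_infsum[OF s[OF that]]]] .
    then show ?thesis using nrm[of x] by (metis of_real_eq_iff)
  qed
  have int: "integrable (M \<Otimes>\<^sub>M count_space UNIV) (\<lambda>(x,l). F l x)"
  proof (rule P.Fubini_integrable[OF meas])
    have m2: "(\<lambda>x. \<integral>l. cmod (F l x) \<partial>count_space UNIV) \<in> borel_measurable M"
      by (intro C.borel_measurable_lebesgue_integral) (use measurable_compose[OF meas, of norm borel] in \<open>simp add: case_prod_unfold\<close>)
    show "integrable M (\<lambda>x. \<integral>l. norm (case (x,l) of (x,l) \<Rightarrow> F l x) \<partial>count_space UNIV)"
    proof (rule Bochner_Integration.integrable_bound)
      show "integrable M (\<lambda>x. (\<Sum>\<^sub>\<infinity>l. b l) * w x)" using w by simp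
      show "AE x in M. norm (\<integral>l. norm (case (x,l) of (x,l) \<Rightarrow> F l x) \<partial>count_space UNIV) \<le> norm ((\<Sum>\<^sub>\<infinity>l. b l) * w x)"
      proof (rule AE_I2)
        fix x assume x: "x \<in> space M"
        have "0 \<le> (\<Sum>\<^sub>\<infinity>l. cmod (F l x))" by (simp add: infsum_nonneg)
        with bd[OF x] show "norm (\<integral>l. norm (case (x,l) of (x,l) \<Rightarrow> F l x) \<partial>count_space UNIV) \<le> norm ((\<Sum>\<^sub>\<infinity>l. b l) * w x)"
          by (simp only: prod.case nrm2[OF x] real_norm_def)
      qed
    qed (use m2 in simp)
    show "AE x in M. integrable (count_space UNIV) (\<lambda>l. case (x,l) of (x,l) \<Rightarrow> F l x)"
      by (rule AE_I2) (simp add: integrable_count_space_int_iff s)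
  qed
  show "integrable M (\<lambda>x. \<Sum>\<^sub>\<infinity>l. F l x)"
    unfolding infsum_eq_integral_count_space using P.integrable_fst'[OF int] by simp
  show "(\<integral>x. (\<Sum>\<^sub>\<infinity>l. F l x) \<partial>M) = (\<Sum>\<^sub>\<infinity>l. \<integral>x. F l x \<partial>M)"
    unfolding infsum_eq_integral_count_space using P.Fubini_integral[OF int] by simp
qed

text \<open>Borel induction from intervals. After extension by zero, \<open>D\<close> has total
  integral 0, so the sets over which it integrates to 0 are closed under complements, and
  integrability handles disjoint countable unions.\<close>

lemma AE_zero_of_interval_integrals:
  fixes d :: "real \<Rightarrow> complex"
  assumes d: "set_integrable lborel {A..B} d"
    and z: "\<And>a b. A \<le> a \<Longrightarrow> a \<le> b \<Longrightarrow> b \<le> B \<Longrightarrow> (LINT x:{a..b}|lborel. d x) = 0"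
  shows "AE x in lborel. x \<in> {A..B} \<longrightarrow> d x = 0"
proof -
  define D where "D = (\<lambda>x. indicator {A..B} x *\<^sub>R d x)"
  have D: "integrable lborel D" using d by (simp add: D_def set_integrable_def)
  have DS: "set_integrable lborel S D" if "S \<in> sets borel" for S
    unfolding set_integrable_def by (rule integrable_mult_indicator) (use that D in simp_all)
  have iv: "(LINT x:{a..b}|lborel. D x) = 0" for a b
  proof -
    have "(LINT x:{a..b}|lborel. D x) = (LINT x:{max a A..min b B}|lborel. d x)"
      unfolding set_lebesgue_integral_def D_def
      by (intro Bochner_Integration.integral_cong refl) (auto simp: indicator_def)
    also have "\<dots> = 0"
      using z[of "max a A" "min b B"] by (cases "max a A \<le> min b B") (auto simp: set_lebesgue_integral_def)
    finally show ?thesis .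
  qed
  have all: "(LINT x:UNIV|lborel. D x) = 0"
  proof -
    have "(LINT x:UNIV|lborel. D x) = (LINT x:{A..B}|lborel. D x)"
      unfolding set_lebesgue_integral_def D_def
      by (intro Bochner_Integration.integral_cong refl) (auto simp: indicator_def)
    then show ?thesis using iv by simp
  qed
  have S: "(LINT x:S|lborel. D x) = 0" if "S \<in> sets borel" for S
    using that
  proof (induction S rule: borel_set_induct)
    case empty show ?case by (simp add: set_lebesgue_integral_def)
  next
    case (interval a b) show ?case by (rule iv)
  next
    case (compl S)
    have "(LINT x:(S \<union> - S)|lborel. D x) = (LINT x:S|lborel. D x) + (LINT x:-S|lborel. D x)"
      using compl.hyps by (intro set_integral_Un DS) auto
    then show ?case using all compl.IH by simp
  next
    case (union f)
    have "(LINT x:(\<Union>i. f i)|lborel. D x) = (\<Sum>i. (LINT x:(f i)|lborel. D x))"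
      using union.hyps by (intro lebesgue_integral_countable_add DS) (auto simp: disjoint_family_on_def)
    then show ?case using union.IH by simp
  qed
  have "AE x in lborel. D x = 0"
    by (rule sigma_finite_measure.density_zero[OF sigma_finite_lborel D]) (use S in simp)
  then show ?thesis by eventually_elim (auto simp: D_def)
qed

text \<open>Complex coefficients are allowed so that real polynomials in the coordinates of
  \<open>cis x\<close> are included. The inductive form reduces orthogonality to monomials and
  additivity.\<close>

inductive trig_poly :: "(real \<Rightarrow> complex) \<Rightarrow> bool" where
  monom: "trig_poly (\<lambda>x. c * cis (real_of_int l * x))"
| add: "trig_poly f \<Longrightarrow> trig_poly g \<Longrightarrow> trig_poly (\<lambda>x. f x + g x)"

lemma trig_poly_mult:
  assumes "trig_poly f" "trig_poly g" shows "trig_poly (\<lambda>x. f x * g x)"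
  using assms
proof (induction f rule: trig_poly.induct)
  case (monom c l)
  from monom.prems show ?case
  proof (induction g rule: trig_poly.induct)
    case (monom c' l')
    have "(\<lambda>x. c * cis (real_of_int l * x) * (c' * cis (real_of_int l' * x))) =
        (\<lambda>x. (c * c') * cis (real_of_int (l + l') * x))"
      by (simp add: fun_eq_iff cis_mult[symmetric] distrib_right)
    then show ?case using trig_poly.monom[of "c * c'" "l + l'"] by (simp only:)
  next
    case (add f g)
    then show ?case using trig_poly.add by (simp add: distrib_left)
  qed
next
  case (add f' g')
  then show ?case using trig_poly.add by (simp add: distrib_right)
qed

text \<open>A real linear functional on the plane combines real and imaginary part, and Euler's
  formulas express cosine and sine by \<open>cis x\<close> and \<open>cis (- x)\<close>.\<close>

lemma trig_poly_of_real_polynomial: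
  fixes P :: "complex \<Rightarrow> real"
  assumes "real_polynomial_function P"
  shows "trig_poly (\<lambda>x. complex_of_real (P (cis x)))"
  using assms
proof (induction P rule: real_polynomial_function.induct)
  case (linear f)
  then interpret bounded_linear f .
  have fz: "f z = Re z * f 1 + Im z * f \<i>" for z
  proof -
    have "z = Re z *\<^sub>R 1 + Im z *\<^sub>R \<i>" by (simp add: complex_eq_iff)
    then have "f z = f (Re z *\<^sub>R 1 + Im z *\<^sub>R \<i>)" by simp
    then show ?thesis by (simp add: add scaleR)
  qed
  have "complex_of_real (f (cis x)) =
      ((f 1 - \<i> * f \<i>) / 2) * cis (real_of_int 1 * x) + ((f 1 + \<i> * f \<i>) / 2) * cis (real_of_int (-1) * x)" for x
    unfolding fz[of "cis x"] by (simp add: complex_eq_iff field_simps)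
  then show ?case using trig_poly.add[OF trig_poly.monom trig_poly.monom] by (simp only:)
next
  case (const c)
  show ?case using trig_poly.monom[of "of_real c" 0] by simp
next
  case (add f g)
  then show ?case using trig_poly.add by simp
next
  case (mult f g)
  then show ?case using trig_poly_mult by simp
qed

lemma trig_poly_continuous: "trig_poly f \<Longrightarrow> continuous_on UNIV f"
  by (induction rule: trig_poly.induct) (auto intro!: continuous_intros)

lemma set_integrable_mult_bounded:
  fixes d \<phi> :: "real \<Rightarrow> complex"
  assumes d: "set_integrable lborel {A..B} d" and \<phi>: "continuous_on {A..B} \<phi>"
  shows "set_integrable lborel {A..B} (\<lambda>x. d x * \<phi> x)"
proof -
  obtain C where C: "\<And>x. x \<in> {A..B} \<Longrightarrow> norm (\<phi> x) \<le> C"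
    using compact_imp_bounded[OF compact_continuous_image[OF \<phi>]] by (force simp: bounded_iff)
  have m: "(\<lambda>x. indicator {A..B} x *\<^sub>R \<phi> x) \<in> borel_measurable lborel"
    using borel_measurable_continuous_on_indicator[OF _ \<phi>] by simp
  have m2: "(\<lambda>x. indicator {A..B} x *\<^sub>R d x) \<in> borel_measurable lborel"
    using d by (auto simp: set_integrable_def)
  have eq: "(\<lambda>x. indicator {A..B} x *\<^sub>R (d x * \<phi> x)) =
      (\<lambda>x. (indicator {A..B} x *\<^sub>R d x) * (indicator {A..B} x *\<^sub>R \<phi> x))"
    by (auto simp: fun_eq_iff indicator_def)
  show ?thesis unfolding set_integrable_def
  proof (rule Bochner_Integration.integrable_bound)
    show "integrable lborel (\<lambda>x. C *\<^sub>R (indicator {A..B} x *\<^sub>R d x))"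
      using d unfolding set_integrable_def by (rule integrable_scaleR_right)
    show "(\<lambda>x. indicator {A..B} x *\<^sub>R (d x * \<phi> x)) \<in> borel_measurable lborel"
      unfolding eq by (rule borel_measurable_times[OF m2 m])
    show "AE x in lborel. norm (indicator {A..B} x *\<^sub>R (d x * \<phi> x)) \<le> norm (C *\<^sub>R (indicator {A..B} x *\<^sub>R d x))"
    proof (rule AE_I2)
      fix x
      show "norm (indicator {A..B} x *\<^sub>R (d x * \<phi> x)) \<le> norm (C *\<^sub>R (indicator {A..B} x *\<^sub>R d x))"
        using mult_right_mono[OF order_trans[OF C[of x] abs_ge_self], of "cmod (d x)"]
        by (auto simp: indicator_def norm_mult mult.commute)
    qed
  qed
qed

text \<open>Stone--Weierstrass on the circle makes \<open>d\<close> orthogonal to all continuous functions of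
  \<open>cis (\<omega> x)\<close>; the bumps \<open>min 1 (n dist(\<cdot>, K))\<close> then exhaust the indicator of an interval.\<close>
lemma fourier_uniqueness:
  fixes d :: "real \<Rightarrow> complex"
  assumes T: "T > 0" and d: "set_integrable lborel {0..T} d"
    and z: "\<And>l::int. (LINT x:{0..T}|lborel. d x * cis (l * (2 * pi / T) * x)) = 0"
  shows "AE x in lborel. x \<in> {0..T} \<longrightarrow> d x = 0"
proof (rule AE_zero_of_interval_integrals[OF d])
  define \<omega> where "\<omega> = 2 * pi / T"
  have \<omega>: "\<omega> > 0" using T by (simp add: \<omega>_def)
  have tp: "(LINT x:{0..T}|lborel. d x * f (\<omega> * x)) = 0" if "trig_poly f" for f
    using that
  proof (induction f rule: trig_poly.induct)
    case (monom c l)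
    have "(LINT x:{0..T}|lborel. d x * (c * cis (l * (\<omega> * x)))) =
        (LINT x:{0..T}|lborel. c * (d x * cis (l * (2 * pi / T) * x)))"
      by (simp add: \<omega>_def mult_ac)
    then show ?case using z[of l] by simp
  next
    case (add f g)
    have i: "set_integrable lborel {0..T} (\<lambda>x. d x * f (\<omega> * x))" if "trig_poly f" for f
      by (intro set_integrable_mult_bounded[OF d] continuous_on_compose2[OF trig_poly_continuous[OF that]] continuous_intros) auto
    show ?case using add set_integral_add(2)[OF i[OF add.hyps(1)] i[OF add.hyps(2)]]
      by (simp add: distrib_left)
  qed
  define I where "I = (LINT x:{0..T}|lborel. cmod (d x))"
  have I: "set_integrable lborel {0..T} (\<lambda>x. cmod (d x))" using d by (rule set_integrable_norm)
  have I0: "I \<ge> 0" unfolding I_def set_lebesgue_integral_def by (intro Bochner_Integration.integral_nonneg) auto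
  have ct: "(LINT x:{0..T}|lborel. d x * of_real (\<phi> (cis (\<omega> * x)))) = 0"
    if \<phi>: "continuous_on UNIV \<phi>" for \<phi> :: "complex \<Rightarrow> real"
  proof -
    let ?J = "(LINT x:{0..T}|lborel. d x * of_real (\<phi> (cis (\<omega> * x))))"
    have "cmod ?J \<le> \<epsilon> * I" if \<epsilon>: "\<epsilon> > 0" for \<epsilon>
    proof -
      obtain P where P: "real_polynomial_function P" "\<And>x. x \<in> sphere 0 1 \<Longrightarrow> \<bar>\<phi> x - P x\<bar> < \<epsilon>"
        using Stone_Weierstrass_real_polynomial_function[OF _ continuous_on_subset[OF \<phi>] \<epsilon>, of "sphere 0 1"] by auto
      have cP: "continuous_on UNIV P"
        using P(1) continuous_on_polymonial_function real_polynomial_function_eq by blast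
      have iP: "set_integrable lborel {0..T} (\<lambda>x. d x * of_real (\<psi> (cis (\<omega> * x))))"
        if "continuous_on UNIV \<psi>" for \<psi> :: "complex \<Rightarrow> real"
        by (intro set_integrable_mult_bounded[OF d] continuous_intros continuous_on_compose2[OF that]) auto
      have "?J = ?J - (LINT x:{0..T}|lborel. d x * of_real (P (cis (\<omega> * x))))"
        using tp[OF trig_poly_of_real_polynomial[OF P(1)]] by simp
      also have "\<dots> = (LINT x:{0..T}|lborel. d x * of_real (\<phi> (cis (\<omega> * x))) - d x * of_real (P (cis (\<omega> * x))))"
        by (rule set_integral_diff(2)[symmetric]) (intro iP \<phi> cP)+
      also have "cmod \<dots> \<le> (LINT x:{0..T}|lborel. \<epsilon> * cmod (d x))"
        unfolding set_lebesgue_integral_def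
      proof (rule Bochner_Integration.integral_norm_bound_integral)
        show "integrable lborel (\<lambda>x. indicat_real {0..T} x *\<^sub>R (d x * complex_of_real (\<phi> (cis (\<omega> * x))) - d x * complex_of_real (P (cis (\<omega> * x)))))"
          using set_integral_diff(1)[OF iP[OF \<phi>] iP[OF cP]] by (simp add: set_integrable_def)
        show "integrable lborel (\<lambda>x. indicat_real {0..T} x *\<^sub>R (\<epsilon> * cmod (d x)))"
          using set_integrable_mult_right[OF I, of \<epsilon>] by (simp add: set_integrable_def)
        fix x :: real
        have "\<bar>\<phi> (cis (\<omega> * x)) - P (cis (\<omega> * x))\<bar> \<le> \<epsilon>" using P(2)[of "cis (\<omega> * x)"] by simp
        then have "cmod (d x) * \<bar>\<phi> (cis (\<omega> * x)) - P (cis (\<omega> * x))\<bar> \<le> \<epsilon> * cmod (d x)"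
          by (subst mult.commute) (rule mult_right_mono, auto)
        then show "norm (indicat_real {0..T} x *\<^sub>R (d x * complex_of_real (\<phi> (cis (\<omega> * x))) - d x * complex_of_real (P (cis (\<omega> * x)))))
            \<le> indicat_real {0..T} x *\<^sub>R (\<epsilon> * cmod (d x))"
          by (auto simp: indicator_def right_diff_distrib[symmetric] of_real_diff[symmetric] norm_mult simp del: of_real_diff)
      qed
      also have "\<dots> = \<epsilon> * I" by (simp add: I_def)
      finally show ?thesis .
    qed
    then have "cmod ?J \<le> 0 + e" if "e > 0" for e
    proof -
      \<comment> \<open>Division by \<open>I + 1\<close> is safe when \<open>I\<close>
        vanishes.\<close>
      have "cmod ?J \<le> e / (I + 1) * I" using that I0 by (intro \<open>\<And>\<epsilon>. \<epsilon> > 0 \<Longrightarrow> cmod ?J \<le> \<epsilon> * I\<close>) auto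
      also have "\<dots> \<le> e" using that I0 by (simp add: field_simps)
      finally show ?thesis by simp
    qed
    then have "cmod ?J \<le> 0" by (rule field_le_epsilon)
    then show ?thesis by simp
  qed
  fix a b assume ab: "0 \<le> a" "a \<le> b" "b \<le> T"
  \<comment> \<open>The image of the complement of the open interval. It is never empty, since it
    contains the point 1, the common image of 0 and T.\<close>
  define K where "K = (\<lambda>x. cis (\<omega> * x)) ` ({0..a} \<union> {b..T})"
  define \<phi> where "\<phi> = (\<lambda>(n::nat) z. min 1 (real n * infdist z K))"
  have Kc: "compact K" unfolding K_def by (intro compact_continuous_image continuous_intros compact_Un) auto
  have K0: "K \<noteq> {}" using ab by (auto simp: K_def)
  \<comment> \<open>A point strictly between \<open>a\<close> and \<open>b\<close> is less than one
    period away from every point of [0, T], so it can share its image on the circle only with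
    itself.\<close>
  have inj: "cis (\<omega> * x) \<notin> K" if "a < x" "x < b" for x
  proof
    assume "cis (\<omega> * x) \<in> K"
    then obtain y where y: "y \<in> {0..a} \<union> {b..T}" "cis (\<omega> * x) = cis (\<omega> * y)" unfolding K_def by blast
    then have "cis (\<omega> * x - \<omega> * y) = 1" by (simp add: cis_divide[symmetric])
    then obtain m :: int where m: "\<omega> * x - \<omega> * y = 2 * pi * m"
      unfolding cis_conv_exp exp_eq_1 by auto
    have "2 * pi * (x - y) = 2 * pi * (T * m)" using m T by (simp add: \<omega>_def field_simps)
    then have "x - y = T * m" by simp
    moreover have "\<bar>x - y\<bar> < T" "x \<noteq> y" using y(1) that ab by auto
    ultimately have "\<bar>T * m\<bar> < T * 1" "m \<noteq> 0" using T by auto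
    then have "\<bar>real_of_int m\<bar> < 1" using T by (simp add: abs_mult)
    then show False using \<open>m \<noteq> 0\<close> by linarith
  qed
  have lim: "(\<lambda>n. \<phi> n (cis (\<omega> * x))) \<longlonglongrightarrow> indicator {a<..<b} x" if x: "x \<in> {0..T}" for x
  proof (cases "x \<in> {a<..<b}")
    case True
    then have "infdist (cis (\<omega> * x)) K > 0"
      using inj[of x] K0 Kc by (auto simp: infdist_pos_not_in_closed compact_imp_closed)
    then obtain N where N: "1 < real N * infdist (cis (\<omega> * x)) K"
      using reals_Archimedean3 by blast
    have "\<forall>\<^sub>F n in sequentially. \<phi> n (cis (\<omega> * x)) = 1"
      using eventually_ge_at_top[of N]
    proof eventually_elim
      case (elim n)
      have "real N * infdist (cis (\<omega> * x)) K \<le> real n * infdist (cis (\<omega> * x)) K"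
        using elim by (intro mult_right_mono) (auto simp: infdist_nonneg)
      then show ?case using N by (simp add: \<phi>_def)
    qed
    then show ?thesis using True by (simp add: tendsto_eventually)
  next
    case False
    then have "cis (\<omega> * x) \<in> K" using x by (auto simp: K_def)
    then show ?thesis using False by (simp add: \<phi>_def)
  qed
  have "(\<lambda>n. LINT x|lborel. indicator {0..T} x *\<^sub>R (d x * of_real (\<phi> n (cis (\<omega> * x))))) \<longlonglongrightarrow>
      (LINT x|lborel. indicator {a<..<b} x *\<^sub>R d x)"
  proof (rule integral_dominated_convergence)
    have "set_integrable lborel {a<..<b} d" by (rule set_integrable_subset[OF d]) (use ab in auto)
    then show "(\<lambda>x. indicat_real {a<..<b} x *\<^sub>R d x) \<in> borel_measurable lborel" by (auto simp: set_integrable_def)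
    show "integrable lborel (\<lambda>x. indicator {0..T} x *\<^sub>R cmod (d x))" using I by (simp add: set_integrable_def)
    have "set_integrable lborel {0..T} (\<lambda>x. d x * of_real (\<phi> n (cis (\<omega> * x))))" for n
      unfolding \<phi>_def by (intro set_integrable_mult_bounded[OF d] continuous_intros)
    then show "(\<lambda>x. indicator {0..T} x *\<^sub>R (d x * of_real (\<phi> n (cis (\<omega> * x))))) \<in> borel_measurable lborel" for n
      by (auto simp: set_integrable_def)
    show "AE x in lborel. (\<lambda>n. indicator {0..T} x *\<^sub>R (d x * of_real (\<phi> n (cis (\<omega> * x))))) \<longlonglongrightarrow> indicator {a<..<b} x *\<^sub>R d x"
    proof (rule AE_I2)
      fix x
      show "(\<lambda>n. indicator {0..T} x *\<^sub>R (d x * of_real (\<phi> n (cis (\<omega> * x))))) \<longlonglongrightarrow> indicator {a<..<b} x *\<^sub>R d x"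
      proof (cases "x \<in> {0..T}")
        case True
        have "(\<lambda>n. d x * complex_of_real (\<phi> n (cis (\<omega> * x)))) \<longlonglongrightarrow> d x * of_real (indicator {a<..<b} x)"
          by (intro tendsto_intros lim True)
        then show ?thesis using True by (simp add: scaleR_conv_of_real mult.commute)
      qed (use ab in auto)
    qed
    show "AE x in lborel. norm (indicator {0..T} x *\<^sub>R (d x * of_real (\<phi> n (cis (\<omega> * x))))) \<le> indicator {0..T} x *\<^sub>R cmod (d x)" for n
    proof (rule AE_I2)
      fix x
      have "\<bar>\<phi> n (cis (\<omega> * x))\<bar> \<le> 1" by (simp add: \<phi>_def abs_le_iff min_def infdist_nonneg)
      then show "norm (indicator {0..T} x *\<^sub>R (d x * of_real (\<phi> n (cis (\<omega> * x))))) \<le> indicator {0..T} x *\<^sub>R cmod (d x)"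
        by (auto simp: indicator_def norm_mult mult_left_le)
    qed
  qed
  moreover have "(LINT x|lborel. indicator {0..T} x *\<^sub>R (d x * of_real (\<phi> n (cis (\<omega> * x))))) = 0" for n
  proof -
    have "continuous_on UNIV (\<phi> n)" unfolding \<phi>_def by (intro continuous_intros)
    from ct[OF this] show ?thesis by (simp add: set_lebesgue_integral_def)
  qed
  ultimately have "(LINT x|lborel. indicator {a<..<b} x *\<^sub>R d x) = 0"
    using LIMSEQ_unique[OF _ tendsto_const] by (simp add: LIMSEQ_const_iff)
  moreover have "(LINT x:{a..b}|lborel. d x) = (LINT x|lborel. indicator {a<..<b} x *\<^sub>R d x)"
    unfolding set_lebesgue_integral_def
  proof (rule integral_cong_AE)
    have "set_integrable lborel {a..b} d" "set_integrable lborel {a<..<b} d"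
      by (rule set_integrable_subset[OF d]; use ab in auto)+
    then show "(\<lambda>x. indicat_real {a..b} x *\<^sub>R d x) \<in> borel_measurable lborel"
      "(\<lambda>x. indicat_real {a<..<b} x *\<^sub>R d x) \<in> borel_measurable lborel" by (auto simp: set_integrable_def)
    have "AE x in lborel. x \<noteq> a" "AE x in lborel. x \<noteq> b" by (rule AE_lborel_singleton)+
    then show "AE x in lborel. indicat_real {a..b} x *\<^sub>R d x = indicat_real {a<..<b} x *\<^sub>R d x"
      by eventually_elim (auto simp: indicator_def)
  qed
  ultimately show "(LINT x:{a..b}|lborel. d x) = 0" by simp
qed


section \<open>Fourier series and the kernel they generate\<close>

definition fourier_series :: "real \<Rightarrow> (int \<Rightarrow> complex) \<Rightarrow> real \<Rightarrow> complex" where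
  "fourier_series \<omega> c x = (\<Sum>\<^sub>\<infinity>l. c l * cis (l * \<omega> * x))"

lemma fourier_series_measurable [measurable]: "fourier_series \<omega> c \<in> borel_measurable borel"
  unfolding fourier_series_def
  by (rule borel_measurable_infsum_int[of "\<lambda>l x. c l * cis (l * \<omega> * x)"],
      rule borel_measurable_continuous_onI, intro continuous_intros)

lemma fourier_series_bound:
  assumes "(\<lambda>l. cmod (c l)) summable_on UNIV"
  shows "cmod (fourier_series \<omega> c x) \<le> (\<Sum>\<^sub>\<infinity>l. cmod (c l))"
  unfolding fourier_series_def
  using norm_infsum_bound[of "\<lambda>l. c l * cis (l * \<omega> * x)" UNIV] assms by (simp add: norm_mult)

lemma integral_cis_period:
  assumes T: "T > 0"
  shows "(LINT x:{0..T}|lborel. cis (real_of_int n * (2 * pi / T) * x)) = (if n = 0 then of_real T else 0)"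
proof (cases "n = 0")
  case True
  then show ?thesis using T by (simp add: set_lebesgue_integral_def scaleR_conv_of_real)
next
  case False
  define a where "a = real_of_int n * (2 * pi / T)"
  have a: "a \<noteq> 0" using False T by (simp add: a_def)
  have "(LINT x|lborel. indicator {0..T} x *\<^sub>R cis (a * x)) = cis (a * T) / (\<i> * a) - cis (a * 0) / (\<i> * a)"
  proof (rule integral_FTC_atLeastAtMost)
    fix x :: real
    have "((\<lambda>x. exp (\<i> * of_real a * x) / (\<i> * a)) has_vector_derivative exp (\<i> * of_real a * x)) (at x within {0..T})"
      using a by (auto intro!: derivative_eq_intros has_vector_derivative_real_field)
    then show "((\<lambda>x. cis (a * x) / (\<i> * a)) has_vector_derivative cis (a * x)) (at x within {0..T})"
      by (simp add: cis_conv_exp mult.assoc)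
  qed (use T in \<open>auto intro!: continuous_intros\<close>)
  moreover have "cis (a * T) = 1"
  proof -
    have "a * T = 2 * pi * n" using T by (simp add: a_def)
    then show ?thesis using cis_multiple_2pi[of "real_of_int n"] by simp
  qed
  ultimately show ?thesis using False by (simp add: set_lebesgue_integral_def a_def)
qed

lemma fourier_series_coefficient:
  assumes T: "T > 0" and c: "(\<lambda>l. cmod (c l)) summable_on UNIV"
  shows "(LINT x:{0..T}|lborel. fourier_series (2 * pi / T) c x * cis (real_of_int j * (2 * pi / T) * x)) = of_real T * c (- j)"
proof -
  define \<omega> where "\<omega> = 2 * pi / T"
  let ?F = "\<lambda>l x. indicator {0..T} x *\<^sub>R (c l * cis (real_of_int (l + j) * \<omega> * x))"
  have "(LINT x:{0..T}|lborel. fourier_series \<omega> c x * cis (real_of_int j * \<omega> * x)) =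
      (LINT x|lborel. (\<Sum>\<^sub>\<infinity>l. ?F l x))"
    unfolding set_lebesgue_integral_def fourier_series_def
  proof (intro Bochner_Integration.integral_cong refl)
    fix x
    have "(\<Sum>\<^sub>\<infinity>l. ?F l x) = (\<Sum>\<^sub>\<infinity>l. of_real (indicator {0..T} x) * ((c l * cis (real_of_int l * \<omega> * x)) * cis (real_of_int j * \<omega> * x)))"
      by (simp add: scaleR_conv_of_real cis_mult distrib_right mult.assoc)
    then show "indicat_real {0..T} x *\<^sub>R ((\<Sum>\<^sub>\<infinity>l. c l * cis (real_of_int l * \<omega> * x)) * cis (real_of_int j * \<omega> * x)) = (\<Sum>\<^sub>\<infinity>l. ?F l x)"
      by (auto simp: infsum_cmult_right' infsum_cmult_left' scaleR_conv_of_real)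
  qed
  also have "\<dots> = (\<Sum>\<^sub>\<infinity>l. LINT x|lborel. ?F l x)"
  proof (rule integral_infsum_int(2)[OF sigma_finite_lborel _ c])
    show "?F l \<in> borel_measurable lborel" for l
      by (simp, intro borel_measurable_scaleR borel_measurable_times borel_measurable_indicator borel_measurable_const
          borel_measurable_continuous_onI continuous_intros) auto
    show "integrable lborel (\<lambda>x. indicat_real {0..T} x)" using T by simp
    show "cmod (?F l x) \<le> cmod (c l) * indicat_real {0..T} x" for l x
      by (simp add: norm_mult)
  qed
  also have "\<dots> = (\<Sum>\<^sub>\<infinity>l. if l = - j then c l * of_real T else 0)"
  proof (rule infsum_cong)
    fix l
    have "(LINT x|lborel. ?F l x) = (LINT x:{0..T}|lborel. c l * cis (real_of_int (l + j) * \<omega> * x))"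
      unfolding set_lebesgue_integral_def ..
    also have "\<dots> = c l * (LINT x:{0..T}|lborel. cis (real_of_int (l + j) * \<omega> * x))"
      by (rule set_integral_mult_right)
    also have "\<dots> = (if l = - j then c l * of_real T else 0)"
      unfolding \<omega>_def integral_cis_period[OF T] by (auto simp: add_eq_0_iff)
    finally show "(LINT x|lborel. ?F l x) = (if l = - j then c l * of_real T else 0)" .
  qed
  also have "\<dots> = (\<Sum>\<^sub>\<infinity>l\<in>{- j}. c l * of_real T)"
    by (rule infsum_cong_neutral) auto
  finally show ?thesis by (simp add: \<omega>_def mult.commute)
qed

lemma fourier_series_periodic:
  assumes "T > 0"
  shows "fourier_series (2 * pi / T) c (x + real_of_int j * T) = fourier_series (2 * pi / T) c x"
  unfolding fourier_series_def
proof (rule infsum_cong)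
  fix l :: int
  have "real_of_int l * (2 * pi / T) * (x + real_of_int j * T) = real_of_int l * (2 * pi / T) * x + 2 * pi * real_of_int (l * j)"
    using assms by (simp add: field_simps)
  then have "cis (real_of_int l * (2 * pi / T) * (x + real_of_int j * T)) = cis (real_of_int l * (2 * pi / T) * x)"
    using cis_multiple_2pi[of "real_of_int (l * j)"] by (simp only: cis_mult[symmetric]) simp
  then show "c l * cis (real_of_int l * (2 * pi / T) * (x + real_of_int j * T)) = c l * cis (real_of_int l * (2 * pi / T) * x)"
    by simp
qed

text \<open>Both functions have the same Fourier coefficients, so they agree almost everywhere on
  one period, and countably many translates cover the line. The exceptional set is stated as
  \<open>negligible\<close> because it is later mapped through \<open>exp\<close>.\<close>

lemma periodic_eq_fourier_series:
  fixes p :: "real \<Rightarrow> real"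
  assumes T: "T > 0" and per: "\<forall>x. p (x + T) = p x"
    and int: "set_integrable lborel {0..T} p"
    and c: "(\<lambda>l. cmod (fcoef T p l)) summable_on UNIV"
  shows "negligible {x. of_real (p x) \<noteq> fourier_series (2 * pi / T) (fcoef T p) x}"
proof -
  let ?c = "fcoef T p"
  let ?q = "fourier_series (2 * pi / T) ?c"
  define d where "d = (\<lambda>x. complex_of_real (p x) - ?q x)"
  have ip: "set_integrable lborel {0..T} (\<lambda>x. complex_of_real (p x))"
    using int unfolding set_integrable_def by (auto dest: integrable_of_real[where 'a=complex] simp: scaleR_conv_of_real)
  have iq: "set_integrable lborel {0..T} ?q" unfolding set_integrable_def
  proof (rule Bochner_Integration.integrable_bound)
    show "integrable lborel (\<lambda>x. (\<Sum>\<^sub>\<infinity>l. cmod (?c l)) * indicat_real {0..T} x)" using T by simp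
    show "AE x in lborel. norm (indicat_real {0..T} x *\<^sub>R ?q x) \<le> norm ((\<Sum>\<^sub>\<infinity>l. cmod (?c l)) * indicat_real {0..T} x)"
      using order_trans[OF fourier_series_bound[OF c] abs_ge_self] by (intro AE_I2) (auto simp: indicator_def)
  qed simp
  have cont: "continuous_on {0..T} (\<lambda>x. cis (real_of_int l * (2 * pi / T) * x))" for l by (intro continuous_intros)
  have "AE x in lborel. x \<in> {0..T} \<longrightarrow> d x = 0"
  proof (rule fourier_uniqueness[OF T])
    show "set_integrable lborel {0..T} d" unfolding d_def by (rule set_integral_diff(1)[OF ip iq])
    fix l :: int
    have "(LINT x:{0..T}|lborel. of_real (p x) * cis (real_of_int l * (2 * pi / T) * x)) = of_real T * ?c (- l)"
    proof -
      have "(LINT x:{0..T}|lborel. of_real (p x) * cis (real_of_int l * (2 * pi / T) * x)) =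
          (LINT x:{0..T}|lborel. exp (- \<i> * of_int (-l) * of_real (2 * pi / T) * of_real x) * of_real (p x))"
        by (simp add: cis_conv_exp mult_ac)
      then show ?thesis using T by (simp add: fcoef_def)
    qed
    moreover have "(LINT x:{0..T}|lborel. d x * cis (real_of_int l * (2 * pi / T) * x)) =
        (LINT x:{0..T}|lborel. of_real (p x) * cis (real_of_int l * (2 * pi / T) * x)) -
        (LINT x:{0..T}|lborel. ?q x * cis (real_of_int l * (2 * pi / T) * x))"
      unfolding d_def left_diff_distrib
      by (rule set_integral_diff(2)) (intro set_integrable_mult_bounded ip iq cont)+
    ultimately show "(LINT x:{0..T}|lborel. d x * cis (real_of_int l * (2 * pi / T) * x)) = 0"
      using fourier_series_coefficient[OF T c, of l] by simp
  qed
  then have "AE x in lebesgue. x \<in> {0..T} \<longrightarrow> d x = 0" by (simp add: AE_completion_iff)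
  then obtain N where N: "N \<in> null_sets lebesgue" "{x. \<not> (x \<in> {0..T} \<longrightarrow> d x = 0)} \<subseteq> N"
    unfolding eventually_ae_filter by auto
  have n0: "negligible {x \<in> {0..T}. d x \<noteq> 0}"
    using N by (auto simp: negligible_iff_null_sets intro: negligible_subset[unfolded negligible_iff_null_sets])
  have perj: "p (x + real_of_int j * T) = p x" for x j
  proof -
    have n: "p (x + real n * T) = p x" for x n
    proof (induction n)
      case (Suc n)
      have "p (x + real (Suc n) * T) = p ((x + real n * T) + T)" by (simp add: algebra_simps)
      then show ?case using Suc per by simp
    qed auto
    show ?thesis
    proof (cases j rule: int_cases2)
      case (nonneg n) then show ?thesis using n by simp
    next
      case (nonpos n) then show ?thesis using n[of "x + real_of_int j * T" n] by simp
    qed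
  qed
  have dper: "d (x + real_of_int j * T) = d x" for x j
    unfolding d_def perj fourier_series_periodic[OF T] ..
  have "{x. d x \<noteq> 0} \<subseteq> (\<Union>j::int. (+) (real_of_int j * T) ` {x \<in> {0..T}. d x \<noteq> 0})"
  proof
    fix x assume "x \<in> {x. d x \<noteq> 0}"
    define j where "j = \<lfloor>x / T\<rfloor>"
    define y where "y = x - real_of_int j * T"
    have "real_of_int j \<le> x / T" "x / T < real_of_int j + 1" by (simp_all add: j_def)
    then have "0 \<le> y" "y \<le> T" using T by (auto simp: y_def field_simps)
    moreover have "d y \<noteq> 0" using dper[of y j] \<open>x \<in> _\<close> by (simp add: y_def)
    ultimately show "x \<in> (\<Union>j::int. (+) (real_of_int j * T) ` {x \<in> {0..T}. d x \<noteq> 0})"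
      by (intro UN_I[of j] image_eqI[of _ _ y]) (auto simp: y_def)
  qed
  moreover have "negligible (\<Union>j::int. (+) (real_of_int j * T) ` {x \<in> {0..T}. d x \<noteq> 0})"
    by (intro negligible_countable_Union) (use negligible_translation[OF n0] in auto)
  ultimately have "negligible {x. d x \<noteq> 0}" by (rule negligible_subset[rotated])
  then show ?thesis by (simp add: d_def)
qed

definition fourier_kernel :: "real \<Rightarrow> (int \<Rightarrow> complex) \<Rightarrow> real \<Rightarrow> complex" where
  "fourier_kernel \<omega> c u = fourier_series \<omega> c (ln u) / of_real u"

lemma fourier_kernel_measurable [measurable]: "fourier_kernel \<omega> c \<in> borel_measurable borel"
  unfolding fourier_kernel_def by measurable

text \<open>For fixed \<open>t\<close> the integrands differ only if ln (t + s) lies in the null set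
  where \<open>p\<close> and its series disagree. The differentiable map \<open>exp\<close> sends
  null sets to null sets, and so does the translation by \<open>- t\<close>. Hence the identity
  holds at every positive \<open>t\<close>, with no exceptional set in \<open>t\<close>.\<close>

lemma hankel_eq_fourier_kernel:
  assumes T: "T > 0" and per: "\<forall>x. p (x + T) = p x"
    and p: "p \<in> borel_measurable lborel"
    and int: "set_integrable lborel {0..T} p"
    and c: "(\<lambda>l. cmod (fcoef T p l)) summable_on UNIV"
    and f: "f \<in> borel_measurable lborel" and t: "t > 0"
  shows "hankel p f t = (LINT s:{0<..}|lborel. fourier_kernel (2 * pi / T) (fcoef T p) (t + s) * f s)"
  unfolding hankel_def
proof (rule set_lebesgue_integral_cong_AE)
  let ?B = "{x. of_real (p x) \<noteq> fourier_series (2 * pi / T) (fcoef T p) x}"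
  have "(exp has_derivative (*) (exp x)) (at x within ?B)" for x :: real
    using DERIV_exp[of x] has_field_derivative_at_within unfolding has_field_derivative_def[symmetric] by blast
  then have "exp differentiable_on ?B" unfolding differentiable_on_def differentiable_def by blast
  with periodic_eq_fourier_series[OF T per int c] have "negligible (exp ` ?B)"
    by (intro negligible_differentiable_image_negligible) auto
  then have "negligible ((+) (- t) ` exp ` ?B)" by (rule negligible_translation)
  then have "AE s in lebesgue. s \<notin> (+) (- t) ` exp ` ?B"
    by (auto simp: negligible_iff_null_sets intro: AE_not_in)
  then have "AE s in lborel. s \<notin> (+) (- t) ` exp ` ?B" by (simp add: AE_completion_iff)
  then show "AE s\<in>{0<..} in lborel. hkernel p (t + s) * f s = fourier_kernel (2 * pi / T) (fcoef T p) (t + s) * f s"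
  proof eventually_elim
    case (elim s)
    show ?case
    proof
      assume "s \<in> {0<..}"
      then have s: "t + s > 0" using t by simp
      then have "s = - t + exp (ln (t + s))" by simp
      then have "ln (t + s) \<notin> ?B" using elim by blast
      then show "hkernel p (t + s) * f s = fourier_kernel (2 * pi / T) (fcoef T p) (t + s) * f s"
        by (simp add: hkernel_def fourier_kernel_def)
    qed
  qed
  have [measurable]: "p \<in> borel_measurable borel" "f \<in> borel_measurable borel" using p f by simp_all
  have [measurable]: "hkernel p \<in> borel_measurable borel"
    unfolding hkernel_def by measurable
  show "(\<lambda>s. hkernel p (t + s) * f s) \<in> borel_measurable lborel"
    "(\<lambda>s. fourier_kernel (2 * pi / T) (fcoef T p) (t + s) * f s) \<in> borel_measurable lborel"
    by measurable
qed simp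

section \<open>The Mellin transform of the Hankel kernel\<close>

text \<open>Agrees with the complex power \<open>powr\<close> for positive \<open>t\<close>, but is manifestly Borel measurable.\<close>
definition rpow :: "real \<Rightarrow> complex \<Rightarrow> complex" where
  "rpow t z = exp (z * of_real (ln t))"

lemma rpow_eq_powr: "t > 0 \<Longrightarrow> of_real t powr z = rpow t z"
  by (simp add: rpow_def powr_def Ln_of_real)

lemma rpow_measurable [measurable]: "(\<lambda>t. rpow t z) \<in> borel_measurable borel"
  unfolding rpow_def by measurable

lemma cmod_rpow: "cmod (rpow t z) = exp (Re z * ln t)"
  by (simp add: rpow_def)

lemma rpow_add: "rpow t (z + w) = rpow t z * rpow t w"
  by (simp add: rpow_def distrib_right exp_add)

lemma rpow_mult: "x > 0 \<Longrightarrow> y > 0 \<Longrightarrow> rpow (x * y) z = rpow x z * rpow y z"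
  by (simp add: rpow_def ln_mult_pos distrib_left exp_add)

lemma rpow_minus: "rpow t (- z) = inverse (rpow t z)"
  by (simp add: rpow_def exp_minus)

lemma rpow_nonzero [simp]: "rpow t z \<noteq> 0"
  by (simp add: rpow_def)

lemma rpow_one: "t > 0 \<Longrightarrow> rpow t 1 = of_real t"
  by (simp add: rpow_def exp_of_real)

section \<open>Gamma and Beta integrals on the half line\<close>

lemma integrable_cmult_cancel:
  fixes f :: "'a \<Rightarrow> complex"
  assumes "integrable M (\<lambda>x. c * f x)" "c \<noteq> 0"
  shows "integrable M f"
proof -
  have "integrable M (\<lambda>x. inverse c * (c * f x))" using assms(1) by (rule integrable_mult_right)
  then show ?thesis using assms(2) by (simp add: mult.assoc[symmetric])
qed

lemma Gamma_integral_lborel: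
  assumes a: "Re a > 0"
  shows "integrable lborel (\<lambda>t. indicator {0<..} t *\<^sub>R (rpow t (a - 1) * exp (- of_real t)))"
    and "(\<integral>t. indicator {0<..} t *\<^sub>R (rpow t (a - 1) * exp (- of_real t)) \<partial>lborel) = Gamma a"
proof -
  let ?g = "\<lambda>t. indicator {0<..} t *\<^sub>R (rpow t (a - 1) * exp (- complex_of_real t))"
  let ?h = "\<lambda>t. complex_of_real t powr (a - 1) / of_real (exp t)"
  have eq: "?g t = indicator {0<..} t *\<^sub>R ?h t" for t
    by (auto simp: indicator_def rpow_eq_powr exp_minus exp_of_real field_simps)
  have m: "?g \<in> borel_measurable borel" by measurable
  have i: "integrable lebesgue ?g"
    using absolutely_integrable_Gamma_integral'[OF a] unfolding set_integrable_def eq .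
  then show 1: "integrable lborel ?g" using integrable_completion[of ?g lborel] m by simp
  have "(\<integral>t. ?g t \<partial>lborel) = (\<integral>t. ?g t \<partial>lebesgue)"
    using integral_completion[of ?g lborel] m by simp
  also have "\<dots> = (LINT t:{0<..}|lebesgue. ?h t)" unfolding set_lebesgue_integral_def eq ..
  also have "\<dots> = integral {0<..} ?h"
    by (rule set_lebesgue_integral_eq_integral(2)[OF absolutely_integrable_Gamma_integral'[OF a]])
  also have "\<dots> = Gamma a" by (rule integral_unique[OF Gamma_integral_complex'[OF a]])
  finally show "(\<integral>t. ?g t \<partial>lborel) = Gamma a" .
qed

lemma Gamma_integral_scaled:
  assumes a: "Re a > 0" and x: "x > 0"
  shows "integrable lborel (\<lambda>t. indicator {0<..} t *\<^sub>R (rpow t (a - 1) * exp (- of_real (x * t))))"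
    and "(\<integral>t. indicator {0<..} t *\<^sub>R (rpow t (a - 1) * exp (- of_real (x * t))) \<partial>lborel) = Gamma a * rpow x (- a)"
proof -
  let ?g = "\<lambda>t. indicator {0<..} t *\<^sub>R (rpow t (a - 1) * exp (- complex_of_real t))"
  let ?g' = "\<lambda>t. indicator {0<..} t *\<^sub>R (rpow t (a - 1) * exp (- complex_of_real (x * t)))"
  have eq: "?g (0 + x * t) = rpow x (a - 1) * ?g' t" for t
    using x by (auto simp: indicator_def rpow_mult zero_less_mult_iff)
  have "integrable lborel (\<lambda>t. ?g (0 + x * t))"
    using Gamma_integral_lborel(1)[OF a] x by (intro lborel_integrable_real_affine) auto
  then have "integrable lborel (\<lambda>t. rpow x (a - 1) * ?g' t)" by (simp only: eq)
  then show "integrable lborel ?g'" by (rule integrable_cmult_cancel) simp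
  have "Gamma a = (\<integral>t. ?g t \<partial>lborel)" using Gamma_integral_lborel(2)[OF a] by simp
  also have "\<dots> = \<bar>x\<bar> *\<^sub>R (\<integral>t. ?g (0 + x * t) \<partial>lborel)"
    using x by (intro lborel_integral_real_affine) auto
  also have "\<dots> = of_real x * (rpow x (a - 1) * (\<integral>t. ?g' t \<partial>lborel))"
    unfolding eq using x by (simp add: scaleR_conv_of_real)
  also have "\<dots> = rpow x a * (\<integral>t. ?g' t \<partial>lborel)"
    using rpow_add[of x 1 "a - 1"] rpow_one[OF x] by (simp add: mult.assoc)
  finally show "(\<integral>t. ?g' t \<partial>lborel) = Gamma a * rpow x (- a)"
    by (simp add: rpow_minus field_simps)
qed

lemma Gamma_integral_scaled_real:
  fixes \<alpha> x :: real
  assumes a: "\<alpha> > 0" and x: "x > 0"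
  shows "integrable lborel (\<lambda>t. indicator {0<..} t * (exp ((\<alpha> - 1) * ln t) * exp (- (x * t))))"
    and "(\<integral>t. indicator {0<..} t * (exp ((\<alpha> - 1) * ln t) * exp (- (x * t))) \<partial>lborel) = Gamma \<alpha> * exp (- \<alpha> * ln x)"
proof -
  have eq: "indicator {0<..} t *\<^sub>R (rpow t (of_real \<alpha> - 1) * exp (- complex_of_real (x * t))) =
      of_real (indicator {0<..} t * (exp ((\<alpha> - 1) * ln t) * exp (- (x * t))))" for t
    by (simp add: rpow_def indicator_def exp_of_real[symmetric])
  have a': "Re (of_real \<alpha>) > 0" using a by simp
  note G = Gamma_integral_scaled[OF a' x, unfolded eq]
  show "integrable lborel (\<lambda>t. indicator {0<..} t * (exp ((\<alpha> - 1) * ln t) * exp (- (x * t))))"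
    using G(1) unfolding complex_of_real_integrable_eq .
  have "complex_of_real (\<integral>t. indicator {0<..} t * (exp ((\<alpha> - 1) * ln t) * exp (- (x * t))) \<partial>lborel) = Gamma (of_real \<alpha>) * rpow x (- of_real \<alpha>)"
    using G(2) unfolding integral_complex_of_real .
  also have "\<dots> = of_real (Gamma \<alpha> * exp (- \<alpha> * ln x))"
    by (simp add: Gamma_complex_of_real rpow_def exp_of_real[symmetric])
  finally show "(\<integral>t. indicator {0<..} t * (exp ((\<alpha> - 1) * ln t) * exp (- (x * t))) \<partial>lborel) = Gamma \<alpha> * exp (- \<alpha> * ln x)"
    by (simp only: of_real_eq_iff)
qed

text \<open>Write \<open>\<Gamma>(a + b) (s + t)\<^bsup>-a-b\<^esup>\<close> as a Gamma integral in \<open>u\<close> and integrate over \<open>t\<close> first.\<close>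
lemma Beta_integral_half_line:
  assumes a: "Re a > 0" and b: "Re b > 0" and s: "s > 0"
  shows "integrable lborel (\<lambda>t. indicator {0<..} t *\<^sub>R (rpow t (a - 1) * rpow (t + s) (- (a + b))))"
    and "(\<integral>t. indicator {0<..} t *\<^sub>R (rpow t (a - 1) * rpow (t + s) (- (a + b))) \<partial>lborel) = Beta a b * rpow s (- b)"
proof -
  define F where "F = (\<lambda>u t. (indicator {0<..} u * indicator {0<..} t) *\<^sub>R
     (rpow u (a + b - 1) * exp (- complex_of_real ((t + s) * u)) * rpow t (a - 1)))"
  have ab: "Re (a + b) > 0" using a b by simp
  have Gab: "Gamma (a + b) \<noteq> 0"
    using ab by (metis Gamma_eq_zero_iff nonpos_Ints_cases of_int_0_le_iff complex_Re_of_int not_le of_int_le_0_iff)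
  have Ft: "(\<lambda>t. F u t) = (\<lambda>t. (indicator {0<..} u *\<^sub>R (rpow u (a + b - 1) * exp (- complex_of_real (s * u)))) *
      (indicator {0<..} t *\<^sub>R (rpow t (a - 1) * exp (- complex_of_real (u * t)))))" for u
    unfolding F_def by (auto simp: fun_eq_iff indicator_def exp_add[symmetric] algebra_simps)
  have Fu: "(\<lambda>u. F u t) = (\<lambda>u. (indicator {0<..} t *\<^sub>R rpow t (a - 1)) *
      (indicator {0<..} u *\<^sub>R (rpow u (a + b - 1) * exp (- complex_of_real ((t + s) * u)))))" for t
    unfolding F_def by (auto simp: fun_eq_iff indicator_def)
  \<comment> \<open>The inner integral contributes u^(-a), which lowers the exponent a + b - 1 to b
    - 1.\<close>
  have It: "(\<integral>t. F u t \<partial>lborel) = Gamma a * (indicator {0<..} u *\<^sub>R (rpow u (b - 1) * exp (- complex_of_real (s * u))))" for u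
  proof (cases "u > 0")
    case True
    have "rpow u (a + b - 1) * rpow u (- a) = rpow u (b - 1)"
      by (simp add: rpow_add[symmetric])
    then show ?thesis
      unfolding Ft integral_mult_right_zero Gamma_integral_scaled(2)[OF a True] using True by (simp add: mult_ac)
  qed (simp add: Ft)
  have Iu: "(\<integral>u. F u t \<partial>lborel) = Gamma (a + b) * (indicator {0<..} t *\<^sub>R (rpow t (a - 1) * rpow (t + s) (- (a + b))))" for t
  proof (cases "t > 0")
    case True
    then have "t + s > 0" using s by simp
    from Gamma_integral_scaled(2)[OF ab this] show ?thesis
      unfolding Fu integral_mult_right_zero using True by (simp add: mult_ac)
  qed (simp add: Fu)
  \<comment> \<open>Taking norms replaces the exponents by their real parts, so absolute convergence
    is the same computation with real Gamma integrals.\<close>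
  have FnA: "norm (F u t) = (indicator {0<..} u * exp ((Re a + Re b - 1) * ln u) * exp (- (s * u))) *
      (indicator {0<..} t * (exp ((Re a - 1) * ln t) * exp (- (u * t))))" for u t
    unfolding F_def by (auto simp: cmod_rpow norm_mult indicator_def exp_add[symmetric] algebra_simps)
  have FnI: "(\<integral>t. norm (F u t) \<partial>lborel) = Gamma (Re a) * (indicator {0<..} u * (exp ((Re b - 1) * ln u) * exp (- (s * u))))" for u
  proof (cases "u > 0")
    case True
    have e: "exp ((Re a + Re b - 1) * ln u) * exp (- Re a * ln u) = exp ((Re b - 1) * ln u)"
      by (simp add: exp_add[symmetric] algebra_simps)
    have "(\<integral>t. norm (F u t) \<partial>lborel) = exp ((Re a + Re b - 1) * ln u) * exp (- (s * u)) * (Gamma (Re a) * exp (- Re a * ln u))"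
      unfolding FnA using Gamma_integral_scaled_real(2)[OF a True] True by simp
    also have "\<dots> = Gamma (Re a) * (exp (- (s * u)) * (exp ((Re a + Re b - 1) * ln u) * exp (- Re a * ln u)))"
      by (simp only: mult_ac)
    finally show ?thesis unfolding e using True by (simp add: mult_ac)
  qed (simp add: FnA)
  have int: "integrable (lborel \<Otimes>\<^sub>M lborel) (case_prod F)"
  proof (rule lborel_pair.Fubini_integrable)
    show "case_prod F \<in> borel_measurable (lborel \<Otimes>\<^sub>M lborel)"
      unfolding F_def rpow_def by measurable
    show "integrable lborel (\<lambda>u. \<integral>t. norm (case (u,t) of (u,t) \<Rightarrow> F u t) \<partial>lborel)"
      using Gamma_integral_scaled_real(1)[OF b s] by (simp add: FnI)
    show "AE u in lborel. integrable lborel (\<lambda>t. case (u,t) of (u,t) \<Rightarrow> F u t)"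
    proof (rule AE_I2)
      fix u :: real
      show "integrable lborel (\<lambda>t. case (u,t) of (u,t) \<Rightarrow> F u t)"
        unfolding prod.case Ft
      proof (rule integrable_mult_right)
        assume "indicator {0<..} u *\<^sub>R (rpow u (a + b - 1) * exp (- complex_of_real (s * u))) \<noteq> 0"
        then have "u > 0" by (auto simp: indicator_def split: if_splits)
        then show "integrable lborel (\<lambda>t. indicator {0<..} t *\<^sub>R (rpow t (a - 1) * exp (- complex_of_real (u * t))))"
          by (rule Gamma_integral_scaled(1)[OF a])
      qed
    qed
  qed
  have "integrable lborel (\<lambda>t. \<integral>u. F u t \<partial>lborel)" using lborel_pair.integrable_snd[OF int] .
  then show "integrable lborel (\<lambda>t. indicator {0<..} t *\<^sub>R (rpow t (a - 1) * rpow (t + s) (- (a + b))))"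
    unfolding Iu by (rule integrable_cmult_cancel[OF _ Gab])
  have "(\<integral>t. (\<integral>u. F u t \<partial>lborel) \<partial>lborel) = (\<integral>u. (\<integral>t. F u t \<partial>lborel) \<partial>lborel)"
    using lborel_pair.Fubini_integral[OF int] .
  then have "Gamma (a + b) * (\<integral>t. indicator {0<..} t *\<^sub>R (rpow t (a - 1) * rpow (t + s) (- (a + b))) \<partial>lborel) =
      Gamma a * (Gamma b * rpow s (- b))"
    unfolding Iu It integral_mult_right_zero Gamma_integral_scaled(2)[OF b s] .
  then show "(\<integral>t. indicator {0<..} t *\<^sub>R (rpow t (a - 1) * rpow (t + s) (- (a + b))) \<partial>lborel) = Beta a b * rpow s (- b)"
    using Gab by (simp add: Beta_def field_simps)
qed

lemma exp_half_ln: "exp (- (1/2) * ln t) = 1 / sqrt t" if "t > 0" for t :: real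
  using that by (simp add: exp_minus ln_sqrt[symmetric] field_simps)

text \<open>The case a = b = 1/2, where the Beta value is Gamma(1/2)^2 = pi: t^(-1/2) is an
  eigenfunction of the kernel 1 / (t + s) with eigenvalue pi. It provides the dominating function
  for the Mellin transform and the weight of the Schur test.\<close>

lemma hilbert_kernel_integral:
  assumes s: "s > 0"
  shows "integrable lborel (\<lambda>t. indicator {0<..} t * (1 / sqrt t / (t + s)))"
    and "(\<integral>t. indicator {0<..} t * (1 / sqrt t / (t + s)) \<partial>lborel) = pi / sqrt s"
proof -
  have r: "rpow t (of_real (1/2) - 1) = of_real (1 / sqrt t)" if "t > 0" for t
    using exp_half_ln[OF that] unfolding rpow_def
    by (metis (no_types, lifting) diff_divide_eq_iff exp_of_real field_sum_of_halves add_diff_cancel_left' minus_diff_eq of_real_1 of_real_diff of_real_mult)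
  have r1: "rpow (t + s) (- (of_real (1/2) + of_real (1/2))) = of_real (1 / (t + s))" if "t > 0" for t
    using that s rpow_one[of "t + s"] by (simp add: rpow_minus field_simps)
  have r2: "rpow s (- of_real (1/2)) = of_real (1 / sqrt s)"
    using exp_half_ln[OF s] unfolding rpow_def by (metis exp_of_real of_real_minus of_real_mult)
  have eq: "indicator {0<..} t *\<^sub>R (rpow t (of_real (1/2) - 1) * rpow (t + s) (- (of_real (1/2) + of_real (1/2)))) =
      complex_of_real (indicator {0<..} t * (1 / sqrt t / (t + s)))" for t
    using r[of t] r1[of t] by (cases "t > 0") simp_all
  have h: "Re (complex_of_real (1/2)) > 0" by simp
  note B = Beta_integral_half_line[OF h h s, unfolded eq]
  show "integrable lborel (\<lambda>t. indicator {0<..} t * (1 / sqrt t / (t + s)))"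
    using B(1) unfolding complex_of_real_integrable_eq .
  have G: "Beta (complex_of_real (1/2)) (complex_of_real (1/2)) = of_real pi"
    by (simp add: Beta_def Gamma_one_half_complex flip: of_real_mult)
  have "complex_of_real (\<integral>t. indicator {0<..} t * (1 / sqrt t / (t + s)) \<partial>lborel) = of_real (pi / sqrt s)"
    using B(2) unfolding integral_complex_of_real G r2 by simp
  then show "(\<integral>t. indicator {0<..} t * (1 / sqrt t / (t + s)) \<partial>lborel) = pi / sqrt s"
    by (simp only: of_real_eq_iff)
qed

section \<open>Termwise Mellin transform\<close>

lemma fourier_kernel_expand:
  assumes u: "u > 0"
  shows "fourier_kernel \<omega> c u = (\<Sum>\<^sub>\<infinity>l. c l * rpow u (- 1 + \<i> * of_real (\<omega> * of_int l)))"
proof -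
  have "c l * rpow u (- 1 + \<i> * of_real (\<omega> * of_int l)) = (c l * cis (l * \<omega> * ln u)) * (1 / of_real u)" for l :: int
    unfolding rpow_add rpow_minus rpow_one[OF u]
    by (simp add: rpow_def cis_conv_exp field_simps)
  then have "(\<Sum>\<^sub>\<infinity>l. c l * rpow u (- 1 + \<i> * of_real (\<omega> * of_int l))) =
      (\<Sum>\<^sub>\<infinity>l. (c l * cis (l * \<omega> * ln u)) * (1 / of_real u))" by (simp only:)
  then show ?thesis
    unfolding fourier_kernel_def fourier_series_def infsum_cmult_left' by simp
qed

lemma fourier_kernel_bound:
  assumes c: "(\<lambda>l. cmod (c l)) summable_on UNIV" and u: "u > 0"
  shows "cmod (fourier_kernel \<omega> c u) \<le> (\<Sum>\<^sub>\<infinity>l. cmod (c l)) / u"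
  using fourier_series_bound[OF c, of \<omega> "ln u"] u by (simp add: fourier_kernel_def norm_divide divide_right_mono)

lemma cmod_rpow_half: "t > 0 \<Longrightarrow> Re z = - (1/2) \<Longrightarrow> cmod (rpow t z) = 1 / sqrt t"
  using exp_half_ln[of t] by (simp only: cmod_rpow)

text \<open>The term with frequency \<open>l\<close> is a Beta integral whose first argument 1/2 -
  i(\<omega> n + k) is fixed by the Mellin exponent. The exponent of t + s forces the arguments to
  add up to 1 - i \<omega> l, so the second is 1/2 + i(\<omega> (n - l) + k). Column m = n - l of
  row \<open>n\<close> appears, and the sum is reindexed by \<open>m\<close>.\<close>

lemma mellin_fourier_kernel:
  assumes c: "(\<lambda>l. cmod (c l)) summable_on UNIV" and s: "s > 0"
  shows "(\<integral>t. indicator {0<..} t *\<^sub>R (fourier_kernel \<omega> c (t + s) * rpow t (- (1/2) - \<i> * of_real (\<omega> * of_int n + k))) \<partial>lborel) =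
    (\<Sum>\<^sub>\<infinity>m. Hfiber \<omega> c k n m * rpow s (- (1/2) - \<i> * of_real (\<omega> * of_int m + k)))"
proof -
  define \<xi> where "\<xi> = \<omega> * of_int n + k"
  define z where "z = - (1/2) - \<i> * of_real \<xi>"
  define F where "F = (\<lambda>(l::int) t. indicator {0<..} t *\<^sub>R (c l * rpow (t + s) (- 1 + \<i> * of_real (\<omega> * of_int l)) * rpow t z))"
  have "indicator {0<..} t *\<^sub>R (fourier_kernel \<omega> c (t + s) * rpow t z) = (\<Sum>\<^sub>\<infinity>l. F l t)" for t
    using s by (cases "t > 0") (simp_all add: F_def fourier_kernel_expand infsum_cmult_left')
  then have "(\<integral>t. indicator {0<..} t *\<^sub>R (fourier_kernel \<omega> c (t + s) * rpow t z) \<partial>lborel) = (\<integral>t. (\<Sum>\<^sub>\<infinity>l. F l t) \<partial>lborel)"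
    by simp
  also have "\<dots> = (\<Sum>\<^sub>\<infinity>l. \<integral>t. F l t \<partial>lborel)"
  proof (rule integral_infsum_int(2)[OF sigma_finite_lborel _ c hilbert_kernel_integral(1)[OF s]])
    show "F l \<in> borel_measurable lborel" for l unfolding F_def by measurable
    fix l and t :: real
    have "cmod (rpow (t + s) (- 1 + \<i> * of_real (\<omega> * of_int l))) = 1 / (t + s)" if "t > 0"
      using that s by (simp add: cmod_rpow exp_minus field_simps)
    then show "cmod (F l t) \<le> cmod (c l) * (indicat_real {0<..} t * (1 / sqrt t / (t + s)))"
      using cmod_rpow_half[of t z] by (cases "t > 0") (simp_all add: F_def norm_mult z_def mult_ac)
  qed
  also have "\<dots> = (\<Sum>\<^sub>\<infinity>l. Hfiber \<omega> c k n (n - l) * rpow s (- (1/2) - \<i> * of_real (\<omega> * of_int (n - l) + k)))"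
  proof (rule infsum_cong)
    fix l :: int
    define a where "a = 1/2 - \<i> * complex_of_real \<xi>"
    define b where "b = 1/2 + \<i> * complex_of_real (\<omega> * of_int (n - l) + k)"
    have e: "- 1 + \<i> * of_real (\<omega> * of_int l) = - (a + b)" "z = a - 1"
      by (simp_all add: a_def b_def z_def \<xi>_def algebra_simps)
    have ab: "Re a > 0" "Re b > 0" by (simp_all add: a_def b_def)
    have "(\<integral>t. F l t \<partial>lborel) = (\<integral>t. c l * (indicator {0<..} t *\<^sub>R (rpow t (a - 1) * rpow (t + s) (- (a + b)))) \<partial>lborel)"
      unfolding F_def e by (simp add: mult_ac)
    also have "\<dots> = c l * (Beta a b * rpow s (- b))"
      unfolding integral_mult_right_zero Beta_integral_half_line(2)[OF ab s] ..
    also have "Beta a b = Beta (1/2 - \<i> * of_real (\<omega> * of_int n) - \<i> * of_real k)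
        (1/2 + \<i> * of_real (\<omega> * of_int (n - l)) + \<i> * of_real k)"
      by (simp add: a_def b_def \<xi>_def algebra_simps)
    also have "c l * (\<dots> * rpow s (- b)) = Hfiber \<omega> c k n (n - l) * rpow s (- b)"
      by (simp add: Hfiber_def)
    also have "- b = - (1/2) - \<i> * of_real (\<omega> * of_int (n - l) + k)" by (simp add: b_def)
    finally show "(\<integral>t. F l t \<partial>lborel) = Hfiber \<omega> c k n (n - l) * rpow s (- (1/2) - \<i> * of_real (\<omega> * of_int (n - l) + k))" .
  qed
  also have "\<dots> = (\<Sum>\<^sub>\<infinity>m. Hfiber \<omega> c k n m * rpow s (- (1/2) - \<i> * of_real (\<omega> * of_int m + k)))"
  proof -
    have "bij_betw (\<lambda>l. n - l) UNIV (UNIV :: int set)" by (rule bij_betwI[of _ _ _ "\<lambda>l. n - l"]) auto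
    from infsum_reindex_bij_betw[OF this, of "\<lambda>m. Hfiber \<omega> c k n m * rpow s (- (1/2) - \<i> * of_real (\<omega> * of_int m + k))"]
    show ?thesis .
  qed
  finally show ?thesis by (simp add: z_def \<xi>_def)
qed

section \<open>Hilbert-type integrability and limits in mean square\<close>

lemma integrable_indicator_Icc: "integrable lborel (indicat_real {a..b})" for a b :: real
  by (cases "a \<le> b") (auto intro!: integrable_real_indicator)

text \<open>The interval has finite length and \<open>e\<close> has modulus at most 1, so
  integrability of \<phi> dominates the product. In the application \<open>e\<close> is the phase,
  the only factor that depends on \<open>k\<close>.\<close>

lemma integral_parameter_swap:
  fixes \<phi> :: "'a \<Rightarrow> complex" and e :: "real \<Rightarrow> 'a \<Rightarrow> complex"
  assumes M: "sigma_finite_measure M" and \<phi>: "integrable M \<phi>"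
    and e: "(\<lambda>(k,x). e k x) \<in> borel_measurable (lborel \<Otimes>\<^sub>M M)"
    and e1: "\<And>k x. cmod (e k x) \<le> 1"
  shows "set_integrable lborel {a..b} (\<lambda>k. \<integral>x. \<phi> x * e k x \<partial>M)"
    and "(LINT k:{a..b}|lborel. \<integral>x. \<phi> x * e k x \<partial>M) = (\<integral>x. \<phi> x * (LINT k:{a..b}|lborel. e k x) \<partial>M)"
proof -
  interpret M: sigma_finite_measure M by fact
  interpret P: pair_sigma_finite "lborel :: real measure" M ..
  define H where "H = (\<lambda>k x. indicator {a..b} k *\<^sub>R (\<phi> x * e k x))"
  note [measurable] = borel_measurable_integrable[OF \<phi>]
  have e': "(\<lambda>z. e (fst z) (snd z)) \<in> borel_measurable (lborel \<Otimes>\<^sub>M M)" using e by (simp add: case_prod_unfold)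
  have mH: "case_prod H \<in> borel_measurable (lborel \<Otimes>\<^sub>M M)"
    unfolding H_def case_prod_unfold
    by (intro borel_measurable_scaleR borel_measurable_times e') measurable
  have ek: "e k \<in> borel_measurable M" for k
    using measurable_compose[OF measurable_Pair1' e', of k] by simp
  have ex: "(\<lambda>k. e k x) \<in> borel_measurable lborel" if "x \<in> space M" for x
    using measurable_compose[OF measurable_Pair2'[OF that] e'] by simp
  have i1: "integrable M (\<lambda>x. \<phi> x * e k x)" for k
    by (rule Bochner_Integration.integrable_bound[OF \<phi>])
      (use ek e1 in \<open>auto intro!: borel_measurable_times AE_I2 simp: norm_mult mult_left_le\<close>)
  have int: "integrable (lborel \<Otimes>\<^sub>M M) (case_prod H)"
  proof (rule P.Fubini_integrable[OF mH])
    show "integrable lborel (\<lambda>k. \<integral>x. norm (case (k,x) of (k,x) \<Rightarrow> H k x) \<partial>M)"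
    proof (rule Bochner_Integration.integrable_bound)
      show "integrable lborel (\<lambda>k. indicator {a..b} k * (\<integral>x. norm (\<phi> x) \<partial>M))"
        by (intro integrable_mult_left integrable_indicator_Icc)
      have "(\<lambda>z. norm (case_prod H z)) \<in> borel_measurable (lborel \<Otimes>\<^sub>M M)" using mH by measurable
      then show "(\<lambda>k. \<integral>x. norm (case (k,x) of (k,x) \<Rightarrow> H k x) \<partial>M) \<in> borel_measurable lborel"
        by (intro M.borel_measurable_lebesgue_integral) (simp add: case_prod_unfold)
      show "AE k in lborel. norm (\<integral>x. norm (case (k,x) of (k,x) \<Rightarrow> H k x) \<partial>M) \<le> norm (indicator {a..b} k * (\<integral>x. norm (\<phi> x) \<partial>M))"
      proof (rule AE_I2)
        fix k
        have "(\<integral>x. norm (\<phi> x * e k x) \<partial>M) \<le> (\<integral>x. norm (\<phi> x) \<partial>M)"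
          by (intro integral_mono integrable_norm \<phi> i1) (use e1 in \<open>auto simp: norm_mult mult_left_le\<close>)
        moreover have "0 \<le> (\<integral>x. norm (\<phi> x * e k x) \<partial>M)" by simp
        ultimately show "norm (\<integral>x. norm (case (k,x) of (k,x) \<Rightarrow> H k x) \<partial>M) \<le> norm (indicator {a..b} k * (\<integral>x. norm (\<phi> x) \<partial>M))"
          by (simp add: H_def indicator_def)
      qed
    qed
    show "AE k in lborel. integrable M (\<lambda>x. case (k,x) of (k,x) \<Rightarrow> H k x)"
      unfolding H_def prod.case by (intro AE_I2 integrable_scaleR_right i1)
  qed
  have inner: "(\<integral>x. H k x \<partial>M) = indicator {a..b} k *\<^sub>R (\<integral>x. \<phi> x * e k x \<partial>M)" for k
    unfolding H_def by simp
  show "set_integrable lborel {a..b} (\<lambda>k. \<integral>x. \<phi> x * e k x \<partial>M)"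
    using P.integrable_fst[OF int] unfolding inner set_integrable_def .
  have "(LINT k:{a..b}|lborel. \<integral>x. \<phi> x * e k x \<partial>M) = (\<integral>k. \<integral>x. H k x \<partial>M \<partial>lborel)"
    unfolding set_lebesgue_integral_def inner ..
  also have "\<dots> = (\<integral>x. \<integral>k. H k x \<partial>lborel \<partial>M)" using P.Fubini_integral[OF int] by simp
  also have "\<dots> = (\<integral>x. \<phi> x * (LINT k:{a..b}|lborel. e k x) \<partial>M)"
  proof (rule Bochner_Integration.integral_cong[OF refl])
    fix x
    have "(\<integral>k. H k x \<partial>lborel) = (\<integral>k. \<phi> x * (indicator {a..b} k *\<^sub>R e k x) \<partial>lborel)"
      by (simp add: H_def)
    also have "\<dots> = \<phi> x * (LINT k:{a..b}|lborel. e k x)"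
      unfolding set_lebesgue_integral_def integral_mult_right_zero ..
    finally show "(\<integral>k. H k x \<partial>lborel) = \<phi> x * (LINT k:{a..b}|lborel. e k x)" .
  qed
  finally show "(LINT k:{a..b}|lborel. \<integral>x. \<phi> x * e k x \<partial>M) = (\<integral>x. \<phi> x * (LINT k:{a..b}|lborel. e k x) \<partial>M)" .
qed

text \<open>The modulus is at most b - a by the length of the interval and at most 2 / |x| by the
  antiderivative. The two squared bounds are added, and the factor 1 + x^2 packages them. Later x =
  ln t.\<close>

lemma integral_exp_window:
  fixes a b \<theta> x :: real
  assumes ab: "a \<le> b"
  shows "(cmod (LINT k:{a..b}|lborel. exp (- \<i> * of_real ((\<theta> + k) * x))))\<^sup>2 * (1 + x\<^sup>2) \<le> (b - a)\<^sup>2 + 4"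
proof -
  define J where "J = (LINT k:{a..b}|lborel. exp (- \<i> * of_real ((\<theta> + k) * x)))"
  have "cmod J \<le> (LINT k:{a..b}|lborel. 1)"
    unfolding J_def set_lebesgue_integral_def
  proof (rule Bochner_Integration.integral_norm_bound_integral)
    have "set_integrable lborel {a..b} (\<lambda>k. exp (- \<i> * of_real ((\<theta> + k) * x)))"
      by (intro borel_integrable_atLeastAtMost' continuous_intros)
    then show "integrable lborel (\<lambda>k. indicat_real {a..b} k *\<^sub>R exp (- \<i> * of_real ((\<theta> + k) * x)))"
      by (simp only: set_integrable_def)
    show "integrable lborel (\<lambda>k. indicat_real {a..b} k *\<^sub>R (1::real))"
      using integrable_indicator_Icc by simp
  qed (auto simp: indicator_def)
  then have 1: "cmod J \<le> b - a" using ab by (simp add: set_lebesgue_integral_def)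
  have 2: "cmod J * \<bar>x\<bar> \<le> 2"
  proof (cases "x = 0")
    case False
    have "J = exp (- \<i> * of_real ((\<theta> + b) * x)) / (- \<i> * of_real x) - exp (- \<i> * of_real ((\<theta> + a) * x)) / (- \<i> * of_real x)"
      unfolding J_def set_lebesgue_integral_def
    proof (rule integral_FTC_atLeastAtMost[OF ab])
      fix k :: real
      have "((\<lambda>k. exp (- \<i> * ((of_real \<theta> + k) * of_real x)) / (- \<i> * of_real x)) has_field_derivative
          exp (- \<i> * ((of_real \<theta> + of_real k) * of_real x))) (at (of_real k))"
        using False by (auto intro!: derivative_eq_intros simp: mult_ac)
      from has_vector_derivative_real_field[OF this]
      show "((\<lambda>k. exp (- \<i> * of_real ((\<theta> + k) * x)) / (- \<i> * of_real x)) has_vector_derivative exp (- \<i> * of_real ((\<theta> + k) * x))) (at k within {a..b})"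
        by (simp add: o_def)
    qed (intro continuous_intros)
    then have "J * (- \<i> * of_real x) = exp (- \<i> * of_real ((\<theta> + b) * x)) - exp (- \<i> * of_real ((\<theta> + a) * x))"
      using False by (simp add: field_simps)
    then have "cmod (J * (- \<i> * of_real x)) \<le> cmod (exp (- \<i> * of_real ((\<theta> + b) * x))) + cmod (exp (- \<i> * of_real ((\<theta> + a) * x)))"
      by (metis norm_triangle_ineq4)
    then show ?thesis by (simp add: norm_mult)
  qed auto
  have "(cmod J)\<^sup>2 \<le> (b - a)\<^sup>2" using 1 by (intro power_mono) auto
  moreover have "(cmod J * \<bar>x\<bar>)\<^sup>2 \<le> 2\<^sup>2" using 2 by (intro power_mono) auto
  ultimately show ?thesis unfolding J_def[symmetric] by (simp add: power_mult_distrib distrib_left)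
qed

text \<open>The square is dominated by C / (t (1 + (ln t)^2)), the derivative of C * arctan (ln t),
  which has finite limits at 0 and at infinity.\<close>

lemma L2pos_log_decay:
  assumes m: "\<Phi> \<in> borel_measurable borel"
    and le: "\<And>t. t > 0 \<Longrightarrow> (cmod (\<Phi> t))\<^sup>2 * (1 + (ln t)\<^sup>2) \<le> C"
  shows "L2pos (\<lambda>t. \<Phi> t / of_real (sqrt t))"
proof -
  have ft: "set_integrable lborel (einterval 0 \<infinity>) (\<lambda>t. 1 / (t * (1 + (ln t)\<^sup>2)))"
  proof (rule interval_integral_FTC_nonneg[where F = "\<lambda>t. arctan (ln t)" and A = "- pi / 2" and B = "pi / 2"])
    fix t :: real assume "0 < ereal t"
    then have t: "t > 0" by simp
    then show "((\<lambda>t. arctan (ln t)) has_real_derivative 1 / (t * (1 + (ln t)\<^sup>2))) (at t)"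
      by (auto intro!: derivative_eq_intros simp: field_simps)
    show "isCont (\<lambda>t. 1 / (t * (1 + (ln t)\<^sup>2))) t"
      using t by (intro continuous_intros) (auto simp: add_nonneg_eq_0_iff)
  next
    show "AE t in lborel. 0 < ereal t \<longrightarrow> ereal t < \<infinity> \<longrightarrow> 0 \<le> 1 / (t * (1 + (ln t)\<^sup>2))"
      by (intro AE_I2) (auto intro!: divide_nonneg_nonneg mult_nonneg_nonneg)
    have "((\<lambda>t. arctan (ln t)) \<longlongrightarrow> - (pi / 2)) (at_right 0)"
      by (rule filterlim_compose[OF tendsto_arctan_at_bot ln_at_0])
    then show "(((\<lambda>t. arctan (ln t)) \<circ> real_of_ereal) \<longlongrightarrow> - pi / 2) (at_right 0)"
      using ereal_tendsto_simps1(2)[of "\<lambda>t. arctan (ln t)" "- pi / 2" 0] by (simp add: zero_ereal_def)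
    have "((\<lambda>t. arctan (ln t)) \<longlongrightarrow> pi / 2) at_top"
      by (rule filterlim_compose[OF tendsto_arctan_at_top ln_at_top])
    then show "(((\<lambda>t. arctan (ln t)) \<circ> real_of_ereal) \<longlongrightarrow> pi / 2) (at_left \<infinity>)"
      using ereal_tendsto_simps1(3)[of "\<lambda>t. arctan (ln t)" "pi / 2"] by simp
  qed auto
  have ei: "einterval 0 \<infinity> = {0<..}" by (auto simp: einterval_def)
  have "set_integrable lborel {0<..} (\<lambda>t. (cmod (\<Phi> t / of_real (sqrt t)))\<^sup>2)"
    unfolding set_integrable_def
  proof (rule Bochner_Integration.integrable_bound)
    show "integrable lborel (\<lambda>t. C * (indicator {0<..} t *\<^sub>R (1 / (t * (1 + (ln t)\<^sup>2)))))"
      using ft unfolding ei set_integrable_def by (rule integrable_mult_right)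
    show "(\<lambda>t. indicat_real {0<..} t *\<^sub>R (cmod (\<Phi> t / of_real (sqrt t)))\<^sup>2) \<in> borel_measurable lborel"
      using m by measurable
    show "AE t in lborel. norm (indicat_real {0<..} t *\<^sub>R (cmod (\<Phi> t / of_real (sqrt t)))\<^sup>2) \<le>
        norm (C * (indicator {0<..} t *\<^sub>R (1 / (t * (1 + (ln t)\<^sup>2)))))"
    proof (rule AE_I2)
      fix t :: real
      show "norm (indicat_real {0<..} t *\<^sub>R (cmod (\<Phi> t / of_real (sqrt t)))\<^sup>2) \<le>
        norm (C * (indicator {0<..} t *\<^sub>R (1 / (t * (1 + (ln t)\<^sup>2)))))"
      proof (cases "t > 0")
        case True
        have pos: "1 + (ln t)\<^sup>2 > 0" by (simp add: add_pos_nonneg)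
        have "0 \<le> C" using le[OF True] pos by (meson mult_nonneg_nonneg order_trans less_imp_le zero_le_power2)
        moreover have "(cmod (\<Phi> t))\<^sup>2 \<le> C / (1 + (ln t)\<^sup>2)" using le[OF True] pos by (simp add: pos_le_divide_eq)
        then have "(cmod (\<Phi> t))\<^sup>2 / t \<le> C / (1 + (ln t)\<^sup>2) / t" using True by (intro divide_right_mono) auto
        ultimately show ?thesis using True pos by (simp add: norm_divide power_divide abs_mult mult.commute)
      qed simp
    qed
  qed
  then show ?thesis using m unfolding L2pos_def by simp
qed

text \<open>Integrated over \<open>t\<close>, the weight gives sqrt s * (pi / sqrt s) = pi, so the
  double integral is pi times the squared norm of \<open>u\<close>.\<close>

lemma schur_weight_integrable:
  assumes u: "L2pos u"
  shows "integrable (lborel \<Otimes>\<^sub>M lborel) (\<lambda>(s,t). indicator {0<..} s * indicator {0<..} t * ((cmod (u s))\<^sup>2 * sqrt s / (sqrt t * (t + s))))"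
proof -
  have [measurable]: "u \<in> borel_measurable borel" using u by (simp add: L2pos_def)
  define A where "A = (\<lambda>s t. indicator {0<..} s * indicator {0<..} t * ((cmod (u s))\<^sup>2 * sqrt s / (sqrt t * (t + s))))"
  have A: "A s t = (indicator {0<..} s * (cmod (u s))\<^sup>2 * sqrt s) * (indicator {0<..} t * (1 / sqrt t / (t + s)))" for s t
    by (simp add: A_def)
  have A0: "norm (A s t) = A s t" for s t by (simp add: A_def indicator_def)
  have iA: "integrable lborel (\<lambda>t. A s t)" for s
  proof (cases "s > 0")
    case True
    show ?thesis unfolding A by (intro integrable_mult_right hilbert_kernel_integral(1)[OF True])
  qed (simp add: A)
  have IA: "(\<integral>t. A s t \<partial>lborel) = pi * (indicator {0<..} s *\<^sub>R (cmod (u s))\<^sup>2)" for s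
    unfolding A integral_mult_right_zero using hilbert_kernel_integral(2)[of s]
    by (cases "s > 0") auto
  have "integrable (lborel \<Otimes>\<^sub>M lborel) (case_prod A)"
  proof (rule lborel_pair.Fubini_integrable)
    show "case_prod A \<in> borel_measurable (lborel \<Otimes>\<^sub>M lborel)" unfolding A_def by measurable
    show "integrable lborel (\<lambda>s. \<integral>t. norm (case (s,t) of (s,t) \<Rightarrow> A s t) \<partial>lborel)"
      unfolding prod.case A0 IA using u by (intro integrable_mult_right) (simp add: L2pos_def set_integrable_def)
    show "AE s in lborel. integrable lborel (\<lambda>t. case (s,t) of (s,t) \<Rightarrow> A s t)"
      using iA by simp
  qed
  then show ?thesis by (simp add: A_def)
qed

text \<open>Hilbert's inequality in the weak form of mere integrability, by the Schur test:
  \<open>2 x y \<le> r x\<^sup>2 + y\<^sup>2 / r\<close> with \<open>r = sqrt (s / t)\<close>.\<close>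
lemma hilbert_integrable:
  assumes u: "L2pos u" and v: "L2pos v"
  shows "integrable (lborel \<Otimes>\<^sub>M lborel) (\<lambda>(s,t). indicator {0<..} s * indicator {0<..} t * (cmod (u s) * cmod (v t) / (t + s)))"
proof (rule Bochner_Integration.integrable_bound)
  have [measurable]: "u \<in> borel_measurable borel" "v \<in> borel_measurable borel" using u v by (simp_all add: L2pos_def)
  let ?A = "\<lambda>(s,t). indicator {0<..} s * indicator {0<..} t * ((cmod (u s))\<^sup>2 * sqrt s / (sqrt t * (t + s)))"
  let ?B = "\<lambda>(s,t). indicator {0<..} t * indicator {0<..} s * ((cmod (v t))\<^sup>2 * sqrt t / (sqrt s * (s + t)))"
  have "integrable (lborel \<Otimes>\<^sub>M lborel) ?B"
    using lborel_pair.integrable_product_swap[OF schur_weight_integrable[OF v]] by (simp add: case_prod_unfold)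
  then show "integrable (lborel \<Otimes>\<^sub>M lborel) (\<lambda>z. ?A z + ?B z)"
    by (intro Bochner_Integration.integrable_add schur_weight_integrable[OF u])
  show "(\<lambda>(s,t). indicator {0<..} s * indicator {0<..} t * (cmod (u s) * cmod (v t) / (t + s))) \<in> borel_measurable (lborel \<Otimes>\<^sub>M lborel)"
    by measurable
  have "cmod (u s) * cmod (v t) / (t + s) \<le> (cmod (u s))\<^sup>2 * sqrt s / (sqrt t * (t + s)) + (cmod (v t))\<^sup>2 * sqrt t / (sqrt s * (s + t))"
    if "s > 0" "t > 0" for s t
  proof -
    define r where "r = sqrt s / sqrt t"
    define x where "x = cmod (u s)"
    define y where "y = cmod (v t)"
    have r: "r > 0" using that by (simp add: r_def)
    have "0 \<le> (x * r - y)\<^sup>2 / r" using r by simp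
    also have "\<dots> = x\<^sup>2 * r + y\<^sup>2 / r - 2 * (x * y)" using r by (simp add: power2_eq_square field_simps)
    finally have "2 * (x * y) \<le> x\<^sup>2 * r + y\<^sup>2 / r" by simp
    moreover have "0 \<le> x * y" by (simp add: x_def y_def)
    ultimately have "x * y \<le> x\<^sup>2 * r + y\<^sup>2 / r" by linarith
    then have "x * y / (t + s) \<le> (x\<^sup>2 * r + y\<^sup>2 / r) / (t + s)" using that by (intro divide_right_mono) auto
    also have "\<dots> = x\<^sup>2 * sqrt s / (sqrt t * (t + s)) + y\<^sup>2 * sqrt t / (sqrt s * (s + t))"
      unfolding r_def by (simp add: add_divide_distrib add.commute)
    finally show ?thesis by (simp add: x_def y_def)
  qed
  then show "AE z in lborel \<Otimes>\<^sub>M lborel. norm (case z of (s,t) \<Rightarrow> indicator {0<..} s * indicator {0<..} t * (cmod (u s) * cmod (v t) / (t + s))) \<le> norm (?A z + ?B z)"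
    by (intro AE_I2) (auto simp: indicator_def intro!: order_trans[OF _ abs_ge_self])
qed

text \<open>On an interval of finite length mean-square convergence implies convergence in mean; |D|
  <= \<epsilon> + |D|^2 / \<epsilon> takes the place of the Cauchy-Schwarz inequality. The limit is
  integrable because it differs from some integrable \<open>U j\<close> by an integrable
  function.\<close>

lemma L2_limit_interval_integral:
  fixes U :: "nat \<Rightarrow> real \<Rightarrow> complex"
  assumes ab: "a \<le> b" and U: "\<And>j. set_integrable lborel {a..b} (U j)"
    and v: "v \<in> borel_measurable borel"
    and lim: "(\<lambda>j. \<integral>\<^sup>+k. indicator {a..b} k * ennreal ((cmod (U j k - v k))\<^sup>2) \<partial>lborel) \<longlonglongrightarrow> 0"
  shows "set_integrable lborel {a..b} v"
    and "(\<lambda>j. LINT k:{a..b}|lborel. U j k) \<longlonglongrightarrow> (LINT k:{a..b}|lborel. v k)"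
proof -
  define \<delta> where "\<delta> = (\<lambda>j. \<integral>\<^sup>+k. indicator {a..b} k * ennreal ((cmod (U j k - v k))\<^sup>2) \<partial>lborel)"
  define D where "D = (\<lambda>j k. indicator {a..b} k *\<^sub>R (U j k - v k))"
  have mU: "(\<lambda>k. indicator {a..b} k *\<^sub>R U j k) \<in> borel_measurable borel" for j
    using U[of j] by (auto simp: set_integrable_def)
  have D_eq: "D j = (\<lambda>k. indicator {a..b} k *\<^sub>R U j k - indicator {a..b} k *\<^sub>R v k)" for j
    by (simp add: D_def scaleR_diff_right)
  have mD: "D j \<in> borel_measurable borel" for j
    unfolding D_eq using mU v by measurable
  have \<delta>D: "\<delta> j = (\<integral>\<^sup>+k. ennreal ((cmod (D j k))\<^sup>2) \<partial>lborel)" for j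
    unfolding \<delta>_def D_def by (intro nn_integral_cong) (auto simp: indicator_def)
  have bd: "(\<integral>\<^sup>+k. ennreal (cmod (D j k)) \<partial>lborel) \<le> ennreal (\<epsilon> * (b - a)) + ennreal (1 / \<epsilon>) * \<delta> j"
    if \<epsilon>: "\<epsilon> > 0" for \<epsilon> j
  proof -
    have "cmod (D j k) \<le> \<epsilon> * indicator {a..b} k + 1 / \<epsilon> * (cmod (D j k))\<^sup>2" for k
    proof (cases "k \<in> {a..b}")
      case True
      define x where "x = cmod (D j k)"
      have "0 \<le> (x - \<epsilon>)\<^sup>2 / \<epsilon>" using \<epsilon> by simp
      also have "\<dots> = x\<^sup>2 / \<epsilon> + \<epsilon> - 2 * x" using \<epsilon> by (simp add: power2_eq_square field_simps)
      finally have "2 * x \<le> \<epsilon> + x\<^sup>2 / \<epsilon>" by simp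
      moreover have "0 \<le> x" by (simp add: x_def)
      ultimately have "x \<le> \<epsilon> + x\<^sup>2 / \<epsilon>" by linarith
      then show ?thesis using True by (simp add: x_def)
    qed (simp add: D_def)
    then have "(\<integral>\<^sup>+k. ennreal (cmod (D j k)) \<partial>lborel) \<le> (\<integral>\<^sup>+k. ennreal (\<epsilon> * indicator {a..b} k + 1 / \<epsilon> * (cmod (D j k))\<^sup>2) \<partial>lborel)"
      by (intro nn_integral_mono ennreal_leI)
    also have "\<dots> = (\<integral>\<^sup>+k. ennreal \<epsilon> * indicator {a..b} k + ennreal (1 / \<epsilon>) * ennreal ((cmod (D j k))\<^sup>2) \<partial>lborel)"
      using \<epsilon> by (intro nn_integral_cong) (simp add: ennreal_plus[symmetric] ennreal_mult[symmetric] indicator_def del: ennreal_plus)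
    also have "\<dots> = (\<integral>\<^sup>+k. ennreal \<epsilon> * indicator {a..b} k \<partial>lborel) + (\<integral>\<^sup>+k. ennreal (1 / \<epsilon>) * ennreal ((cmod (D j k))\<^sup>2) \<partial>lborel)"
      using mD by (intro nn_integral_add) measurable
    also have "\<dots> = ennreal (\<epsilon> * (b - a)) + ennreal (1 / \<epsilon>) * \<delta> j"
      using mD ab \<epsilon> unfolding \<delta>D by (simp add: nn_integral_cmult nn_integral_cmult_indicator ennreal_mult)
    finally show ?thesis .
  qed
  have iD: "integrable lborel (D j)" if "\<delta> j < \<infinity>" for j
  proof (rule integrableI_bounded)
    show "D j \<in> borel_measurable lborel" using mD by simp
    have "ennreal (1 * (b - a)) + ennreal (1 / 1) * \<delta> j < \<infinity>" using that by (simp add: ennreal_mult_less_top)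
    then show "(\<integral>\<^sup>+k. ennreal (cmod (D j k)) \<partial>lborel) < \<infinity>"
      using bd[of 1 j] by (simp add: order_le_less_trans)
  qed
  have ev: "\<forall>\<^sub>F j in sequentially. \<delta> j < \<infinity>"
    using order_tendstoD(2)[OF lim, of \<infinity>] unfolding \<delta>_def by simp
  have vi: "integrable lborel (\<lambda>k. indicator {a..b} k *\<^sub>R v k)" 
  proof -
    obtain j where "\<delta> j < \<infinity>" using ev by (metis eventually_happens' trivial_limit_sequentially)
    from Bochner_Integration.integrable_diff[OF U[of j, unfolded set_integrable_def] iD[OF this]]
    show ?thesis unfolding D_eq by simp
  qed
  then show "set_integrable lborel {a..b} v" by (simp add: set_integrable_def)
  have dD: "(LINT k:{a..b}|lborel. U j k) - (LINT k:{a..b}|lborel. v k) = (\<integral>k. D j k \<partial>lborel)" for j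
    unfolding D_eq set_lebesgue_integral_def
    by (rule Bochner_Integration.integral_diff[symmetric]) (use U[of j] vi in \<open>auto simp: set_integrable_def\<close>)
  show "(\<lambda>j. LINT k:{a..b}|lborel. U j k) \<longlonglongrightarrow> (LINT k:{a..b}|lborel. v k)"
  proof (rule LIMSEQ_I)
    fix r :: real assume r: "r > 0"
    \<comment> \<open>The added 1 keeps \<open>L\<close> positive when a = b. Each of the two
      summands of \<open>bd\<close> is then allotted r / 2.\<close>
    define L where "L = b - a + 1"
    define \<epsilon> where "\<epsilon> = r / (2 * L)"
    have L: "L > 0" using ab by (simp add: L_def)
    have \<epsilon>: "\<epsilon> > 0" using r L by (simp add: \<epsilon>_def)
    have e1: "\<epsilon> * (b - a) \<le> r / 2"
    proof -
      have "\<epsilon> * (b - a) \<le> \<epsilon> * L" using \<epsilon> by (intro mult_left_mono) (auto simp: L_def)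
      also have "\<dots> = r / 2" using L by (simp add: \<epsilon>_def)
      finally show ?thesis .
    qed
    have "\<forall>\<^sub>F j in sequentially. \<delta> j < ennreal (\<epsilon> * (r / 2))"
      using order_tendstoD(2)[OF lim, of "ennreal (\<epsilon> * (r / 2))"] \<epsilon> r unfolding \<delta>_def by simp
    with ev have "\<forall>\<^sub>F j in sequentially. norm ((LINT k:{a..b}|lborel. U j k) - (LINT k:{a..b}|lborel. v k)) < r"
    proof eventually_elim
      case (elim j)
      have "ennreal (norm (\<integral>k. D j k \<partial>lborel)) \<le> (\<integral>\<^sup>+k. ennreal (cmod (D j k)) \<partial>lborel)"
        by (rule integral_norm_bound_ennreal[OF iD[OF elim(1)]])
      also have "\<dots> \<le> ennreal (\<epsilon> * (b - a)) + ennreal (1 / \<epsilon>) * \<delta> j" by (rule bd[OF \<epsilon>])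
      also have "\<dots> \<le> ennreal (r / 2) + ennreal (1 / \<epsilon>) * \<delta> j"
        using e1 by (intro add_right_mono ennreal_leI)
      also have "\<dots> < ennreal (r / 2) + ennreal (1 / \<epsilon>) * ennreal (\<epsilon> * (r / 2))"
        unfolding ennreal_add_left_cancel_less
        using elim(2) \<epsilon> by (auto intro!: ennreal_mult_strict_left_mono)
      also have "\<dots> = ennreal r" using \<epsilon> r by (simp add: ennreal_mult[symmetric] ennreal_plus[symmetric] del: ennreal_plus)
      finally show ?case unfolding dD using r by (simp add: ennreal_less_iff)
    qed
    then show "\<exists>N. \<forall>j\<ge>N. norm ((LINT k:{a..b}|lborel. U j k) - (LINT k:{a..b}|lborel. v k)) < r"
      by (simp add: eventually_sequentially)
  qed
qed

section \<open>Comparison of the two transforms on windows\<close>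

text \<open>The Mellin kernel stripped of its modulus t^(-1/2). The dependence on \<open>k\<close>
  is thereby confined to a unimodular factor.\<close>

definition phase :: "real \<Rightarrow> int \<Rightarrow> real \<Rightarrow> real \<Rightarrow> complex" where
  "phase \<omega> n k t = exp (- \<i> * of_real ((\<omega> * of_int n + k) * ln t))"

lemma cmod_phase: "cmod (phase \<omega> n k t) = 1"
  by (simp add: phase_def)

lemma rpow_eq_phase:
  assumes "t > 0"
  shows "rpow t (- (1/2) - \<i> * of_real (\<omega> * of_int n + k)) = phase \<omega> n k t / of_real (sqrt t)"
proof -
  have "rpow t (- (1/2) - \<i> * of_real (\<omega> * of_int n + k)) =
      exp (of_real (- (1/2) * ln t)) * phase \<omega> n k t"
    unfolding rpow_def phase_def exp_add[symmetric] by (simp add: algebra_simps)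
  then show ?thesis unfolding exp_of_real exp_half_ln[OF assms] by simp
qed

section \<open>Truncated transforms\<close>

lemma Utrunc_eq_rpow:
  assumes "R > 0"
  shows "Utrunc \<omega> f R k m = (1 / of_real (sqrt (2 * pi))) *
     (\<integral>t. indicator {1/R..R} t *\<^sub>R (f t * rpow t (- (1/2) - \<i> * of_real (\<omega> * of_int m + k))) \<partial>lborel)"
proof -
  have e: "- (1/2) - \<i> * of_real k - \<i> * of_real (\<omega> * of_int m) = - (1/2) - \<i> * of_real (\<omega> * of_int m + k)"
    by (simp add: algebra_simps)
  have "indicator {1/R..R} t *\<^sub>R (f t * of_real t powr (- (1/2) - \<i> * of_real (\<omega> * of_int m + k))) =
      indicator {1/R..R} t *\<^sub>R (f t * rpow t (- (1/2) - \<i> * of_real (\<omega> * of_int m + k)))" for t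
  proof (cases "t \<in> {1/R..R}")
    case True
    then have "1 / R \<le> t" by simp
    moreover have "0 < 1 / R" using assms by simp
    ultimately have "t > 0" by linarith
    then show ?thesis by (simp add: rpow_eq_powr)
  qed simp
  then show ?thesis unfolding Utrunc_def set_lebesgue_integral_def e by (simp only:)
qed

lemma pos_of_mem_window: "R > 0 \<Longrightarrow> t \<in> {1/R..R} \<Longrightarrow> t > 0" for R t :: real
  by (meson atLeastAtMost_iff less_le_trans zero_less_divide_1_iff)

text \<open>By the arithmetic-geometric mean inequality the integrand is at most |f(s)|^2 + 1/s, and
  1/s <= R on the window.\<close>

lemma trunc_weight_integrable:
  assumes f: "L2pos f" and R: "R > 0"
  shows "integrable lborel (\<lambda>s. indicator {1/R..R} s * (cmod (f s) / sqrt s))"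
proof (rule Bochner_Integration.integrable_bound)
  have [measurable]: "f \<in> borel_measurable borel" using f by (simp add: L2pos_def)
  show "integrable lborel (\<lambda>s. indicator {0<..} s *\<^sub>R (cmod (f s))\<^sup>2 + R * indicator {1/R..R} s)"
    using f by (intro Bochner_Integration.integrable_add integrable_mult_right integrable_indicator_Icc)
      (simp add: L2pos_def set_integrable_def)
  show "(\<lambda>s. indicator {1/R..R} s * (cmod (f s) / sqrt s)) \<in> borel_measurable lborel" by measurable
  have "cmod (f s) / sqrt s \<le> (cmod (f s))\<^sup>2 + R" if "s \<in> {1/R..R}" for s
  proof -
    have s: "s > 0" by (rule pos_of_mem_window[OF R that])
    have "1 / s \<le> R" using that R s by (simp add: field_simps)
    have p: "(1 / sqrt s)\<^sup>2 = 1 / s" using s by (simp add: power_divide)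
    have "2 * cmod (f s) * (1 / sqrt s) \<le> (cmod (f s))\<^sup>2 + 1 / s"
      using sum_squares_bound[of "cmod (f s)" "1 / sqrt s"] unfolding p .
    moreover have "0 \<le> cmod (f s) * (1 / sqrt s)" using s by simp
    ultimately show ?thesis using \<open>1 / s \<le> R\<close> by simp
  qed
  note le = this
  show "AE s in lborel. norm (indicator {1/R..R} s * (cmod (f s) / sqrt s)) \<le>
      norm (indicator {0<..} s *\<^sub>R (cmod (f s))\<^sup>2 + R * indicator {1/R..R} s)"
  proof (rule AE_I2)
    fix s
    show "norm (indicator {1/R..R} s * (cmod (f s) / sqrt s)) \<le>
        norm (indicator {0<..} s *\<^sub>R (cmod (f s))\<^sup>2 + R * indicator {1/R..R} s)"
      using le[of s] pos_of_mem_window[OF R, of s] by (cases "s \<in> {1/R..R}") simp_all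
  qed
qed

lemma trunc_integrand_bound:
  assumes R: "R > 0"
  shows "cmod (indicator {1/R..R} s *\<^sub>R (f s * rpow s (- (1/2) - \<i> * of_real (\<omega> * of_int m + k)))) =
    indicator {1/R..R} s * (cmod (f s) / sqrt s)"
proof (cases "s \<in> {1/R..R}")
  case True
  then have "s > 0" by (rule pos_of_mem_window[OF R])
  then show ?thesis using True cmod_rpow_half[of s "- (1/2) - \<i> * of_real (\<omega> * of_int m + k)"]
    by (simp add: norm_mult)
qed simp

text \<open>The bound is uniform in \<open>m\<close>, so the absolutely summable rows of the fiber
  matrix can be applied to the truncated transform.\<close>

lemma Utrunc_bound:
  assumes f: "L2pos f" and R: "R > 0"
  shows "cmod (Utrunc \<omega> f R k m) \<le> (1 / sqrt (2 * pi)) * (\<integral>s. indicator {1/R..R} s * (cmod (f s) / sqrt s) \<partial>lborel)"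
proof -
  let ?h = "\<lambda>s. indicator {1/R..R} s *\<^sub>R (f s * rpow s (- (1/2) - \<i> * of_real (\<omega> * of_int m + k)))"
  have [measurable]: "f \<in> borel_measurable borel" using f by (simp add: L2pos_def)
  have "integrable lborel ?h"
  proof (rule Bochner_Integration.integrable_bound[OF trunc_weight_integrable[OF f R]])
    show "AE s in lborel. norm (?h s) \<le> norm (indicator {1/R..R} s * (cmod (f s) / sqrt s))"
      unfolding trunc_integrand_bound[OF R] by (intro AE_I2) (simp only: real_norm_def abs_ge_self)
  qed measurable
  then have "cmod (\<integral>s. ?h s \<partial>lborel) \<le> (\<integral>s. indicator {1/R..R} s * (cmod (f s) / sqrt s) \<partial>lborel)"
    by (rule Bochner_Integration.integral_norm_bound_integral[OF _ trunc_weight_integrable[OF f R]])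
      (simp only: trunc_integrand_bound[OF R] order_refl)
  then show ?thesis unfolding Utrunc_eq_rpow[OF R] norm_mult
    by (intro mult_mono) (auto simp: norm_divide)
qed

text \<open>The integrand common to both sides of the diagonalization. Multiplied by the phase in
  \<open>t\<close>, it leads to the transform of the Hankel image if \<open>s\<close> is integrated
  first, and to the fiber matrix acting on the transform of \<open>f\<close> if \<open>t\<close> is
  integrated first.\<close>

definition hankel_density :: "real \<Rightarrow> (int \<Rightarrow> complex) \<Rightarrow> (real \<Rightarrow> complex) \<Rightarrow> real \<times> real \<Rightarrow> complex" where
  "hankel_density \<omega> c f = (\<lambda>(s,t). (indicator {0<..} s * indicator {0<..} t) *\<^sub>R
     (f s * fourier_kernel \<omega> c (t + s) / of_real (sqrt t)))"

text \<open>Exhaustion is demanded only where \<phi> is nonzero, because the cutoffs exhaust the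
  open quadrant and not the plane.\<close>

lemma truncation_limit:
  fixes \<phi> :: "'a \<Rightarrow> complex" and A :: "nat \<Rightarrow> 'a set"
  assumes \<phi>: "integrable M \<phi>" and A: "\<And>j. A j \<in> sets M"
    and ev: "\<And>x. \<phi> x \<noteq> 0 \<Longrightarrow> \<forall>\<^sub>F j in sequentially. x \<in> A j"
  shows "(\<lambda>j. \<integral>x. \<phi> x * of_real (indicator (A j) x) \<partial>M) \<longlonglongrightarrow> (\<integral>x. \<phi> x \<partial>M)"
proof (rule integral_dominated_convergence)
  note [measurable] = A borel_measurable_integrable[OF \<phi>]
  show "\<phi> \<in> borel_measurable M" by measurable
  show "(\<lambda>x. \<phi> x * of_real (indicator (A j) x)) \<in> borel_measurable M" for j by measurable
  show "integrable M (\<lambda>x. cmod (\<phi> x))" using \<phi> by simp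
  show "AE x in M. (\<lambda>j. \<phi> x * of_real (indicator (A j) x)) \<longlonglongrightarrow> \<phi> x"
  proof (rule AE_I2)
    fix x
    show "(\<lambda>j. \<phi> x * of_real (indicator (A j) x)) \<longlonglongrightarrow> \<phi> x"
    proof (cases "\<phi> x = 0")
      case False
      have "\<forall>\<^sub>F j in sequentially. \<phi> x * of_real (indicator (A j) x) = \<phi> x"
        using ev[OF False] by eventually_elim simp
      then show ?thesis by (rule tendsto_eventually)
    qed simp
  qed
  show "AE x in M. norm (\<phi> x * of_real (indicator (A j) x)) \<le> cmod (\<phi> x)" for j
    by (intro AE_I2) (auto simp: indicator_def)
qed

lemma eventually_mem_window: "t > 0 \<Longrightarrow> \<forall>\<^sub>F j in sequentially. t \<in> {1 / real (Suc j)..real (Suc j)}"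
proof -
  assume t: "t > 0"
  obtain N :: nat where N: "max t (1 / t) < real N" using reals_Archimedean2 by blast
  show ?thesis using eventually_ge_at_top[of N]
  proof eventually_elim
    case (elim j)
    then have "real N \<le> real (Suc j)" by simp
    then have *: "t \<le> real (Suc j)" "1 / t \<le> real (Suc j)" using N by auto
    then have "1 / real (Suc j) \<le> t" using t by (simp add: field_simps)
    with * show ?case by simp
  qed
qed

text \<open>Cutoffs at \<open>Suc j\<close> stay positive for all \<open>j\<close> and make the
  limit sequential, as dominated convergence requires.\<close>

lemma Ueq_sequence:
  assumes "Ueq \<omega> f g"
  shows "(\<lambda>j. \<integral>\<^sup>+k. indicator (Omega \<omega>) k *
      (\<Sum>\<^sub>\<infinity> m. ennreal ((cmod (Utrunc \<omega> f (real (Suc j)) k m - g k m))\<^sup>2)) \<partial>lborel) \<longlonglongrightarrow> 0"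
  by (rule filterlim_compose[OF conjunct2[OF assms[unfolded Ueq_def]]
        filterlim_compose[OF filterlim_real_sequentially filterlim_Suc]])

lemma ennreal_component_le_infsum:
  fixes F :: "int \<Rightarrow> ennreal"
  shows "F m \<le> (\<Sum>\<^sub>\<infinity>m. F m)"
proof -
  have "infsum F {m} \<le> infsum F UNIV"
    by (intro infsum_mono_neutral nonneg_summable_on_complete) auto
  then show ?thesis by simp
qed

text \<open>The endpoint \<open>\<omega> / 2\<close> is not in \<open>Omega\<close>, but a single point is negligible.\<close>
lemma nn_integral_window_le_Omega:
  assumes "- \<omega> / 2 \<le> a" "b \<le> \<omega> / 2" and le: "\<And>k. k \<in> Omega \<omega> \<Longrightarrow> F k \<le> G k"
  shows "(\<integral>\<^sup>+k. indicator {a..b} k * F k \<partial>lborel) \<le> (\<integral>\<^sup>+k. indicator (Omega \<omega>) k * G k \<partial>lborel)"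
proof (rule nn_integral_mono_AE)
  have "AE k in lborel. k \<noteq> \<omega> / 2" by (rule AE_lborel_singleton)
  then show "AE k in lborel. indicator {a..b} k * F k \<le> indicator (Omega \<omega>) k * G k"
  proof eventually_elim
    case (elim k)
    show ?case
    proof (cases "k \<in> {a..b}")
      case True
      then have "k \<in> Omega \<omega>" using elim assms by (auto simp: Omega_def)
      then show ?thesis using True le by simp
    qed simp
  qed
qed

lemma weighted_summable_imp_abs_summable:
  assumes "(\<lambda>l::int. cmod (c l) * (1 + (real_of_int l)\<^sup>2) powr (1/4)) summable_on UNIV"
  shows "(\<lambda>l. cmod (c l)) summable_on UNIV"
proof (rule summable_on_comparison_test[OF assms])
  fix l :: int
  have "1 \<le> (1 + (real_of_int l)\<^sup>2) powr (1/4)" by (simp add: ge_one_powr_ge_zero)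
  then show "cmod (c l) \<le> cmod (c l) * (1 + (real_of_int l)\<^sup>2) powr (1/4)"
    by (simp add: mult_le_cancel_left1)
qed auto

lemma Hfiber_abs_summable:
  assumes "\<omega> > 0" "k \<in> Omega \<omega>"
    and "(\<lambda>l::int. cmod (c l) * (1 + (real_of_int l)\<^sup>2) powr (1/4)) summable_on UNIV"
  shows "(\<lambda>(n,m). cmod (Hfiber \<omega> c k n m)) summable_on UNIV"
  by (rule summable_on_comparison_test[OF fiber_major_summable[OF assms(1,3)]])
    (use Hfiber_le_major[OF assms(1,2)] in auto)

section \<open>One component of the identity, tested on windows of quasimomenta\<close>

context
  fixes \<omega> :: real and c :: "int \<Rightarrow> complex" and f :: "real \<Rightarrow> complex" and n :: int
  assumes \<omega>: "\<omega> > 0"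
    and c4: "(\<lambda>l::int. cmod (c l) * (1 + (real_of_int l)\<^sup>2) powr (1/4)) summable_on UNIV"
    and f: "L2pos f"
begin

lemmas c_summable = weighted_summable_imp_abs_summable[OF c4]

lemma f_measurable [measurable]: "f \<in> borel_measurable borel"
  using f by (simp add: L2pos_def)

lemma density_measurable [measurable]:
  "hankel_density \<omega> c f \<in> borel_measurable (lborel \<Otimes>\<^sub>M lborel)"
  unfolding hankel_density_def by measurable

lemma density_bound:
  "cmod (hankel_density \<omega> c f (s,t)) \<le>
     (\<Sum>\<^sub>\<infinity>l. cmod (c l)) * (indicator {0<..} s * indicator {0<..} t * (cmod (f s) / (sqrt t * (t + s))))"
proof (cases "s > 0 \<and> t > 0")
  case True
  then have "cmod (fourier_kernel \<omega> c (t + s)) \<le> (\<Sum>\<^sub>\<infinity>l. cmod (c l)) / (t + s)"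
    by (intro fourier_kernel_bound c_summable) auto
  then have "cmod (f s) * cmod (fourier_kernel \<omega> c (t + s)) / sqrt t \<le> cmod (f s) * ((\<Sum>\<^sub>\<infinity>l. cmod (c l)) / (t + s)) / sqrt t"
    using True by (intro divide_right_mono mult_left_mono) auto
  then show ?thesis using True by (simp add: hankel_density_def norm_mult norm_divide mult_ac)
qed (auto simp: hankel_density_def)

text \<open>The bound in \<open>density_bound\<close> need not be integrable by itself. A factor
  \<open>w\<close> for which w / sqrt t is dominated by a square integrable \<open>v\<close> brings
  it under \<open>hilbert_integrable\<close>. This is used with an indicator and with the window
  integral of the phase.\<close>

lemma density_mult_integrable:
  assumes v: "L2pos v" and w: "w \<in> borel_measurable borel"
    and le: "\<And>t. t > 0 \<Longrightarrow> cmod (w t) / sqrt t \<le> cmod (v t)"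
  shows "integrable (lborel \<Otimes>\<^sub>M lborel) (\<lambda>z. hankel_density \<omega> c f z * w (snd z))"
proof (rule Bochner_Integration.integrable_bound)
  let ?C = "\<Sum>\<^sub>\<infinity>l. cmod (c l)"
  let ?B = "\<lambda>(s,t). indicator {0<..} s * indicator {0<..} t * (cmod (f s) * cmod (v t) / (t + s))"
  have C0: "?C \<ge> 0" by (simp add: infsum_nonneg)
  show "integrable (lborel \<Otimes>\<^sub>M lborel) (\<lambda>z. ?C * ?B z)"
    by (intro integrable_mult_right hilbert_integrable f v)
  show "(\<lambda>z. hankel_density \<omega> c f z * w (snd z)) \<in> borel_measurable (lborel \<Otimes>\<^sub>M lborel)"
    using w by measurable
  show "AE z in lborel \<Otimes>\<^sub>M lborel. norm (hankel_density \<omega> c f z * w (snd z)) \<le> norm (?C * ?B z)"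
  proof (rule AE_I2)
    fix z :: "real \<times> real"
    obtain s t where z: "z = (s,t)" by fastforce
    show "norm (hankel_density \<omega> c f z * w (snd z)) \<le> norm (?C * ?B z)"
    proof (cases "s > 0 \<and> t > 0")
      case True
      have "cmod (hankel_density \<omega> c f (s,t)) * cmod (w t) \<le> (?C * (cmod (f s) / (sqrt t * (t + s)))) * cmod (w t)"
        using density_bound[of s t] True by (intro mult_right_mono) auto
      also have "\<dots> = ?C * (cmod (f s) / (t + s)) * (cmod (w t) / sqrt t)" by simp
      also have "\<dots> \<le> ?C * (cmod (f s) / (t + s)) * cmod (v t)"
        using True C0 le[of t] by (intro mult_left_mono) auto
      finally show ?thesis using True C0 by (simp add: z norm_mult abs_mult)
    qed (auto simp: z hankel_density_def)
  qed
qed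

lemma density_trunc_t_integrable:
  assumes R: "R > 0"
  shows "integrable (lborel \<Otimes>\<^sub>M lborel) (\<lambda>z. hankel_density \<omega> c f z * of_real (indicator (UNIV \<times> {1/R..R}) z))"
proof -
  have "L2pos (\<lambda>t. of_real (indicator {1/R..R} t / sqrt t))"
    unfolding L2pos_def
  proof
    show "set_integrable lborel {0<..} (\<lambda>t. (cmod (complex_of_real (indicator {1/R..R} t / sqrt t)))\<^sup>2)"
      unfolding set_integrable_def
    proof (rule Bochner_Integration.integrable_bound)
      show "integrable lborel (\<lambda>t. R * indicator {1/R..R} t)"
        by (intro integrable_mult_right integrable_indicator_Icc)
      have "1 / t \<le> R" if "1 / R \<le> t" "t > 0" for t using that R by (simp add: field_simps)
      then show "AE t in lborel. norm (indicat_real {0<..} t *\<^sub>R (cmod (complex_of_real (indicator {1/R..R} t / sqrt t)))\<^sup>2) \<le> norm (R * indicator {1/R..R} t)"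
        using R by (intro AE_I2) (auto simp: indicator_def power_divide norm_divide)
    qed measurable
  qed measurable
  from density_mult_integrable[OF this, of "\<lambda>t. of_real (indicator {1/R..R} t)"]
  have "integrable (lborel \<Otimes>\<^sub>M lborel) (\<lambda>z. hankel_density \<omega> c f z * of_real (indicator {1/R..R} (snd z)))"
    by (simp add: norm_divide)
  moreover have "indicator {1/R..R} (snd z) = (indicator (UNIV \<times> {1/R..R}) z :: real)" for z :: "real \<times> real"
    by (simp add: indicator_def mem_Times_iff)
  ultimately show ?thesis by simp
qed

text \<open>There is no cutoff in \<open>t\<close> here, but the \<open>t\<close>-integral of the
  bound is exactly pi / sqrt s, and |f(s)| / sqrt s is integrable on the window in
  \<open>s\<close>.\<close>

lemma density_trunc_s_integrable:
  assumes R: "R > 0"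
  shows "integrable (lborel \<Otimes>\<^sub>M lborel) (\<lambda>z. hankel_density \<omega> c f z * of_real (indicator ({1/R..R} \<times> UNIV) z))"
proof (rule Bochner_Integration.integrable_bound)
  let ?C = "\<Sum>\<^sub>\<infinity>l. cmod (c l)"
  define B where "B = (\<lambda>s t. (?C * (indicator {1/R..R} s * cmod (f s))) * (indicator {0<..} t * (1 / sqrt t / (t + s))))"
  have C0: "?C \<ge> 0" by (simp add: infsum_nonneg)
  have B0: "norm (B s t) = B s t" for s t
    using C0 pos_of_mem_window[OF R, of s] by (auto simp: B_def indicator_def abs_mult)
  have IB: "(\<integral>t. B s t \<partial>lborel) = ?C * pi * (indicator {1/R..R} s * (cmod (f s) / sqrt s))" for s
    unfolding B_def integral_mult_right_zero
    using hilbert_kernel_integral(2)[of s] pos_of_mem_window[OF R, of s] by (cases "s \<in> {1/R..R}") auto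
  show "integrable (lborel \<Otimes>\<^sub>M lborel) (case_prod B)"
  proof (rule lborel_pair.Fubini_integrable)
    show "case_prod B \<in> borel_measurable (lborel \<Otimes>\<^sub>M lborel)" unfolding B_def by measurable
    show "integrable lborel (\<lambda>s. \<integral>t. norm (case (s,t) of (s,t) \<Rightarrow> B s t) \<partial>lborel)"
      unfolding prod.case B0 IB by (intro integrable_mult_right trunc_weight_integrable f R)
    show "AE s in lborel. integrable lborel (\<lambda>t. case (s,t) of (s,t) \<Rightarrow> B s t)"
    proof (rule AE_I2)
      fix s
      show "integrable lborel (\<lambda>t. case (s,t) of (s,t) \<Rightarrow> B s t)"
        unfolding prod.case B_def
        by (rule integrable_mult_right, rule hilbert_kernel_integral(1), rule pos_of_mem_window[OF R])
          (auto simp: indicator_def split: if_splits)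
    qed
  qed
  have [measurable]: "{1/R..R} \<times> UNIV \<in> sets (lborel \<Otimes>\<^sub>M lborel :: (real \<times> real) measure)" by simp
  show "(\<lambda>z. hankel_density \<omega> c f z * of_real (indicator ({1/R..R} \<times> UNIV) z)) \<in> borel_measurable (lborel \<Otimes>\<^sub>M lborel)"
    by measurable
  show "AE z in lborel \<Otimes>\<^sub>M lborel. norm (hankel_density \<omega> c f z * of_real (indicator ({1/R..R} \<times> UNIV) z)) \<le> norm (case_prod B z)"
  proof (rule AE_I2)
    fix z :: "real \<times> real"
    obtain s t where z: "z = (s,t)" by fastforce
    show "norm (hankel_density \<omega> c f z * of_real (indicator ({1/R..R} \<times> UNIV) z)) \<le> norm (case_prod B z)"
    proof (cases "s \<in> {1/R..R}")
      case True
      then show ?thesis using density_bound[of s t] pos_of_mem_window[OF R True]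
        unfolding z prod.case B0 by (simp add: B_def mult_ac)
    qed (simp add: z)
  qed
qed

lemma integrable_mult_phase:
  assumes "integrable (lborel \<Otimes>\<^sub>M lborel) \<phi>"
  shows "integrable (lborel \<Otimes>\<^sub>M lborel) (\<lambda>z. \<phi> z * phase \<omega> n k (snd z))"
proof (rule Bochner_Integration.integrable_bound[OF assms])
  show "(\<lambda>z. \<phi> z * phase \<omega> n k (snd z)) \<in> borel_measurable (lborel \<Otimes>\<^sub>M lborel)"
    using borel_measurable_integrable[OF assms] unfolding phase_def by measurable
qed (simp add: norm_mult cmod_phase)

text \<open>Integrating over \<open>s\<close> first restores the Hankel integral at
  \<open>t\<close>; the factor t^(-1/2) of the density and the phase recombine to the Mellin
  kernel.\<close>

lemma Utrunc_hankel_eq: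
  assumes R: "R > 0"
    and h: "\<And>t. t > 0 \<Longrightarrow> h t = (LINT s:{0<..}|lborel. fourier_kernel \<omega> c (t + s) * f s)"
  shows "of_real (sqrt (2 * pi)) * Utrunc \<omega> h R k n =
    (\<integral>z. (hankel_density \<omega> c f z * of_real (indicator (UNIV \<times> {1/R..R}) z)) * phase \<omega> n k (snd z) \<partial>(lborel \<Otimes>\<^sub>M lborel))"
proof -
  let ?G = "\<lambda>s t. (hankel_density \<omega> c f (s,t) * of_real (indicator {1/R..R} t)) * phase \<omega> n k t"
  have int: "integrable (lborel \<Otimes>\<^sub>M lborel) (case_prod ?G)"
    using integrable_mult_phase[OF density_trunc_t_integrable[OF R], of k]
    by (simp add: case_prod_unfold indicator_def mem_Times_iff)
  have inner: "(\<integral>s. ?G s t \<partial>lborel) = indicator {1/R..R} t *\<^sub>R (h t * rpow t (- (1/2) - \<i> * of_real (\<omega> * of_int n + k)))" for t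
  proof (cases "t \<in> {1/R..R}")
    case True
    then have t: "t > 0" by (rule pos_of_mem_window[OF R])
    have "(\<integral>s. ?G s t \<partial>lborel) = (\<integral>s. (phase \<omega> n k t / of_real (sqrt t)) * (indicator {0<..} s *\<^sub>R (fourier_kernel \<omega> c (t + s) * f s)) \<partial>lborel)"
      using t True by (intro Bochner_Integration.integral_cong refl) (simp add: hankel_density_def indicator_def)
    also have "\<dots> = (phase \<omega> n k t / of_real (sqrt t)) * h t"
      unfolding integral_mult_right_zero h[OF t] set_lebesgue_integral_def ..
    finally show ?thesis using True unfolding rpow_eq_phase[OF t] by (simp add: mult.commute)
  qed simp
  have "(\<integral>z. (hankel_density \<omega> c f z * of_real (indicator (UNIV \<times> {1/R..R}) z)) * phase \<omega> n k (snd z) \<partial>(lborel \<Otimes>\<^sub>M lborel)) =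
      (\<integral>z. case_prod ?G z \<partial>(lborel \<Otimes>\<^sub>M lborel))"
    by (intro Bochner_Integration.integral_cong refl) (simp add: case_prod_unfold indicator_def mem_Times_iff)
  also have "\<dots> = (\<integral>t. (\<integral>s. ?G s t \<partial>lborel) \<partial>lborel)" by (rule lborel_pair.integral_snd[OF int, symmetric])
  also have "\<dots> = of_real (sqrt (2 * pi)) * Utrunc \<omega> h R k n"
    unfolding inner Utrunc_eq_rpow[OF R] by simp
  finally show ?thesis by simp
qed

text \<open>With the cutoff in \<open>s\<close>, integrating over \<open>t\<close> first produces
  the Mellin transform of the kernel, a sum over \<open>m\<close> weighted by row \<open>n\<close>
  of the fiber matrix. Absolute summability of that row allows the sum to leave the remaining
  \<open>s\<close>-integral.\<close>

lemma mat_apply_Utrunc_eq: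
  assumes R: "R > 0" and k: "k \<in> Omega \<omega>"
  shows "of_real (sqrt (2 * pi)) * mat_apply (Hfiber \<omega> c k) (Utrunc \<omega> f R k) n =
    (\<integral>z. (hankel_density \<omega> c f z * of_real (indicator ({1/R..R} \<times> UNIV) z)) * phase \<omega> n k (snd z) \<partial>(lborel \<Otimes>\<^sub>M lborel))"
proof -
  let ?G = "\<lambda>s t. (hankel_density \<omega> c f (s,t) * of_real (indicator {1/R..R} s)) * phase \<omega> n k t"
  define r where "r = (\<lambda>m s. rpow s (- (1/2) - \<i> * of_real (\<omega> * of_int m + k)))"
  define F where "F = (\<lambda>m s. indicator {1/R..R} s *\<^sub>R (f s * (Hfiber \<omega> c k n m * r m s)))"
  have int: "integrable (lborel \<Otimes>\<^sub>M lborel) (case_prod ?G)"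
    using integrable_mult_phase[OF density_trunc_s_integrable[OF R], of k]
    by (simp add: case_prod_unfold indicator_def mem_Times_iff)
  have inner: "(\<integral>t. ?G s t \<partial>lborel) = (\<Sum>\<^sub>\<infinity>m. F m s)" for s
  proof (cases "s \<in> {1/R..R}")
    case True
    then have s: "s > 0" by (rule pos_of_mem_window[OF R])
    have "(\<integral>t. ?G s t \<partial>lborel) = (\<integral>t. f s * (indicator {0<..} t *\<^sub>R (fourier_kernel \<omega> c (t + s) * rpow t (- (1/2) - \<i> * of_real (\<omega> * of_int n + k)))) \<partial>lborel)"
    proof (intro Bochner_Integration.integral_cong refl)
      fix t
      show "?G s t = f s * (indicator {0<..} t *\<^sub>R (fourier_kernel \<omega> c (t + s) * rpow t (- (1/2) - \<i> * of_real (\<omega> * of_int n + k))))"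
        using s True rpow_eq_phase[of t \<omega> n k] by (cases "t > 0") (simp_all add: hankel_density_def indicator_def)
    qed
    also have "\<dots> = f s * (\<Sum>\<^sub>\<infinity>m. Hfiber \<omega> c k n m * r m s)"
      unfolding integral_mult_right_zero mellin_fourier_kernel[OF c_summable s] r_def ..
    also have "\<dots> = (\<Sum>\<^sub>\<infinity>m. F m s)" using True by (simp add: F_def infsum_cmult_right')
    finally show ?thesis .
  qed (simp add: F_def)
  have Fr: "F m s = Hfiber \<omega> c k n m * (indicator {1/R..R} s *\<^sub>R (f s * r m s))" for m s
    by (simp add: F_def mult_ac)
  have "(\<integral>z. (hankel_density \<omega> c f z * of_real (indicator ({1/R..R} \<times> UNIV) z)) * phase \<omega> n k (snd z) \<partial>(lborel \<Otimes>\<^sub>M lborel)) =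
      (\<integral>z. case_prod ?G z \<partial>(lborel \<Otimes>\<^sub>M lborel))"
    by (intro Bochner_Integration.integral_cong refl) (simp add: case_prod_unfold indicator_def mem_Times_iff)
  also have "\<dots> = (\<integral>s. (\<integral>t. ?G s t \<partial>lborel) \<partial>lborel)" by (rule lborel_pair.integral_fst[OF int, symmetric])
  also have "\<dots> = (\<Sum>\<^sub>\<infinity>m. \<integral>s. F m s \<partial>lborel)"
    unfolding inner
  proof (rule integral_infsum_int(2)[OF sigma_finite_lborel _ abs_summable_matrix_rows(1)[OF Hfiber_abs_summable[OF \<omega> k c4]] trunc_weight_integrable[OF f R]])
    show "F m \<in> borel_measurable lborel" for m unfolding F_def r_def by measurable
    show "cmod (F m s) \<le> cmod (Hfiber \<omega> c k n m) * (indicator {1/R..R} s * (cmod (f s) / sqrt s))" for m s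
      unfolding Fr r_def norm_mult trunc_integrand_bound[OF R] by simp
  qed
  also have "\<dots> = (\<Sum>\<^sub>\<infinity>m. of_real (sqrt (2 * pi)) * (Hfiber \<omega> c k n m * Utrunc \<omega> f R k m))"
    unfolding Fr integral_mult_right_zero Utrunc_eq_rpow[OF R] r_def by (simp add: mult_ac)
  also have "\<dots> = of_real (sqrt (2 * pi)) * mat_apply (Hfiber \<omega> c k) (Utrunc \<omega> f R k) n"
    by (simp add: infsum_cmult_right' mat_apply_def)
  finally show ?thesis by simp
qed

text \<open>The limit does not mention \<open>A\<close>, so different exhaustions of the quadrant
  lead to one and the same double integral. For each \<open>j\<close> the integral over
  \<open>k\<close> is moved onto the phase; the resulting product is integrable without any cutoff,
  and dominated convergence removes \<open>A j\<close>.\<close>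

lemma window_integral_limits:
  fixes A :: "nat \<Rightarrow> (real \<times> real) set"
  assumes ab: "a \<le> b"
    and A: "\<And>j. A j \<in> sets (lborel \<Otimes>\<^sub>M lborel)"
    and int: "\<And>j. integrable (lborel \<Otimes>\<^sub>M lborel) (\<lambda>z. hankel_density \<omega> c f z * of_real (indicator (A j) z))"
    and ev: "\<And>s t. s > 0 \<Longrightarrow> t > 0 \<Longrightarrow> \<forall>\<^sub>F j in sequentially. (s,t) \<in> A j"
  defines "V \<equiv> \<lambda>j k. \<integral>z. (hankel_density \<omega> c f z * of_real (indicator (A j) z)) * phase \<omega> n k (snd z) \<partial>(lborel \<Otimes>\<^sub>M lborel)"
  shows "set_integrable lborel {a..b} (V j)"
    and "(\<lambda>j. LINT k:{a..b}|lborel. V j k) \<longlonglongrightarrow>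
      (\<integral>z. hankel_density \<omega> c f z * (LINT k:{a..b}|lborel. phase \<omega> n k (snd z)) \<partial>(lborel \<Otimes>\<^sub>M lborel))"
proof -
  define \<Phi> where "\<Phi> = (\<lambda>t. LINT k:{a..b}|lborel. phase \<omega> n k t)"
  have sf: "sigma_finite_measure (lborel \<Otimes>\<^sub>M lborel :: (real \<times> real) measure)"
    unfolding lborel_prod by (rule sigma_finite_lborel)
  have me: "(\<lambda>(k,z). phase \<omega> n k (snd z)) \<in> borel_measurable (lborel \<Otimes>\<^sub>M (lborel \<Otimes>\<^sub>M lborel :: (real \<times> real) measure))"
    unfolding phase_def by measurable
  note sw = integral_parameter_swap[OF sf int me]
  show "set_integrable lborel {a..b} (V j)"
    unfolding V_def by (rule sw(1)) (simp add: cmod_phase)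
  have m\<Phi>: "\<Phi> \<in> borel_measurable borel"
  proof -
    have "(\<lambda>(t,k). indicator {a..b} k *\<^sub>R phase \<omega> n k t) \<in> borel_measurable (borel \<Otimes>\<^sub>M lborel)"
      unfolding phase_def by measurable
    then show ?thesis unfolding \<Phi>_def set_lebesgue_integral_def
      by (rule lborel.borel_measurable_lebesgue_integral)
  qed
  \<comment> \<open>The window integral of the phase decays like 1 / |ln t|, which is what makes
    t^(-1/2) square integrable.\<close>
  have L: "L2pos (\<lambda>t. \<Phi> t / of_real (sqrt t))"
  proof (rule L2pos_log_decay[OF m\<Phi>])
    show "(cmod (\<Phi> t))\<^sup>2 * (1 + (ln t)\<^sup>2) \<le> (b - a)\<^sup>2 + 4" for t
      unfolding \<Phi>_def phase_def by (rule integral_exp_window[OF ab])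
  qed
  have i\<Phi>: "integrable (lborel \<Otimes>\<^sub>M lborel) (\<lambda>z. hankel_density \<omega> c f z * \<Phi> (snd z))"
    by (rule density_mult_integrable[OF L m\<Phi>]) (simp add: norm_divide)
  have "(\<lambda>j. \<integral>z. hankel_density \<omega> c f z * \<Phi> (snd z) * of_real (indicator (A j) z) \<partial>(lborel \<Otimes>\<^sub>M lborel)) \<longlonglongrightarrow>
      (\<integral>z. hankel_density \<omega> c f z * \<Phi> (snd z) \<partial>(lborel \<Otimes>\<^sub>M lborel))"
  proof (rule truncation_limit[OF i\<Phi> A])
    fix z :: "real \<times> real" assume "hankel_density \<omega> c f z * \<Phi> (snd z) \<noteq> 0"
    then have "fst z > 0" "snd z > 0" by (auto simp: hankel_density_def case_prod_unfold indicator_def split: if_splits)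
    from ev[OF this] show "\<forall>\<^sub>F j in sequentially. z \<in> A j" by simp
  qed
  moreover have "(LINT k:{a..b}|lborel. V j k) =
      (\<integral>z. hankel_density \<omega> c f z * \<Phi> (snd z) * of_real (indicator (A j) z) \<partial>(lborel \<Otimes>\<^sub>M lborel))" for j
  proof -
    have "(LINT k:{a..b}|lborel. V j k) = (\<integral>z. (hankel_density \<omega> c f z * of_real (indicator (A j) z)) * \<Phi> (snd z) \<partial>(lborel \<Otimes>\<^sub>M lborel))"
      unfolding V_def \<Phi>_def by (rule sw(2)) (simp add: cmod_phase)
    then show ?thesis by (simp add: mult_ac)
  qed
  ultimately show "(\<lambda>j. LINT k:{a..b}|lborel. V j k) \<longlonglongrightarrow>
      (\<integral>z. hankel_density \<omega> c f z * (LINT k:{a..b}|lborel. phase \<omega> n k (snd z)) \<partial>(lborel \<Otimes>\<^sub>M lborel))"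
    by (simp add: \<Phi>_def)
qed

lemma hankel_window_integral:
  assumes ab: "a \<le> b" "- \<omega> / 2 \<le> a" "b \<le> \<omega> / 2"
    and h: "\<And>t. t > 0 \<Longrightarrow> h t = (LINT s:{0<..}|lborel. fourier_kernel \<omega> c (t + s) * f s)"
    and g': "Ueq \<omega> h g'"
  shows "set_integrable lborel {a..b} (\<lambda>k. g' k n)"
    and "(LINT k:{a..b}|lborel. g' k n) = (1 / of_real (sqrt (2 * pi))) *
      (\<integral>z. hankel_density \<omega> c f z * (LINT k:{a..b}|lborel. phase \<omega> n k (snd z)) \<partial>(lborel \<Otimes>\<^sub>M lborel))"
proof -
  let ?A = "\<lambda>j. UNIV \<times> {1 / real (Suc j)..real (Suc j)} :: (real \<times> real) set"
  define V where "V = (\<lambda>j k. \<integral>z. (hankel_density \<omega> c f z * of_real (indicator (?A j) z)) * phase \<omega> n k (snd z) \<partial>(lborel \<Otimes>\<^sub>M lborel))"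
  define U where "U = (\<lambda>j k. Utrunc \<omega> h (real (Suc j)) k n)"
  have UV: "U j k = (1 / of_real (sqrt (2 * pi))) * V j k" for j k
    using Utrunc_hankel_eq[of "real (Suc j)" h k] h unfolding U_def V_def by (simp add: field_simps)
  have A: "?A j \<in> sets (lborel \<Otimes>\<^sub>M lborel)" for j by simp
  have R: "real (Suc j) > 0" for j by simp
  have ev: "\<forall>\<^sub>F j in sequentially. (s,t) \<in> ?A j" if "t > 0" for s t
    using eventually_mem_window[OF that] by simp
  note lims = window_integral_limits[OF ab(1) A density_trunc_t_integrable[OF R] ev]
  have V_int: "set_integrable lborel {a..b} (V j)" for j
    unfolding V_def by (rule lims(1))
  have V_lim: "(\<lambda>j. LINT k:{a..b}|lborel. V j k) \<longlonglongrightarrow>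
      (\<integral>z. hankel_density \<omega> c f z * (LINT k:{a..b}|lborel. phase \<omega> n k (snd z)) \<partial>(lborel \<Otimes>\<^sub>M lborel))"
    unfolding V_def by (rule lims(2))
  have iU: "set_integrable lborel {a..b} (U j)" for j
    unfolding UV by (rule set_integrable_mult_right, rule V_int)
  have m: "(\<lambda>k. g' k n) \<in> borel_measurable borel" using g' by (simp add: Ueq_def)
  have lim: "(\<lambda>j. \<integral>\<^sup>+k. indicator {a..b} k * ennreal ((cmod (U j k - g' k n))\<^sup>2) \<partial>lborel) \<longlonglongrightarrow> 0"
  proof (rule tendsto_sandwich[OF _ _ tendsto_const Ueq_sequence[OF g']])
    show "\<forall>\<^sub>F j in sequentially. (\<integral>\<^sup>+k. indicator {a..b} k * ennreal ((cmod (U j k - g' k n))\<^sup>2) \<partial>lborel) \<le>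
      (\<integral>\<^sup>+k. indicator (Omega \<omega>) k * (\<Sum>\<^sub>\<infinity> m. ennreal ((cmod (Utrunc \<omega> h (real (Suc j)) k m - g' k m))\<^sup>2)) \<partial>lborel)"
      unfolding U_def
      by (intro always_eventually allI nn_integral_window_le_Omega ab ennreal_component_le_infsum[of _ n])
  qed simp
  note L = L2_limit_interval_integral[OF ab(1) iU m lim]
  show "set_integrable lborel {a..b} (\<lambda>k. g' k n)" by (rule L(1))
  have "(\<lambda>j. LINT k:{a..b}|lborel. U j k) \<longlonglongrightarrow> (1 / of_real (sqrt (2 * pi))) *
      (\<integral>z. hankel_density \<omega> c f z * (LINT k:{a..b}|lborel. phase \<omega> n k (snd z)) \<partial>(lborel \<Otimes>\<^sub>M lborel))"
    unfolding UV set_integral_mult_right by (intro tendsto_mult tendsto_const V_lim)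
  from LIMSEQ_unique[OF L(2) this] show "(LINT k:{a..b}|lborel. g' k n) = (1 / of_real (sqrt (2 * pi))) *
      (\<integral>z. hankel_density \<omega> c f z * (LINT k:{a..b}|lborel. phase \<omega> n k (snd z)) \<partial>(lborel \<Otimes>\<^sub>M lborel))" .
qed

text \<open>Mean-square convergence of the truncated transforms of \<open>f\<close> survives the
  application of row \<open>n\<close>, because its absolute sums are bounded uniformly in
  \<open>k\<close>.\<close>

lemma mat_apply_window_integral:
  assumes ab: "a \<le> b" "- \<omega> / 2 \<le> a" "b \<le> \<omega> / 2" and g: "Ueq \<omega> f g"
  shows "set_integrable lborel {a..b} (\<lambda>k. mat_apply (Hfiber \<omega> c k) (g k) n)"
    and "(LINT k:{a..b}|lborel. mat_apply (Hfiber \<omega> c k) (g k) n) = (1 / of_real (sqrt (2 * pi))) *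
      (\<integral>z. hankel_density \<omega> c f z * (LINT k:{a..b}|lborel. phase \<omega> n k (snd z)) \<partial>(lborel \<Otimes>\<^sub>M lborel))"
proof -
  let ?A = "\<lambda>j. {1 / real (Suc j)..real (Suc j)} \<times> UNIV :: (real \<times> real) set"
  define V where "V = (\<lambda>j k. \<integral>z. (hankel_density \<omega> c f z * of_real (indicator (?A j) z)) * phase \<omega> n k (snd z) \<partial>(lborel \<Otimes>\<^sub>M lborel))"
  \<comment> \<open>A uniform bound for the absolute sums of row \<open>n\<close>, with 1 added to
    make it positive. Dividing by \<open>w\<close> makes the error of the row at most the l2 error
    of its argument, so the integrand in \<open>Ueq\<close> dominates with constant 1.\<close>
  define w where "w = (\<Sum>\<^sub>\<infinity>m. fiber_major \<omega> c n m) + 1"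
  have fm: "(\<lambda>m. fiber_major \<omega> c n m) summable_on UNIV"
    using summable_on_SigmaD1[of "\<lambda>n m. fiber_major \<omega> c n m" UNIV "\<lambda>_. UNIV" n] fiber_major_summable[OF \<omega> c4] by simp
  have fm0: "fiber_major \<omega> c n m \<ge> 0" for m by (simp add: fiber_major_def beta_major_nonneg[OF \<omega>])
  have w: "w > 0" unfolding w_def using infsum_nonneg[of UNIV "\<lambda>m. fiber_major \<omega> c n m"] fm0 by simp
  define U where "U = (\<lambda>j k. (1 / of_real w) * ((1 / of_real (sqrt (2 * pi))) * V j k))"
  define v where "v = (\<lambda>k. mat_apply (Hfiber \<omega> c k) (g k) n)"
  have UV: "U j k = (1 / of_real w) * mat_apply (Hfiber \<omega> c k) (Utrunc \<omega> f (real (Suc j)) k) n" if "k \<in> Omega \<omega>" for j k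
  proof -
    have "V j k = of_real (sqrt (2 * pi)) * mat_apply (Hfiber \<omega> c k) (Utrunc \<omega> f (real (Suc j)) k) n"
      unfolding V_def by (rule mat_apply_Utrunc_eq[symmetric, OF _ that]) simp
    then show ?thesis unfolding U_def by simp
  qed
  have A: "?A j \<in> sets (lborel \<Otimes>\<^sub>M lborel)" for j by simp
  have R: "real (Suc j) > 0" for j by simp
  have ev: "\<forall>\<^sub>F j in sequentially. (s,t) \<in> ?A j" if "s > 0" for s t
    using eventually_mem_window[OF that] by simp
  note lims = window_integral_limits[OF ab(1) A density_trunc_s_integrable[OF R] ev]
  have V_int: "set_integrable lborel {a..b} (V j)" for j
    unfolding V_def by (rule lims(1))
  have V_lim: "(\<lambda>j. LINT k:{a..b}|lborel. V j k) \<longlonglongrightarrow>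
      (\<integral>z. hankel_density \<omega> c f z * (LINT k:{a..b}|lborel. phase \<omega> n k (snd z)) \<partial>(lborel \<Otimes>\<^sub>M lborel))"
    unfolding V_def by (rule lims(2))
  have iU: "set_integrable lborel {a..b} (U j)" for j
    unfolding U_def by (intro set_integrable_mult_right V_int)
  have gm: "(\<lambda>k. g k m) \<in> borel_measurable borel" for m using g by (simp add: Ueq_def)
  have mv: "v \<in> borel_measurable borel"
    unfolding v_def mat_apply_def
    by (intro borel_measurable_infsum_int[of "\<lambda>m k. Hfiber \<omega> c k n m * g k m"] borel_measurable_times gm
        borel_measurable_continuous_onI Hfiber_continuous)
  have row: "(\<Sum>\<^sub>\<infinity>m. cmod (Hfiber \<omega> c k n m)) \<le> w" if k: "k \<in> Omega \<omega>" for k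
    using infsum_mono[OF abs_summable_matrix_rows(1)[OF Hfiber_abs_summable[OF \<omega> k c4]] fm Hfiber_le_major[OF \<omega> k]]
    unfolding w_def by simp
  have le: "ennreal ((cmod (U j k - (1 / of_real w) * v k))\<^sup>2) \<le>
      (\<Sum>\<^sub>\<infinity> m. ennreal ((cmod (Utrunc \<omega> f (real (Suc j)) k m - g k m))\<^sup>2))" if k: "k \<in> Omega \<omega>" for j k
  proof (cases "(\<Sum>\<^sub>\<infinity> m. ennreal ((cmod (Utrunc \<omega> f (real (Suc j)) k m - g k m))\<^sup>2))")
    \<comment> \<open>An infinite sum makes the claim trivial; a finite value \<open>E\<close>
      bounds every component of the error by \<open>sqrt E\<close>.\<close>
    case (real E)
    define x where "x = Utrunc \<omega> f (real (Suc j)) k"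
    note sm = Hfiber_abs_summable[OF \<omega> k c4]
    have d: "cmod (x m - g k m) \<le> sqrt E" for m
    proof -
      have "ennreal ((cmod (x m - g k m))\<^sup>2) \<le> ennreal E"
        unfolding real(2)[symmetric] x_def by (rule ennreal_component_le_infsum[of "\<lambda>m. ennreal ((cmod (Utrunc \<omega> f (real (Suc j)) k m - g k m))\<^sup>2)"])
      then have "(cmod (x m - g k m))\<^sup>2 \<le> E" using real(1) by simp
      then show ?thesis by (rule real_le_rsqrt)
    qed
    obtain B where B: "\<And>m. cmod (x m) \<le> B" unfolding x_def using Utrunc_bound[OF f R] by blast
    \<comment> \<open>\<open>g k\<close> inherits boundedness from the truncated transform, so the
      row applied to it converges absolutely and the difference may be taken termwise.\<close>
    have gB: "cmod (g k m) \<le> B + sqrt E" for m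
      using norm_triangle_ineq4[of "x m" "x m - g k m"] B[of m] d[of m] by simp
    have sx: "(\<lambda>m. Hfiber \<omega> c k n m * x m) summable_on UNIV"
      by (rule abs_summable_summable[OF abs_summable_row_mult(1)[OF sm B]])
    have sg: "(\<lambda>m. Hfiber \<omega> c k n m * g k m) summable_on UNIV"
      by (rule abs_summable_summable[OF abs_summable_row_mult(1)[OF sm gB]])
    have "mat_apply (Hfiber \<omega> c k) x n - v k = mat_apply (Hfiber \<omega> c k) (\<lambda>m. x m - g k m) n"
    proof -
      have "((\<lambda>m. Hfiber \<omega> c k n m * x m + (- 1) * (Hfiber \<omega> c k n m * g k m)) has_sum
          (mat_apply (Hfiber \<omega> c k) x n + (- 1) * v k)) UNIV"
        unfolding v_def mat_apply_def by (intro has_sum_add has_sum_cmult_right has_sum_infsum sx sg)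
      from infsumI[OF this] show ?thesis by (simp add: mat_apply_def right_diff_distrib)
    qed
    then have "cmod (mat_apply (Hfiber \<omega> c k) x n - v k) \<le> (\<Sum>\<^sub>\<infinity>m. cmod (Hfiber \<omega> c k n m)) * sqrt E"
      using abs_summable_row_mult(2)[OF sm d] by simp
    also have "\<dots> \<le> w * sqrt E" using row[OF k] real(1) by (intro mult_right_mono) auto
    finally have "cmod ((1 / of_real w) * (mat_apply (Hfiber \<omega> c k) x n - v k)) \<le> sqrt E"
      using w by (simp add: norm_divide divide_le_eq mult.commute)
    then have "(cmod (U j k - (1 / of_real w) * v k))\<^sup>2 \<le> (sqrt E)\<^sup>2"
      unfolding UV[OF k] x_def[symmetric] right_diff_distrib[symmetric] by (intro power_mono) auto
    then show ?thesis unfolding real(2) using real(1) by (intro ennreal_leI) simp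
  qed simp
  have lim: "(\<lambda>j. \<integral>\<^sup>+k. indicator {a..b} k * ennreal ((cmod (U j k - (1 / of_real w) * v k))\<^sup>2) \<partial>lborel) \<longlonglongrightarrow> 0"
  proof (rule tendsto_sandwich[OF _ _ tendsto_const Ueq_sequence[OF g]])
    show "\<forall>\<^sub>F j in sequentially. (\<integral>\<^sup>+k. indicator {a..b} k * ennreal ((cmod (U j k - (1 / of_real w) * v k))\<^sup>2) \<partial>lborel) \<le>
      (\<integral>\<^sup>+k. indicator (Omega \<omega>) k * (\<Sum>\<^sub>\<infinity> m. ennreal ((cmod (Utrunc \<omega> f (real (Suc j)) k m - g k m))\<^sup>2)) \<partial>lborel)"
      by (intro always_eventually allI nn_integral_window_le_Omega ab le)
  qed simp
  have mv': "(\<lambda>k. (1 / of_real w) * v k) \<in> borel_measurable borel" using mv by measurable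
  note L = L2_limit_interval_integral[OF ab(1) iU mv' lim]
  show "set_integrable lborel {a..b} (\<lambda>k. mat_apply (Hfiber \<omega> c k) (g k) n)"
    using set_integrable_mult_right[OF L(1), of "of_real w"] w by (simp add: v_def)
  have "(\<lambda>j. LINT k:{a..b}|lborel. U j k) \<longlonglongrightarrow> (1 / of_real w) * ((1 / of_real (sqrt (2 * pi))) *
      (\<integral>z. hankel_density \<omega> c f z * (LINT k:{a..b}|lborel. phase \<omega> n k (snd z)) \<partial>(lborel \<Otimes>\<^sub>M lborel)))"
    unfolding U_def set_integral_mult_right by (intro tendsto_mult tendsto_const V_lim)
  from LIMSEQ_unique[OF L(2) this] w show "(LINT k:{a..b}|lborel. mat_apply (Hfiber \<omega> c k) (g k) n) = (1 / of_real (sqrt (2 * pi))) *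
      (\<integral>z. hankel_density \<omega> c f z * (LINT k:{a..b}|lborel. phase \<omega> n k (snd z)) \<partial>(lborel \<Otimes>\<^sub>M lborel))"
    unfolding set_integral_mult_right v_def mult_cancel_left by auto
qed

text \<open>Both window integrals equal the same double integral, so the difference integrates to 0
  over every subinterval and \<open>AE_zero_of_interval_integrals\<close> applies.\<close>

lemma fiber_component_AE:
  assumes h: "\<And>t. t > 0 \<Longrightarrow> h t = (LINT s:{0<..}|lborel. fourier_kernel \<omega> c (t + s) * f s)"
    and g: "Ueq \<omega> f g" and g': "Ueq \<omega> h g'"
  shows "AE k in lborel. k \<in> Omega \<omega> \<longrightarrow> g' k n = mat_apply (Hfiber \<omega> c k) (g k) n"
proof -
  have o: "- \<omega> / 2 \<le> \<omega> / 2" using \<omega> by simp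
  have "AE k in lborel. k \<in> {- \<omega> / 2..\<omega> / 2} \<longrightarrow> g' k n - mat_apply (Hfiber \<omega> c k) (g k) n = 0"
  proof (rule AE_zero_of_interval_integrals)
    show "set_integrable lborel {- \<omega> / 2..\<omega> / 2} (\<lambda>k. g' k n - mat_apply (Hfiber \<omega> c k) (g k) n)"
      by (rule set_integral_diff(1)[OF hankel_window_integral(1)[OF o order_refl order_refl h g'] mat_apply_window_integral(1)[OF o order_refl order_refl g]])
    fix a b assume ab: "- \<omega> / 2 \<le> a" "a \<le> b" "b \<le> \<omega> / 2"
    have "(LINT k:{a..b}|lborel. g' k n) = (LINT k:{a..b}|lborel. mat_apply (Hfiber \<omega> c k) (g k) n)"
      by (rule trans[OF hankel_window_integral(2)[OF ab(2,1,3) h g'] mat_apply_window_integral(2)[OF ab(2,1,3) g, symmetric]])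
    moreover have "(LINT k:{a..b}|lborel. g' k n - mat_apply (Hfiber \<omega> c k) (g k) n) =
        (LINT k:{a..b}|lborel. g' k n) - (LINT k:{a..b}|lborel. mat_apply (Hfiber \<omega> c k) (g k) n)"
      by (rule set_integral_diff(2)[OF hankel_window_integral(1)[OF ab(2,1,3) h g'] mat_apply_window_integral(1)[OF ab(2,1,3) g]])
    ultimately show "(LINT k:{a..b}|lborel. g' k n - mat_apply (Hfiber \<omega> c k) (g k) n) = 0" by simp
  qed
  then show ?thesis by eventually_elim (auto simp: Omega_def)
qed

end

theorem theorem2p4:
  fixes T :: real and p :: "real \<Rightarrow> real"
  assumes T_pos: "T > 0"
    and p_periodic: "\<forall>x. p (x + T) = p x"
    and p_meas: "p \<in> borel_measurable lborel"
    and p_int: "set_integrable lborel {0..T} p"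
    and p_coef: "(\<lambda>l::int. cmod (fcoef T p l) * (1 + (real_of_int l)\<^sup>2) powr (1/4)) summable_on UNIV"
  shows
    "(\<forall>f g g'. L2pos f \<longrightarrow> Ueq (2 * pi / T) f g \<longrightarrow> Ueq (2 * pi / T) (hankel p f) g' \<longrightarrow>
        (AE k in lborel. k \<in> Omega (2 * pi / T) \<longrightarrow>
            g' k = mat_apply (Hfiber (2 * pi / T) (fcoef T p) k) (g k)))
     \<and> (\<forall>k \<in> Omega (2 * pi / T). trace_class (Hfiber (2 * pi / T) (fcoef T p) k))
     \<and> (\<forall>k \<in> Omega (2 * pi / T). \<forall>\<epsilon>>0. \<exists>\<delta>>0. \<forall>k' \<in> Omega (2 * pi / T). \<bar>k' - k\<bar> < \<delta> \<longrightarrow>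
          trace_norm (\<lambda>n m. Hfiber (2 * pi / T) (fcoef T p) k' n m
                             - Hfiber (2 * pi / T) (fcoef T p) k n m) < ereal \<epsilon>)"
proof (intro conjI allI impI ballI)
  let ?\<omega> = "2 * pi / T" and ?c = "fcoef T p"
  have \<omega>: "?\<omega> > 0" using T_pos by simp
  fix f g g'
  assume f: "L2pos f" and g: "Ueq ?\<omega> f g" and g': "Ueq ?\<omega> (hankel p f) g'"
  have fm: "f \<in> borel_measurable lborel" using f by (simp add: L2pos_def)
  have h: "hankel p f t = (LINT s:{0<..}|lborel. fourier_kernel ?\<omega> ?c (t + s) * f s)" if "t > 0" for t
    by (rule hankel_eq_fourier_kernel[OF T_pos p_periodic p_meas p_int weighted_summable_imp_abs_summable[OF p_coef] fm that])
  \<comment> \<open>There are countably many components, so their exceptional null sets can be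
    united.\<close>
  have "AE k in lborel. \<forall>n. k \<in> Omega ?\<omega> \<longrightarrow> g' k n = mat_apply (Hfiber ?\<omega> ?c k) (g k) n"
    unfolding AE_all_countable by (intro allI fiber_component_AE[OF \<omega> p_coef f h g g'])
  then show "AE k in lborel. k \<in> Omega ?\<omega> \<longrightarrow> g' k = mat_apply (Hfiber ?\<omega> ?c k) (g k)"
    by eventually_elim auto
next
  fix k assume "k \<in> Omega (2 * pi / T)"
  then show "trace_class (Hfiber (2 * pi / T) (fcoef T p) k)"
    using T_pos by (intro trace_class_of_abs_summable Hfiber_abs_summable p_coef) auto
next
  fix k \<epsilon> :: real assume "k \<in> Omega (2 * pi / T)" "\<epsilon> > 0"
  then show "\<exists>\<delta>>0. \<forall>k' \<in> Omega (2 * pi / T). \<bar>k' - k\<bar> < \<delta> \<longrightarrow>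
          trace_norm (\<lambda>n m. Hfiber (2 * pi / T) (fcoef T p) k' n m
                             - Hfiber (2 * pi / T) (fcoef T p) k n m) < ereal \<epsilon>"
    using T_pos
    by (intro trace_norm_continuous_of_majorant[OF fiber_major_summable[of "2 * pi / T", OF _ p_coef]]
        Hfiber_le_major Hfiber_continuous) auto
qed

end
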